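(* Let $\kappa\colon\mathbb R^d\to(0,\infty)$ be bounded and continuous with $\sup_{x\in\mathbb R^d}\sup_{|y|\le1}\frac{\kappa(x)}{\kappa(x-y)}<\infty$, let $(h_n)_{n\in\mathbb N}\subset(0,\infty)$ with $h_n\to0$, let $\mathcal T\subset[0,\infty)$ be a countable dense set with $0\in\mathcal T$, and let $(I(t))_{t\ge0}$ be a family of operators on $C_\kappa$ satisfying Assumption (A) stated in the context. Then the strongly continuous convex monotone semigroup $(S(t))_{t\ge0}$ on $C_\kappa$ satisfying $$S(t)f=\lim_{l\to\infty}I(\pi_{n_l}^t)f\quad\text{for all }(f,t)\in C_\kappa\times\mathcal T$$ for a subsequence $(n_l)_{l\in\mathbb N}$ does not depend on the choice of the convergent subsequence, and therefore the whole sequence converges: $S(t)f=\lim_{n\to\infty}I(\pi_n^t)f$ for all $(f,t)\in C_\kappa\times\mathcal T$.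
   Context: $\|f\|_\kappa:=\sup_{x}|f(x)|\kappa(x)$, $\|f\|_{\infty,K}:=\sup_{x\in K}|f(x)|$. $C_\kappa$ is the space of continuous $f\colon\mathbb R^d\to\mathbb R$ with $\|f\|_\kappa<\infty$, ordered pointwise; $B_{C_\kappa}(r)=\{f\in C_\kappa:\|f\|_\kappa\le r\}$. All limits in $C_\kappa$ are in the mixed topology: $f_n\to f$ iff $\sup_n\|f_n\|_\kappa<\infty$ and $\|f_n-f\|_{\infty,K}\to0$ for every compact $K$; limits as $h\downarrow0$ are along all sequences. $\mathrm{Lip}_b(r)$ is the set of $r$-Lipschitz $f\colon\mathbb R^d\to\mathbb R$ with $\|f\|_\infty\le r$. $C_b^\infty$: bounded infinitely differentiable functions with bounded partial derivatives of all orders. $(\tau_xf)(y):=f(x+y)$. $I'(0)f:=\lim_{h\downarrow0}\frac{I(h)f-f}{h}\in C_\kappa$ if the limit exists. $k_n^t:=\max\{k\in\mathbb N_0:kh_n\le t\}$, $I(\pi_n^t)f:=I(h_n)^{k_n^t}f$. Assumption (A) for a family of operators $I(t)\colon C_\kappa\to C_\kappa$, $t\ge0$: (i) $I(0)=\mathrm{id}_{C_\kappa}$. (ii) $I(h_n)$ is convex and monotone with $I(h_n)0=0$ for all $n$. (iii) There is $\omega\ge0$ with $\|I(h_n)f\|_\kappa\le e^{\omega h_n}\|f\|_\kappa$ for all $f\in C_\kappa$, $n\in\mathbb N$. (iv) For every $r\ge0$ there is $\omega_r\ge0$ with $\|I(h_n)f-I(h_n)g\|_\kappa\le e^{h_n\omega_r}\|f-g\|_\kappa$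 for all $n$ and $f,g\in B_{C_\kappa}(r)$, and $r\mapsto\omega_r$ is non-decreasing. (v) For every $\varepsilon>0$ there are $\delta>0$, $n_0\in\mathbb N$ with $I(h_n)(\tau_xf)\le\tau_xI(h_n)f+\frac{r\varepsilon h_n}{\kappa}$ for all $r\ge0$, $f\in\mathrm{Lip}_b(r)$, $|x|\le\delta$ and $n\ge n_0$. (vi) The limit $I'(0)f\in C_\kappa$ exists for all $f\in C_b^\infty$. (vii) For every $\varepsilon>0$, $r,T\ge0$ and compact $K\subset\mathbb R^d$ there are a compact $K'\subset\mathbb R^d$ and $c\ge0$ with $\|I(\pi_n^t)f-I(\pi_n^t)g\|_{\infty,K}\le c\|f-g\|_{\infty,K'}+\varepsilon$ for all $t\in[0,T]$, $n\in\mathbb N$, $f,g\in B_{C_\kappa}(r)$. (viii) There is $c\ge0$ with $I(h_n)\colon\mathrm{Lip}_b(r)\to\mathrm{Lip}_b(e^{ch_n}r)$ for all $r\ge0$, $n\in\mathbb N$. A convex monotone semigroup on $C_\kappa$ is a family of operators $S(t)\colon C_\kappa\to C_\kappa$, $t\ge0$, such that: (S1) each $S(t)$ is convex and monotone, and $S(t)f_n\downarrow0$ pointwise whenever $(f_n)\subset C_\kappa$ decreases pointwise to $0$; (S2) $S(0)f=f$ and $S(s+t)f=S(s)S(t)f$; (S3) $\sup_{t\in[0,T]}\|S(t)\frac r\kappa\|_\kappa<\infty$ for all $r,T\ge0$; (S4) $\limsup_n(S(s_n)f)(x_n)\le(S(t)f)(x)$ for all $f\in C_\kappa$, $0\le s_n\to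 t$, $x_n\to x$. It is strongly continuous if $\lim_{t\to0}S(t)f=f$ for all $f\in C_\kappa$. Under Assumption (A), at least one subsequence and semigroup as in the claim exist. *)

theory Defs
  imports "HOL-Analysis.Analysis"
begin

text \<open>
  Operators on \<open>C_kappa\<close> are total functions on \<open>real ^ 'd \<Rightarrow> real\<close> that map the set \<open>C_kappa \<kappa>\<close>
  into itself; their values outside of \<open>C_kappa \<kappa>\<close> and at negative times are irrelevant.
  The order on \<open>real ^ 'd \<Rightarrow> real\<close> is the pointwise one.
\<close>

definition wnorm :: "(real ^ 'd \<Rightarrow> real) \<Rightarrow> (real ^ 'd \<Rightarrow> real) \<Rightarrow> real" where
  "wnorm \<kappa> f = (SUP x. \<bar>f x\<bar> * \<kappa> x)"

text \<open>The supremum of nonnegative quantities over the empty set is 0 by convention.\<close>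

definition supnorm_on :: "(real ^ 'd) set \<Rightarrow> (real ^ 'd \<Rightarrow> real) \<Rightarrow> real" where
  "supnorm_on K f = (if K = {} then 0 else SUP x\<in>K. \<bar>f x\<bar>)"

text \<open>As \<open>Sup\<close> is only meaningful for bounded sets of reals, finiteness of a supremum is
  expressed by \<open>bdd_above\<close> throughout.\<close>

definition C_kappa :: "(real ^ 'd \<Rightarrow> real) \<Rightarrow> (real ^ 'd \<Rightarrow> real) set" where
  "C_kappa \<kappa> = {f. continuous_on UNIV f \<and> bdd_above (range (\<lambda>x. \<bar>f x\<bar> * \<kappa> x))}"

definition ball_kappa :: "(real ^ 'd \<Rightarrow> real) \<Rightarrow> real \<Rightarrow> (real ^ 'd \<Rightarrow> real) set" where
  "ball_kappa \<kappa> r = {f \<in> C_kappa \<kappa>. wnorm \<kappa> f \<le> r}"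

definition mixed_lim ::
  "(real ^ 'd \<Rightarrow> real) \<Rightarrow> (nat \<Rightarrow> real ^ 'd \<Rightarrow> real) \<Rightarrow> (real ^ 'd \<Rightarrow> real) \<Rightarrow> bool" where
  "mixed_lim \<kappa> F f \<longleftrightarrow>
     (\<forall>n. F n \<in> C_kappa \<kappa>) \<and> f \<in> C_kappa \<kappa> \<and>
     bdd_above (range (\<lambda>n. wnorm \<kappa> (F n))) \<and>
     (\<forall>K. compact K \<longrightarrow> (\<lambda>n. supnorm_on K (\<lambda>x. F n x - f x)) \<longlonglongrightarrow> 0)"

definition mixed_lim_at_right_0 ::
  "(real ^ 'd \<Rightarrow> real) \<Rightarrow> (real \<Rightarrow> real ^ 'd \<Rightarrow> real) \<Rightarrow> (real ^ 'd \<Rightarrow> real) \<Rightarrow> bool" where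
  "mixed_lim_at_right_0 \<kappa> F f \<longleftrightarrow>
     (\<forall>s. (\<forall>n. 0 < s n) \<and> s \<longlonglongrightarrow> 0 \<longrightarrow> mixed_lim \<kappa> (\<lambda>n. F (s n)) f)"

definition Lip_b :: "real \<Rightarrow> (real ^ 'd \<Rightarrow> real) set" where
  "Lip_b r = {f. r-lipschitz_on UNIV f \<and> (\<forall>x. \<bar>f x\<bar> \<le> r)}"

definition partial :: "'d \<Rightarrow> (real ^ 'd \<Rightarrow> real) \<Rightarrow> real ^ 'd \<Rightarrow> real" where
  "partial i f x = frechet_derivative f (at x) (axis i 1)"

text \<open>The list \<open>js\<close> ranges over all iterated partial derivatives (\<open>js = []\<close> is \<open>f\<close> itself);
  \<open>f\<close> is infinitely differentiable iff each of them is differentiable.\<close>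

definition Cb_infinity :: "(real ^ 'd \<Rightarrow> real) set" where
  "Cb_infinity = {f. \<forall>js. (\<forall>x. foldr partial js f differentiable (at x)) \<and>
                          bounded (range (foldr partial js f))}"

definition shift :: "real ^ 'd \<Rightarrow> (real ^ 'd \<Rightarrow> real) \<Rightarrow> real ^ 'd \<Rightarrow> real" where
  "shift x f = (\<lambda>y. f (x + y))"

definition convex_op ::
  "(real ^ 'd \<Rightarrow> real) set \<Rightarrow> ((real ^ 'd \<Rightarrow> real) \<Rightarrow> (real ^ 'd \<Rightarrow> real)) \<Rightarrow> bool" where
  "convex_op A \<Phi> \<longleftrightarrow>
     (\<forall>f\<in>A. \<forall>g\<in>A. \<forall>u\<in>{0..1}.
        \<Phi> (\<lambda>x. u * f x + (1 - u) * g x) \<le> (\<lambda>x. u * \<Phi> f x + (1 - u) * \<Phi> g x))"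

definition num_steps :: "real \<Rightarrow> real \<Rightarrow> nat" where
  "num_steps h t = Max {k::nat. real k * h \<le> t}"

definition iterate ::
  "(real \<Rightarrow> (real ^ 'd \<Rightarrow> real) \<Rightarrow> (real ^ 'd \<Rightarrow> real)) \<Rightarrow> (nat \<Rightarrow> real) \<Rightarrow> nat \<Rightarrow> real
    \<Rightarrow> (real ^ 'd \<Rightarrow> real) \<Rightarrow> (real ^ 'd \<Rightarrow> real)" where
  "iterate I h n t f = (I (h n) ^^ num_steps (h n) t) f"

definition assumption_A ::
  "(real ^ 'd \<Rightarrow> real) \<Rightarrow> (nat \<Rightarrow> real)
    \<Rightarrow> (real \<Rightarrow> (real ^ 'd \<Rightarrow> real) \<Rightarrow> (real ^ 'd \<Rightarrow> real)) \<Rightarrow> bool" where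
  "assumption_A \<kappa> h I \<longleftrightarrow>
     (\<forall>f \<in> C_kappa \<kappa>. I 0 f = f) \<and>
     (\<forall>n. convex_op (C_kappa \<kappa>) (I (h n)) \<and> mono_on (C_kappa \<kappa>) (I (h n)) \<and>
          I (h n) (\<lambda>_. 0) = (\<lambda>_. 0)) \<and>
     (\<exists>\<omega>\<ge>0. \<forall>n. \<forall>f \<in> C_kappa \<kappa>. wnorm \<kappa> (I (h n) f) \<le> exp (\<omega> * h n) * wnorm \<kappa> f) \<and>
     (\<exists>\<omega> :: real \<Rightarrow> real.
        (\<forall>r\<ge>0. 0 \<le> \<omega> r) \<and> mono_on {0..} \<omega> \<and>
        (\<forall>r\<ge>0. \<forall>n. \<forall>f \<in> ball_kappa \<kappa> r. \<forall>g \<in> ball_kappa \<kappa> r.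
           wnorm \<kappa> (\<lambda>x. I (h n) f x - I (h n) g x)
             \<le> exp (h n * \<omega> r) * wnorm \<kappa> (\<lambda>x. f x - g x))) \<and>
     (\<forall>\<epsilon>>0. \<exists>\<delta>>0. \<exists>n0. \<forall>r\<ge>0. \<forall>f \<in> Lip_b r. \<forall>x. norm x \<le> \<delta> \<longrightarrow> (\<forall>n\<ge>n0.
        I (h n) (shift x f) \<le> (\<lambda>y. shift x (I (h n) f) y + r * \<epsilon> * h n / \<kappa> y))) \<and>
     (\<forall>f \<in> Cb_infinity. \<exists>g \<in> C_kappa \<kappa>.
        mixed_lim_at_right_0 \<kappa> (\<lambda>t x. (I t f x - f x) / t) g) \<and>
     (\<forall>\<epsilon>>0. \<forall>r\<ge>0. \<forall>T\<ge>0. \<forall>K. compact K \<longrightarrow> (\<exists>K' c. compact K' \<and> 0 \<le> c \<and>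
        (\<forall>t\<in>{0..T}. \<forall>n. \<forall>f \<in> ball_kappa \<kappa> r. \<forall>g \<in> ball_kappa \<kappa> r.
           supnorm_on K (\<lambda>x. iterate I h n t f x - iterate I h n t g x)
             \<le> c * supnorm_on K' (\<lambda>x. f x - g x) + \<epsilon>))) \<and>
     (\<exists>c\<ge>0. \<forall>r\<ge>0. \<forall>n. \<forall>f \<in> Lip_b r. I (h n) f \<in> Lip_b (exp (c * h n) * r))"

definition decreases_to_0 :: "(nat \<Rightarrow> real ^ 'd \<Rightarrow> real) \<Rightarrow> bool" where
  "decreases_to_0 F \<longleftrightarrow> decseq F \<and> (\<forall>x. (\<lambda>n. F n x) \<longlonglongrightarrow> 0)"

definition convex_monotone_semigroup ::
  "(real ^ 'd \<Rightarrow> real) \<Rightarrow> (real \<Rightarrow> (real ^ 'd \<Rightarrow> real) \<Rightarrow> (real ^ 'd \<Rightarrow> real)) \<Rightarrow> bool" where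
  "convex_monotone_semigroup \<kappa> S \<longleftrightarrow>
     (\<forall>t\<ge>0. S t \<in> C_kappa \<kappa> \<rightarrow> C_kappa \<kappa>) \<and>
     (\<forall>t\<ge>0. convex_op (C_kappa \<kappa>) (S t) \<and> mono_on (C_kappa \<kappa>) (S t) \<and>
        (\<forall>F. (\<forall>n. F n \<in> C_kappa \<kappa>) \<and> decreases_to_0 F \<longrightarrow> decreases_to_0 (\<lambda>n. S t (F n)))) \<and>
     (\<forall>f \<in> C_kappa \<kappa>. S 0 f = f \<and> (\<forall>s\<ge>0. \<forall>t\<ge>0. S (s + t) f = S s (S t f))) \<and>
     (\<forall>r\<ge>0. \<forall>T\<ge>0. bdd_above ((\<lambda>t. wnorm \<kappa> (S t (\<lambda>x. r / \<kappa> x))) ` {0..T})) \<and>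
     (\<forall>f \<in> C_kappa \<kappa>. \<forall>s t X x. (\<forall>n. 0 \<le> s n) \<and> s \<longlonglongrightarrow> t \<and> X \<longlonglongrightarrow> x \<longrightarrow>
        limsup (\<lambda>n. ereal (S (s n) f (X n))) \<le> ereal (S t f x))"

definition strongly_continuous ::
  "(real ^ 'd \<Rightarrow> real) \<Rightarrow> (real \<Rightarrow> (real ^ 'd \<Rightarrow> real) \<Rightarrow> (real ^ 'd \<Rightarrow> real)) \<Rightarrow> bool" where
  "strongly_continuous \<kappa> S \<longleftrightarrow> (\<forall>f \<in> C_kappa \<kappa>. mixed_lim_at_right_0 \<kappa> (\<lambda>t. S t f) f)"

text \<open>\<open>S\<close> is a strongly continuous convex monotone semigroup which is the limit of the iterates
  along the subsequence \<open>\<nu>\<close>, at all times in \<open>\<T>\<close>.\<close>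

definition limit_semigroup ::
  "(real ^ 'd \<Rightarrow> real) \<Rightarrow> (nat \<Rightarrow> real) \<Rightarrow> real set
    \<Rightarrow> (real \<Rightarrow> (real ^ 'd \<Rightarrow> real) \<Rightarrow> (real ^ 'd \<Rightarrow> real)) \<Rightarrow> (nat \<Rightarrow> nat)
    \<Rightarrow> (real \<Rightarrow> (real ^ 'd \<Rightarrow> real) \<Rightarrow> (real ^ 'd \<Rightarrow> real)) \<Rightarrow> bool" where
  "limit_semigroup \<kappa> h \<T> I \<nu> S \<longleftrightarrow>
     convex_monotone_semigroup \<kappa> S \<and> strongly_continuous \<kappa> S \<and> strict_mono \<nu> \<and>
     (\<forall>f \<in> C_kappa \<kappa>. \<forall>t \<in> \<T>. mixed_lim \<kappa> (\<lambda>l. iterate I h (\<nu> l) t f) (S t f))"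

end

theory Submission
  imports Defs "HOL-Computational_Algebra.Polynomial"
begin

text \<open>
  Let \<open>J n k\<close> be the \<open>k\<close>-th power of the operator \<open>I (h n)\<close>. The theorem is a uniqueness statement for
  limits of these iterates as \<open>k * h n\<close> tends to \<open>t\<close>; existence and convergence of the whole sequence
  follow from it by compactness.

  For uniqueness, let \<open>S1\<close> and \<open>S2\<close> be two limits and let \<open>w t\<close> be the average of the translates of
  \<open>S1 t f\<close> with respect to a smooth kernel with small support. By Jensen's inequality and almost
  invariance under translations, taking this average commutes with a step of the scheme, in one
  direction and up to a small error proportional to \<open>h n\<close> (\<open>I_avg_le\<close>). In the limit,
  \<open>S1 s (w t) \<le> w (t + s) + C * \<epsilon> * s / \<kappa>\<close> (\<open>S_avg_le\<close>). As \<open>w t\<close> is smooth, \<open>S1\<close> and \<open>S2\<close> have the same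
  derivative at time 0 in \<open>w t\<close>, namely the one that is given by the difference quotients of \<open>I\<close>
  (\<open>S_generator\<close>). So \<open>w\<close> is almost a supersolution for \<open>S2\<close> as well: the lower right derivative of
  \<open>s \<mapsto> S2 (t - s) (w s) x\<close> is at least of order \<open>- \<epsilon>\<close>. Comparing the two end points and letting the
  kernel shrink with \<open>\<epsilon>\<close> gives \<open>S2 t f \<le> S1 t f\<close> for bounded Lipschitz \<open>f\<close> (\<open>comparison_Lip_b\<close>).
  Symmetry and density give \<open>S1 = S2\<close> (\<open>limit_family_unique\<close>).

  The remainders in these expansions are small on compact sets only, whereas the available stability
  estimate on compact sets has an additive error that does not become small with the perturbation.
  Convexity resolves this: \<open>\<Phi> (f + s * b) - \<Phi> f \<le> s * (\<Phi> (f + b) - \<Phi> f)\<close> for \<open>0 \<le> s \<le> 1\<close>, so that the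
  estimate is used for a perturbation of order one and the factor \<open>s\<close> multiplies its additive error,
  too (\<open>convex_op_secant\<close>).

  For existence, all numbers \<open>J n k f x\<close> with \<open>k\<close> the number of steps up to \<open>t\<close> are bounded in terms of
  \<open>t\<close>, \<open>f\<close> and \<open>x\<close>, so by Tychonoff's theorem every filter on the indices has a refinement along which
  they all converge. The limits are strongly continuous convex monotone semigroups
  (\<open>S_convex_monotone_semigroup\<close>, \<open>S_strongly_continuous\<close>). By uniqueness they do not depend on the
  refinement, and hence the whole sequence converges (\<open>exists_limit_family_sequentially\<close>). A
  semigroup that is a limit along a subsequence at a dense set of times only is identified with this
  one by continuity in time from the right (\<open>limit_semigroup_eq\<close>).
\<close>

section \<open>Smooth kernels with small support\<close>

text \<open>
  The derivative of \<open>p (1/s) * exp (-1/s)\<close> is again of this form, so that the polynomial parameter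
  makes the family closed under differentiation.
\<close>

definition flat :: "real poly \<Rightarrow> real \<Rightarrow> real" where
  "flat p s = (if 0 < s then poly p (1 / s) * exp (- (1 / s)) else 0)"

lemma poly_times_exp_minus_tendsto_0:
  "((\<lambda>y::real. poly p y * exp (- y)) \<longlongrightarrow> 0) at_top"
proof -
  have "((\<lambda>y. \<Sum>i\<le>degree p. coeff p i * (y ^ i / exp y)) \<longlongrightarrow> 0) at_top"
    by (intro tendsto_null_sum tendsto_mult_right_zero tendsto_power_div_exp_0)
  then show ?thesis
    by (simp add: poly_altdef exp_minus sum_distrib_right divide_inverse mult.assoc)
qed

lemma flat_tendsto_0: "(flat p \<longlongrightarrow> 0) (at 0)"
proof -
  have "((\<lambda>s. poly p (1 / s) * exp (- (1 / s))) \<longlongrightarrow> 0) (at_right (0::real))"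
    using filterlim_compose[OF poly_times_exp_minus_tendsto_0 filterlim_inverse_at_top_right]
    by (simp add: divide_inverse)
  then have "(flat p \<longlongrightarrow> 0) (at_right 0)"
    by (rule Lim_transform_eventually)
       (auto simp: flat_def eventually_at_filter)
  moreover have "((\<lambda>s. 0) \<longlongrightarrow> 0) (at_left (0::real))" by simp
  then have "(flat p \<longlongrightarrow> 0) (at_left 0)"
    by (rule Lim_transform_eventually)
       (auto simp: flat_def eventually_at_filter)
  ultimately show ?thesis by (simp add: filterlim_split_at)
qed

text \<open>
  At \<open>s = 0\<close> the difference quotient is \<open>flat ([:0, 1:] * p)\<close>, which tends to 0 because the
  exponential beats every polynomial.
\<close>

lemma flat_has_derivative:
  "(flat p has_real_derivative flat ([:0, 0, 1:] * (p - pderiv p)) s) (at s)"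
proof (cases s "0 :: real" rule: linorder_cases)
  case less
  have "((\<lambda>_. 0) has_real_derivative 0) (at s)" by simp
  then have "(flat p has_real_derivative 0) (at s)"
    by (rule has_field_derivative_transform_within_open[where S = "{..<0}"])
       (use less in \<open>auto simp: flat_def\<close>)
  then show ?thesis using less by (simp add: flat_def)
next
  case equal
  have "((\<lambda>h. (flat p (0 + h) - flat p 0) / h) \<longlongrightarrow> 0) (at 0)"
  proof (rule Lim_transform_eventually[OF flat_tendsto_0[of "[:0, 1:] * p"]])
    show "\<forall>\<^sub>F h in at 0. flat ([:0, 1:] * p) h = (flat p (0 + h) - flat p 0) / h"
      by (auto simp: flat_def eventually_at_filter)
  qed
  then show ?thesis using equal by (simp add: DERIV_def flat_def)
next
  case greater
  have "((\<lambda>s. poly p (1 / s) * exp (- (1 / s))) has_real_derivative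
      flat ([:0, 0, 1:] * (p - pderiv p)) s) (at s)"
    using greater
    by (auto intro!: derivative_eq_intros simp: flat_def field_simps power2_eq_square)
  then show ?thesis
    by (rule has_field_derivative_transform_within_open[where S = "{0<..}"])
       (use greater in \<open>auto simp: flat_def\<close>)
qed

text \<open>
  Smooth functions of one variable suffice: kernels on \<open>\<real>\<^sup>d\<close> are products of them, and a partial
  derivative of a product affects a single factor.
\<close>

definition smooth_compact :: "real \<Rightarrow> (real \<Rightarrow> real) set" where
  "smooth_compact \<delta> = {\<phi>. (\<forall>n s. (deriv ^^ n) \<phi> field_differentiable at s) \<and>
                          (\<forall>s. \<delta> < \<bar>s\<bar> \<longrightarrow> \<phi> s = 0)}"

lemma smooth_compact_has_derivative:
  assumes "\<phi> \<in> smooth_compact \<delta>"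
  shows "(\<phi> has_real_derivative deriv \<phi> s) (at s)"
  using assms by (auto simp: smooth_compact_def DERIV_deriv_iff_field_differentiable dest: spec[of _ 0])

lemma smooth_compact_continuous:
  assumes "\<phi> \<in> smooth_compact \<delta>"
  shows "continuous_on UNIV \<phi>"
  by (rule DERIV_continuous_on) (use smooth_compact_has_derivative[OF assms] in \<open>auto\<close>)

lemma smooth_compact_deriv:
  assumes "\<phi> \<in> smooth_compact \<delta>"
  shows "deriv \<phi> \<in> smooth_compact \<delta>"
proof -
  have "(deriv ^^ n) (deriv \<phi>) field_differentiable at s" for n s
    using assms by (auto simp: smooth_compact_def funpow_swap1[symmetric] dest!: spec[of _ "Suc n"])
  moreover have "deriv \<phi> s = 0" if "\<delta> < \<bar>s\<bar>" for s
  proof -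
    have "((\<lambda>_. 0) has_real_derivative 0) (at s)" by simp
    then have "(\<phi> has_real_derivative 0) (at s)"
      by (rule has_field_derivative_transform_within_open[where S = "{s. \<delta> < \<bar>s\<bar>}"])
         (use assms that in \<open>auto simp: smooth_compact_def intro!: open_Collect_less continuous_intros\<close>)
    then show ?thesis by (rule DERIV_imp_deriv)
  qed
  ultimately show ?thesis by (simp add: smooth_compact_def)
qed

lemma smooth_compact_uminus_deriv:
  assumes "\<phi> \<in> smooth_compact \<delta>"
  shows "(\<lambda>s. - deriv \<phi> s) \<in> smooth_compact \<delta>"
proof -
  have *: "(deriv ^^ n) (\<lambda>s. - \<psi> s) = (\<lambda>s. - (deriv ^^ n) \<psi> s) \<and>
       (\<forall>s. (deriv ^^ n) (\<lambda>s. - \<psi> s) field_differentiable at s)"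
    if "\<psi> \<in> smooth_compact \<delta>" for n \<psi>
    using that
  proof (induction n arbitrary: \<psi>)
    case 0
    have "\<psi> field_differentiable at s" for s
      using smooth_compact_has_derivative[OF 0] field_differentiable_def by blast
    then show ?case by (auto intro!: derivative_intros)
  next
    case (Suc n)
    have "deriv (\<lambda>s. - \<psi> s) = (\<lambda>s. - deriv \<psi> s)"
      using smooth_compact_has_derivative[OF Suc.prems]
      by (intro ext DERIV_imp_deriv) (auto intro!: derivative_intros)
    then show ?case
      using Suc.IH[OF smooth_compact_deriv[OF Suc.prems]]
      by (auto simp: funpow_swap1)
  qed
  have "(deriv ^^ n) (\<lambda>s. - deriv \<phi> s) field_differentiable at s" for n s
    using *[OF smooth_compact_deriv[OF assms], of n] by blast
  then show ?thesis using smooth_compact_deriv[OF assms] by (simp add: smooth_compact_def)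
qed

text \<open>
  The product rule turns one product into a sum of two, so closure under differentiation requires
  sums.
\<close>

inductive_set bump_span :: "real \<Rightarrow> (real \<Rightarrow> real) set" for \<delta> where
  base: "(\<lambda>s. flat p (\<delta> - s) * flat q (\<delta> + s)) \<in> bump_span \<delta>"
| add: "\<phi> \<in> bump_span \<delta> \<Longrightarrow> \<psi> \<in> bump_span \<delta> \<Longrightarrow> (\<lambda>s. \<phi> s + \<psi> s) \<in> bump_span \<delta>"

lemma flat_uminus: "flat (- p) s = - flat p s"
  by (simp add: flat_def)

lemma bump_span_has_derivative:
  assumes "\<phi> \<in> bump_span \<delta>"
  shows "\<exists>\<psi> \<in> bump_span \<delta>. \<forall>s. (\<phi> has_real_derivative \<psi> s) (at s)"
  using assms
proof induction
  case (base p q)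
  let ?D = "\<lambda>p. [:0, 0, 1:] * (p - pderiv p)"
  have "((\<lambda>s. flat p (\<delta> - s) * flat q (\<delta> + s)) has_real_derivative
      flat (- ?D p) (\<delta> - s) * flat q (\<delta> + s) + flat p (\<delta> - s) * flat (?D q) (\<delta> + s)) (at s)" for s
  proof -
    have "((\<lambda>s. flat p (\<delta> - s)) has_real_derivative flat (?D p) (\<delta> - s) * (- 1)) (at s)"
      by (rule DERIV_chain2[OF flat_has_derivative]) (auto intro!: derivative_eq_intros)
    moreover have "((\<lambda>s. flat q (\<delta> + s)) has_real_derivative flat (?D q) (\<delta> + s) * 1) (at s)"
      by (rule DERIV_chain2[OF flat_has_derivative]) (auto intro!: derivative_eq_intros)
    ultimately have "((\<lambda>s. flat p (\<delta> - s) * flat q (\<delta> + s)) has_real_derivative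
        (flat (?D p) (\<delta> - s) * (- 1)) * flat q (\<delta> + s) + (flat (?D q) (\<delta> + s) * 1) * flat p (\<delta> - s)) (at s)"
      by (rule DERIV_mult)
    then show ?thesis unfolding flat_uminus by (simp add: mult.commute)
  qed
  then show ?case
    by (intro bexI[OF _ bump_span.add[OF bump_span.base bump_span.base]]) blast
next
  case (add \<phi> \<psi>)
  then obtain \<phi>' \<psi>' where "\<phi>' \<in> bump_span \<delta>" "\<psi>' \<in> bump_span \<delta>"
    "\<forall>s. (\<phi> has_real_derivative \<phi>' s) (at s)" "\<forall>s. (\<psi> has_real_derivative \<psi>' s) (at s)"
    by blast
  then show ?case
    by (intro bexI[OF _ bump_span.add[of \<phi>' _ \<psi>']]) (auto intro: DERIV_add)
qed

lemma bump_span_smooth_compact: "bump_span \<delta> \<subseteq> smooth_compact \<delta>"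
proof
  fix \<phi> assume "\<phi> \<in> bump_span \<delta>"
  have "(deriv ^^ n) \<phi> \<in> bump_span \<delta>" for n
  proof (induction n)
    case (Suc n)
    then obtain \<psi> where "\<psi> \<in> bump_span \<delta>" "\<forall>s. ((deriv ^^ n) \<phi> has_real_derivative \<psi> s) (at s)"
      using bump_span_has_derivative by blast
    moreover from this have "deriv ((deriv ^^ n) \<phi>) = \<psi>"
      by (intro ext DERIV_imp_deriv) simp
    ultimately show ?case by simp
  qed (use \<open>\<phi> \<in> bump_span \<delta>\<close> in simp)
  then have "(deriv ^^ n) \<phi> field_differentiable at s" for n s
    using bump_span_has_derivative unfolding field_differentiable_def by blast
  moreover have "\<phi> s = 0" if "\<delta> < \<bar>s\<bar>" for s
    using \<open>\<phi> \<in> bump_span \<delta>\<close> that by induction (auto simp: flat_def)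
  ultimately show "\<phi> \<in> smooth_compact \<delta>" by (simp add: smooth_compact_def)
qed

text \<open>
  A convolution with the reflected product kernel. With the variable of differentiation \<open>x\<close> in the
  kernel, \<open>f\<close> only has to be continuous, and the \<open>i\<close>-th partial derivative replaces the factor \<open>\<phi> i\<close>
  by \<open>- deriv (\<phi> i)\<close>.
\<close>

definition smear :: "(real ^ 'd \<Rightarrow> real) \<Rightarrow> ('d \<Rightarrow> real \<Rightarrow> real) \<Rightarrow> real ^ 'd \<Rightarrow> real" where
  "smear f \<phi> x = integral UNIV (\<lambda>z. f z * (\<Prod>i\<in>UNIV. \<phi> i (z $ i - x $ i)))"

lemma prod_smooth_compact_eq_0:
  fixes x z :: "real ^ 'd"
  assumes "\<And>i. \<phi> i \<in> smooth_compact \<delta>" and "z \<notin> cbox (x - vec \<delta>) (x + vec \<delta>)"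
  shows "(\<Prod>i\<in>UNIV. \<phi> i (z $ i - x $ i)) = 0"
proof -
  obtain i where "\<not> (x $ i - \<delta> \<le> z $ i \<and> z $ i \<le> x $ i + \<delta>)"
    using assms(2) by (auto simp: mem_box_cart)
  then have "\<delta> < \<bar>z $ i - x $ i\<bar>" by linarith
  then have "\<phi> i (z $ i - x $ i) = 0" using assms(1)[of i] by (simp add: smooth_compact_def)
  then show ?thesis by (simp add: prod_zero_iff) blast
qed

lemma continuous_on_prod_smooth_compact:
  fixes \<phi> :: "'d::finite \<Rightarrow> real \<Rightarrow> real"
  assumes "\<And>i. \<phi> i \<in> smooth_compact \<delta>"
    and "\<And>i. continuous_on A (\<lambda>p. g i p)"
  shows "continuous_on A (\<lambda>p. \<Prod>i\<in>UNIV. \<phi> i (g i p))"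
proof (rule continuous_on_prod)
  fix i
  show "continuous_on A (\<lambda>p. \<phi> i (g i p))"
    using continuous_on_compose2[OF smooth_compact_continuous[OF assms(1)] assms(2)] by auto
qed

lemma smear_integrand_integrable:
  fixes f :: "real ^ 'd \<Rightarrow> real"
  assumes "continuous_on UNIV f" and "\<And>i. \<phi> i \<in> smooth_compact \<delta>"
  shows "(\<lambda>z. f z * (\<Prod>i\<in>UNIV. \<phi> i (z $ i - x $ i))) integrable_on cbox a b"
  by (intro integrable_continuous continuous_on_mult continuous_on_prod_smooth_compact[OF assms(2)]
      continuous_on_subset[OF assms(1)] continuous_intros) auto

lemma smear_eq_integral_cbox:
  fixes f :: "real ^ 'd \<Rightarrow> real"
  assumes "continuous_on UNIV f" and "\<And>i. \<phi> i \<in> smooth_compact \<delta>"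
    and "cbox (x - vec \<delta>) (x + vec \<delta>) \<subseteq> cbox a b"
  shows "smear f \<phi> x = integral (cbox a b) (\<lambda>z. f z * (\<Prod>i\<in>UNIV. \<phi> i (z $ i - x $ i)))"
  unfolding smear_def
  by (intro integral_unique has_integral_on_superset[OF integrable_integral]
      smear_integrand_integrable[OF assms(1,2)])
     (use prod_smooth_compact_eq_0[of \<phi>, OF assms(2)] assms(3) in \<open>auto simp del: prod_zero_iff\<close>)

text \<open>
  Differentiation under the integral sign. The support of the kernel moves with the point, but for
  all points of a unit ball it stays in one box, over which the Leibniz rule applies.
\<close>

lemma smear_has_derivative:
  fixes f :: "real ^ 'd \<Rightarrow> real" and \<phi> :: "'d \<Rightarrow> real \<Rightarrow> real"
  assumes "continuous_on UNIV f" and \<phi>: "\<And>i. \<phi> i \<in> smooth_compact \<delta>"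
  shows "(smear f \<phi> has_derivative
           (\<lambda>k. \<Sum>i\<in>UNIV. k $ i * smear f (\<phi>(i := \<lambda>s. - deriv (\<phi> i) s)) x)) (at x)"
proof -
  define \<psi> where "\<psi> i = \<phi>(i := \<lambda>s. - deriv (\<phi> i) s)" for i
  define a b where "a = x - vec (\<delta> + 1)" and "b = x + vec (\<delta> + 1)"
  have \<psi>: "\<psi> i j \<in> smooth_compact \<delta>" for i j
    using \<phi> smooth_compact_uminus_deriv by (auto simp: \<psi>_def)
  define P :: "('d \<Rightarrow> real \<Rightarrow> real) \<Rightarrow> real ^ 'd \<Rightarrow> real ^ 'd \<Rightarrow> real"
    where "P \<phi> y z = f z * (\<Prod>i\<in>UNIV. \<phi> i (z $ i - y $ i))" for \<phi> y z
  define D :: "real ^ 'd \<Rightarrow> real ^ 'd \<Rightarrow> (real ^ 'd) \<Rightarrow>\<^sub>L real"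
    where "D y z = (\<Sum>i\<in>UNIV. P (\<psi> i) y z *\<^sub>R blinfun_inner_left (axis i 1))" for y z
  have deriv: "((\<lambda>y. P \<phi> y z) has_derivative blinfun_apply (D y z)) (at y within ball x 1)" for y z
  proof -
    have "((\<lambda>y. \<phi> i (z $ i - y $ i)) has_derivative (\<lambda>k. deriv (\<phi> i) (z $ i - y $ i) * (- (k $ i))))
        (at y within ball x 1)" for i
    proof -
      have "(\<phi> i has_derivative (*) (deriv (\<phi> i) (z $ i - y $ i))) (at (z $ i - y $ i))"
        using smooth_compact_has_derivative[OF \<phi>] by (simp add: has_field_derivative_def)
      moreover have "((\<lambda>y. z $ i - y $ i) has_derivative (\<lambda>k. - (k $ i))) (at y within ball x 1)"
        by (auto intro!: derivative_eq_intros bounded_linear_imp_has_derivative[OF bounded_linear_vec_nth])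
      ultimately show ?thesis
        by (rule has_derivative_compose[rotated])
    qed
    then have "((\<lambda>y. P \<phi> y z) has_derivative
        (\<lambda>k. f z * (\<Sum>i\<in>UNIV. deriv (\<phi> i) (z $ i - y $ i) * (- (k $ i)) *
                 (\<Prod>j\<in>UNIV - {i}. \<phi> j (z $ j - y $ j))))) (at y within ball x 1)"
      unfolding P_def by (intro has_derivative_mult_right has_derivative_prod) auto
    moreover have "(\<Prod>j\<in>UNIV. \<psi> i j (z $ j - y $ j)) =
        - deriv (\<phi> i) (z $ i - y $ i) * (\<Prod>j\<in>UNIV - {i}. \<phi> j (z $ j - y $ j))" for i
      by (subst prod.remove[of _ i]) (auto simp: \<psi>_def)
    then have "blinfun_apply (D y z) = (\<lambda>k. f z * (\<Sum>i\<in>UNIV. deriv (\<phi> i) (z $ i - y $ i) * (- (k $ i)) *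
                 (\<Prod>j\<in>UNIV - {i}. \<phi> j (z $ j - y $ j))))"
      by (simp add: fun_eq_iff D_def P_def blinfun.sum_left blinfun.scaleR_left blinfun.minus_left inner_axis
          sum_distrib_left mult_ac flip: sum_negf)
    ultimately show ?thesis by simp
  qed
  have cont: "continuous_on A (\<lambda>(y, z). D y z)" for A
    unfolding D_def P_def case_prod_beta
    by (intro continuous_intros continuous_on_prod_smooth_compact[OF \<psi>]
        continuous_on_compose2[OF assms(1)]) auto
  have int: "P \<eta> y integrable_on cbox a b" if "\<And>i. \<eta> i \<in> smooth_compact \<delta>" for \<eta> y
    unfolding P_def by (rule smear_integrand_integrable[OF assms(1) that])
  have box: "cbox (y - vec \<delta>) (y + vec \<delta>) \<subseteq> cbox a b" if "y \<in> ball x 1" for y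
  proof
    fix z assume "z \<in> cbox (y - vec \<delta>) (y + vec \<delta>)"
    then have z: "y $ i - \<delta> \<le> z $ i \<and> z $ i \<le> y $ i + \<delta>" for i
      by (simp add: mem_box_cart)
    have xy: "\<bar>x $ i - y $ i\<bar> \<le> 1" for i
      using component_le_norm_cart[of "x - y" i] that by (simp add: dist_norm)
    have "x $ i - (\<delta> + 1) \<le> z $ i \<and> z $ i \<le> x $ i + (\<delta> + 1)" for i
      using z[of i] xy[of i] by linarith
    then show "z \<in> cbox a b" by (simp add: mem_box_cart a_def b_def)
  qed
  have smear: "smear f \<eta> y = integral (cbox a b) (P \<eta> y)"
    if "\<And>i. \<eta> i \<in> smooth_compact \<delta>" "y \<in> ball x 1" for \<eta> y
    unfolding P_def by (rule smear_eq_integral_cbox[OF assms(1) that(1) box[OF that(2)]])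
  have "((\<lambda>y. integral (cbox a b) (P \<phi> y)) has_derivative integral (cbox a b) (D x)) (at x within ball x 1)"
    by (rule leibniz_rule[OF deriv int[OF \<phi>] cont]) auto
  then have "((\<lambda>y. integral (cbox a b) (P \<phi> y)) has_derivative integral (cbox a b) (D x)) (at x)"
    by (simp add: at_within_open[of x "ball x 1"])
  then have "(smear f \<phi> has_derivative integral (cbox a b) (D x)) (at x)"
    by (rule has_derivative_transform_within_open[where s = "ball x 1"]) (use smear[of \<phi>, OF \<phi>] in auto)
  moreover have "integral (cbox a b) (D x) = (\<Sum>i\<in>UNIV. smear f (\<psi> i) x *\<^sub>R blinfun_inner_left (axis i 1))"
    unfolding D_def
    by (intro integral_unique has_integral_sum has_integral_scaleR_left)
       (auto simp: smear[of "\<psi> _", OF \<psi>] intro!: integrable_integral int[of "\<psi> _", OF \<psi>])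
  then have "blinfun_apply (integral (cbox a b) (D x)) = (\<lambda>k. \<Sum>i\<in>UNIV. k $ i * smear f (\<psi> i) x)"
    by (simp add: fun_eq_iff blinfun.sum_left blinfun.scaleR_left inner_axis mult.commute)
  ultimately show ?thesis by (simp add: \<psi>_def)
qed

lemma smear_bounded:
  fixes f :: "real ^ 'd \<Rightarrow> real"
  assumes "continuous_on UNIV f" and "bounded (range f)" and \<phi>: "\<And>i. \<phi> i \<in> smooth_compact \<delta>"
  shows "bounded (range (smear f \<phi>))"
proof -
  obtain B where B: "\<And>z. \<bar>f z\<bar> \<le> B" using assms(2) by (auto simp: bounded_iff)
  define Q :: "real ^ 'd \<Rightarrow> real" where "Q u = (\<Prod>i\<in>UNIV. \<phi> i (u $ i))" for u
  have "continuous_on UNIV Q"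
    unfolding Q_def by (intro continuous_on_prod_smooth_compact[OF \<phi>] continuous_intros)
  then have "compact (Q ` cbox (vec (- \<delta>)) (vec \<delta>))"
    by (intro compact_continuous_image continuous_on_subset[OF \<open>continuous_on UNIV Q\<close>]) auto
  then obtain C where C: "\<And>u. u \<in> cbox (vec (- \<delta>)) (vec \<delta>) \<Longrightarrow> \<bar>Q u\<bar> \<le> C"
    by (fastforce dest!: compact_imp_bounded simp: bounded_iff)
  have "\<bar>smear f \<phi> x\<bar> \<le> (B * max 0 C) * measure lborel (cbox (0 :: real ^ 'd) (vec (2 * \<delta>)))" for x
  proof -
    have "norm (integral (cbox (x - vec \<delta>) (x + vec \<delta>)) (\<lambda>z. f z * (\<Prod>i\<in>UNIV. \<phi> i (z $ i - x $ i))))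
       \<le> (B * max 0 C) * measure lborel (cbox (x - vec \<delta>) (x + vec \<delta>))"
    proof (rule integrable_bound)
      show "0 \<le> B * max 0 C" using B[of 0] by (intro mult_nonneg_nonneg) auto
      fix z assume "z \<in> cbox (x - vec \<delta>) (x + vec \<delta>)"
      then have "z - x \<in> cbox (vec (- \<delta>)) (vec \<delta>)" by (simp add: mem_box_cart algebra_simps)
      from C[OF this] have "\<bar>Q (z - x)\<bar> \<le> max 0 C" by simp
      then show "norm (f z * (\<Prod>i\<in>UNIV. \<phi> i (z $ i - x $ i))) \<le> B * max 0 C"
        unfolding real_norm_def abs_mult
        using B[of z] by (intro mult_mono) (auto simp: Q_def)
    qed (rule smear_integrand_integrable[OF assms(1) \<phi>])
    moreover have "measure lborel (cbox (x - vec \<delta>) (x + vec \<delta>)) = measure lborel (cbox (0 :: real ^ 'd) (vec (2 * \<delta>)))"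
      by (simp add: content_cbox_if_cart interval_eq_empty_cart)
    ultimately show ?thesis
      by (subst smear_eq_integral_cbox[OF assms(1) \<phi> subset_refl]) simp
  qed
  then show ?thesis unfolding bounded_iff by auto
qed

text \<open>
  Partial derivatives of \<open>smear f \<phi>\<close> are of the form \<open>smear f \<psi>\<close> again, hence so are all the iterated
  ones, and every such function is differentiable and bounded.
\<close>

lemma smear_Cb_infinity:
  fixes f :: "real ^ 'd \<Rightarrow> real"
  assumes "continuous_on UNIV f" and "bounded (range f)" and "\<And>i. \<phi> i \<in> smooth_compact \<delta>"
  shows "smear f \<phi> \<in> Cb_infinity"
proof -
  have "\<exists>\<psi>. (\<forall>i. \<psi> i \<in> smooth_compact \<delta>) \<and> foldr partial js (smear f \<phi>) = smear f \<psi>" for js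
  proof (induction js)
    case Nil
    show ?case using assms(3) by auto
  next
    case (Cons j js)
    then obtain \<psi> where \<psi>: "\<And>i. \<psi> i \<in> smooth_compact \<delta>" "foldr partial js (smear f \<phi>) = smear f \<psi>"
      by auto
    have "partial j (smear f \<psi>) x = smear f (\<psi>(j := \<lambda>s. - deriv (\<psi> j) s)) x" for x
      unfolding partial_def frechet_derivative_at[OF smear_has_derivative[OF assms(1) \<psi>(1)], symmetric]
      by (simp add: axis_def if_distrib[of "\<lambda>t. t * _"] sum.delta cong: if_cong)
    then show ?case
      using \<psi> smooth_compact_uminus_deriv[OF \<psi>(1)]
      by (intro exI[of _ "\<psi>(j := \<lambda>s. - deriv (\<psi> j) s)"]) (simp_all del: fun_upd_apply, simp)
  qed
  moreover have "smear f \<psi> differentiable (at x)" "bounded (range (smear f \<psi>))"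
    if "\<forall>i. \<psi> i \<in> smooth_compact \<delta>" for \<psi> x
    using smear_has_derivative[OF assms(1), of \<psi> \<delta>] smear_bounded[OF assms(1,2), of \<psi> \<delta>] that
    unfolding differentiable_def by blast+
  ultimately have "(\<forall>x. foldr partial js (smear f \<phi>) differentiable (at x)) \<and>
      bounded (range (foldr partial js (smear f \<phi>)))" for js
    by metis
  then show ?thesis by (simp add: Cb_infinity_def)
qed

lemma smear_Lip_b:
  fixes f :: "real ^ 'd \<Rightarrow> real"
  assumes "continuous_on UNIV f" and "bounded (range f)" and \<phi>: "\<And>i. \<phi> i \<in> smooth_compact \<delta>"
  shows "\<exists>r\<ge>0. smear f \<phi> \<in> Lip_b r"
proof -
  have "\<exists>B. \<forall>x. \<bar>smear f (\<phi>(i := \<lambda>s. - deriv (\<phi> i) s)) x\<bar> \<le> B" for i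
    using smear_bounded[OF assms(1,2), of "\<phi>(i := \<lambda>s. - deriv (\<phi> i) s)" \<delta>] \<phi>
      smooth_compact_uminus_deriv[OF \<phi>]
    by (auto simp: bounded_iff)
  then obtain B where B: "\<And>i x. \<bar>smear f (\<phi>(i := \<lambda>s. - deriv (\<phi> i) s)) x\<bar> \<le> B i" by metis
  obtain M where M: "\<And>x. \<bar>smear f \<phi> x\<bar> \<le> M"
    using smear_bounded[OF assms(1,2), of \<phi> \<delta>, OF \<phi>] by (auto simp: bounded_iff)
  define r where "r = max M (\<Sum>i\<in>UNIV. B i)"
  have "r \<ge> 0" using M[of 0] by (simp add: r_def)
  have "r-lipschitz_on UNIV (smear f \<phi>)"
  proof (rule bounded_derivative_imp_lipschitz[OF smear_has_derivative[OF assms(1) \<phi>]])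
    show "onorm (\<lambda>k. \<Sum>i\<in>UNIV. k $ i * smear f (\<phi>(i := \<lambda>s. - deriv (\<phi> i) s)) x) \<le> r" for x
    proof (rule onorm_bound[OF \<open>r \<ge> 0\<close>])
      fix k :: "real ^ 'd"
      have "norm (\<Sum>i\<in>UNIV. k $ i * smear f (\<phi>(i := \<lambda>s. - deriv (\<phi> i) s)) x) \<le> (\<Sum>i\<in>UNIV. norm k * B i)"
        by (rule sum_norm_le) (auto simp: abs_mult intro!: mult_mono component_le_norm_cart B)
      also have "\<dots> \<le> r * norm k"
        unfolding sum_distrib_left[symmetric] r_def mult.commute[of _ "norm k"]
        by (intro mult_left_mono) auto
      finally show "norm (\<Sum>i\<in>UNIV. k $ i * smear f (\<phi>(i := \<lambda>s. - deriv (\<phi> i) s)) x) \<le> r * norm k" .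
    qed
  qed (use \<open>r \<ge> 0\<close> in auto)
  then show ?thesis
    using \<open>r \<ge> 0\<close> M by (auto simp: Lip_b_def r_def max.coboundedI1)
qed

section \<open>Averages of translates\<close>

definition kernel :: "real \<Rightarrow> (real ^ 'd \<Rightarrow> real) \<Rightarrow> bool" where
  "kernel \<delta> m \<longleftrightarrow> continuous_on UNIV m \<and> (\<forall>u. 0 \<le> m u) \<and> (\<forall>u. \<delta> < norm u \<longrightarrow> m u = 0) \<and>
     (\<integral>u. m u \<partial>lborel) = 1"

text \<open>
  An average of the translates of \<open>f\<close> by vectors \<open>u\<close> in the support of the kernel; this form exposes
  \<open>avg m f\<close> as a continuous convex combination of functions \<open>shift u f\<close>.
\<close>

definition avg :: "(real ^ 'd \<Rightarrow> real) \<Rightarrow> (real ^ 'd \<Rightarrow> real) \<Rightarrow> real ^ 'd \<Rightarrow> real" where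
  "avg m f x = (\<integral>u. m u * f (x + u) \<partial>lborel)"

lemma integrable_compact_support_mult:
  fixes m g :: "real ^ 'd \<Rightarrow> real"
  assumes "continuous_on UNIV m" and "\<And>u. \<delta> < norm u \<Longrightarrow> m u = 0"
    and "continuous_on (cball 0 \<delta>) g"
  shows "integrable lborel (\<lambda>u. m u * g u)"
proof -
  have "integrable lborel (\<lambda>u. indicator (cball 0 \<delta>) u *\<^sub>R (m u * g u))"
    by (intro borel_integrable_compact continuous_intros assms(3) continuous_on_subset[OF assms(1)]) auto
  moreover have "(\<lambda>u. indicator (cball 0 \<delta>) u *\<^sub>R (m u * g u)) = (\<lambda>u. m u * g u)"
    using assms(2) by (auto simp: fun_eq_iff indicator_def)
  ultimately show ?thesis by simp
qed

lemma kernel_integrable: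
  assumes "kernel \<delta> m" and "continuous_on (cball 0 \<delta>) g"
  shows "integrable lborel (\<lambda>u. m u * g u)"
  using assms by (intro integrable_compact_support_mult) (auto simp: kernel_def)

lemma kernel_integrable_shift:
  assumes "kernel \<delta> m" and "continuous_on UNIV f"
  shows "integrable lborel (\<lambda>u. m u * f (x + u))"
  by (intro kernel_integrable[OF assms(1)] continuous_on_compose2[OF assms(2)] continuous_intros) auto

lemma avg_const: "kernel \<delta> m \<Longrightarrow> avg m (\<lambda>_. c) x = c"
  by (simp add: avg_def kernel_def)

lemma avg_add_const:
  assumes "kernel \<delta> m" and "continuous_on UNIV f"
  shows "avg m (\<lambda>x. f x + c) x = avg m f x + c"
proof -
  have "avg m (\<lambda>x. f x + c) x = (\<integral>u. m u * f (x + u) + m u * c \<partial>lborel)"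
    by (simp add: avg_def distrib_left)
  also have "\<dots> = avg m f x + (\<integral>u. m u * c \<partial>lborel)"
    unfolding avg_def
    by (intro Bochner_Integration.integral_add kernel_integrable_shift[OF assms] kernel_integrable[OF assms(1)]) auto
  finally show ?thesis using assms(1) by (simp add: kernel_def)
qed

lemma avg_mono:
  assumes "kernel \<delta> m" and "continuous_on UNIV f" and "continuous_on UNIV g"
    and "\<And>u. norm u \<le> \<delta> \<Longrightarrow> f (x + u) \<le> g (x + u)"
  shows "avg m f x \<le> avg m g x"
  unfolding avg_def
proof (rule integral_mono[OF kernel_integrable_shift[OF assms(1,2)] kernel_integrable_shift[OF assms(1,3)]])
  fix u show "m u * f (x + u) \<le> m u * g (x + u)"
    using assms(1,4) by (cases "norm u \<le> \<delta>") (auto simp: kernel_def intro!: mult_left_mono)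
qed

lemma avg_diff_le:
  assumes "kernel \<delta> m" and "continuous_on UNIV f" and "continuous_on UNIV g"
    and "\<And>u. norm u \<le> \<delta> \<Longrightarrow> \<bar>f (x + u) - g (x + u)\<bar> \<le> e"
  shows "\<bar>avg m f x - avg m g x\<bar> \<le> e"
proof -
  have *: "f (x + u) \<le> g (x + u) + e" "g (x + u) \<le> f (x + u) + e" if "norm u \<le> \<delta>" for u
    using assms(4)[OF that] by linarith+
  have "avg m f x \<le> avg m (\<lambda>x. g x + e) x"
    by (intro avg_mono[OF assms(1,2)] continuous_intros assms(3) *)
  moreover have "avg m g x \<le> avg m (\<lambda>x. f x + e) x"
    by (intro avg_mono[OF assms(1,3)] continuous_intros assms(2) *)
  ultimately show ?thesis
    by (simp add: avg_add_const[OF assms(1,2)] avg_add_const[OF assms(1,3)] abs_le_iff)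
qed

lemma avg_close:
  assumes "kernel \<delta> m" and "continuous_on UNIV f"
    and "\<And>u. norm u \<le> \<delta> \<Longrightarrow> \<bar>f (x + u) - c\<bar> \<le> e"
  shows "\<bar>avg m f x - c\<bar> \<le> e"
  using avg_diff_le[OF assms(1,2), of "\<lambda>_. c" x e] assms(3) by (simp add: avg_const[OF assms(1)])

text \<open>
  The kernel is a normalised product of one-dimensional bumps. Translation invariance of Lebesgue
  measure moves the variable \<open>x\<close> from \<open>f\<close> to the kernel and identifies \<open>avg\<close> with a \<open>smear\<close>.
\<close>

lemma exists_smooth_kernel:
  assumes "0 < \<delta>"
  shows "\<exists>m :: real ^ 'd \<Rightarrow> real. kernel \<delta> m \<and>
    (\<forall>f. continuous_on UNIV f \<and> bounded (range f) \<longrightarrow>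
         avg m f \<in> Cb_infinity \<and> (\<exists>r\<ge>0. avg m f \<in> Lip_b r))"
proof -
  \<comment> \<open>The cube of half width \<open>\<eta>\<close> lies in the ball of radius \<open>\<delta>\<close>, by comparison with the 1-norm.\<close>
  define \<eta> where "\<eta> = \<delta> / real CARD('d)"
  have "0 < \<eta>" using assms by (simp add: \<eta>_def)
  define b where "b s = flat 1 (\<eta> - s) * flat 1 (\<eta> + s)" for s
  have b: "b \<in> smooth_compact \<eta>"
    using bump_span_smooth_compact bump_span.base[of 1 \<eta> 1] by (auto simp: b_def[abs_def])
  define q :: "real ^ 'd \<Rightarrow> real" where "q u = (\<Prod>i\<in>UNIV. b (u $ i))" for u
  have q_cont: "continuous_on UNIV q"
    unfolding q_def by (intro continuous_on_prod_smooth_compact[where \<phi> = "\<lambda>_. b", OF b] continuous_intros)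
  have q_nonneg: "0 \<le> q u" for u
    by (auto simp: q_def b_def flat_def intro!: prod_nonneg)
  have q_box: "q u = 0" if "u \<notin> cbox (vec (- \<eta>)) (vec \<eta>)" for u
    using prod_smooth_compact_eq_0[of "\<lambda>_. b" \<eta> u 0] b that by (simp add: q_def vec_neg)
  have q_supp: "q u = 0" if "\<delta> < norm u" for u
  proof (rule q_box)
    show "u \<notin> cbox (vec (- \<eta>)) (vec \<eta>)"
    proof
      assume "u \<in> cbox (vec (- \<eta>)) (vec \<eta>)"
      then have "- \<eta> \<le> u $ i \<and> u $ i \<le> \<eta>" for i by (simp add: mem_box_cart)
      then have "\<bar>u $ i\<bar> \<le> \<eta>" for i by (simp add: abs_le_iff minus_le_iff)
      then have "(\<Sum>i\<in>UNIV. \<bar>u $ i\<bar>) \<le> (\<Sum>i\<in>(UNIV :: 'd set). \<eta>)" by (intro sum_mono) auto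
      then have "norm u \<le> \<delta>"
        using norm_le_l1_cart[of u] by (simp add: \<eta>_def)
      with that show False by simp
    qed
  qed
  have q_integrable: "integrable lborel q"
    using integrable_compact_support_mult[OF q_cont q_supp, where g = "\<lambda>_. 1"] by simp
  define Z where "Z = (\<integral>u. q u \<partial>lborel)"
  have "0 < Z"
  proof -
    let ?B = "cbox (vec (- \<eta>)) (vec \<eta>) :: (real ^ 'd) set"
    have "Z = integral UNIV q"
      using integral_lborel[OF q_integrable] by (simp add: Z_def)
    also have "\<dots> = integral ?B q"
      by (intro integral_unique has_integral_on_superset[OF integrable_integral]
          integrable_continuous continuous_on_subset[OF q_cont]) (auto intro: q_box)
    finally have Z: "Z = integral ?B q" .
    have "q 0 \<noteq> 0" using \<open>0 < \<eta>\<close> by (simp add: q_def b_def flat_def)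
    moreover have "0 \<in> ?B" "box (vec (- \<eta>)) (vec \<eta>) \<noteq> ({} :: (real ^ 'd) set)"
      using \<open>0 < \<eta>\<close> by (auto simp: mem_box_cart interval_eq_empty_cart)
    ultimately have "integral ?B q \<noteq> 0"
      using integral_cbox_eq_0_iff[OF continuous_on_subset[OF q_cont], of "vec (- \<eta>)" "vec \<eta>"] q_nonneg by auto
    moreover have "0 \<le> Z" unfolding Z_def using q_nonneg by simp
    ultimately show ?thesis using Z by simp
  qed
  define m where "m u = q u / Z" for u
  have "kernel \<delta> m"
    using \<open>0 < Z\<close> q_nonneg q_supp
    by (auto simp: kernel_def m_def[abs_def] Z_def[symmetric] intro!: continuous_intros q_cont)
  moreover have "avg m f = smear (\<lambda>z. f z / Z) (\<lambda>_. b)" if f: "continuous_on UNIV f" for f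
  proof
    fix x
    have int: "integrable lborel (\<lambda>z. f z / Z * q (z - x))"
    proof -
      have "integrable lborel (\<lambda>z. q (z - x) * (f z / Z))"
      proof (rule integrable_compact_support_mult[where \<delta> = "\<delta> + norm x"])
        show "continuous_on UNIV (\<lambda>z. q (z - x))"
          by (intro continuous_on_compose2[OF q_cont] continuous_intros) auto
        show "continuous_on (cball 0 (\<delta> + norm x)) (\<lambda>z. f z / Z)"
          using \<open>0 < Z\<close> by (intro continuous_intros continuous_on_subset[OF f]) auto
        show "q (u - x) = 0" if "\<delta> + norm x < norm u" for u
          using norm_triangle_ineq2[of u x] that by (intro q_supp) linarith
      qed
      then show ?thesis by (simp add: mult.commute)
    qed
    have "avg m f x = (\<integral>u. f (x + u) / Z * q (x + u - x) \<partial>lborel)"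
      by (simp add: avg_def m_def mult.commute)
    also have "\<dots> = (\<integral>z. f z / Z * q (z - x) \<partial>distr lborel borel ((+) x))"
      using int by (intro integral_distr[symmetric]) auto
    also have "\<dots> = integral UNIV (\<lambda>z. f z / Z * q (z - x))"
      unfolding lborel_distr_plus by (rule integral_lborel[OF int, symmetric])
    also have "\<dots> = smear (\<lambda>z. f z / Z) (\<lambda>_. b) x"
      by (simp only: smear_def q_def vector_minus_component)
    finally show "avg m f x = smear (\<lambda>z. f z / Z) (\<lambda>_. b) x" .
  qed
  moreover have "continuous_on UNIV (\<lambda>z. f z / Z) \<and> bounded (range (\<lambda>z. f z / Z))"
    if "continuous_on UNIV f" "bounded (range f)" for f :: "real ^ 'd \<Rightarrow> real"
    using that \<open>0 < Z\<close> bounded_scaleR_comp[of f UNIV "1 / Z"] by (auto intro!: continuous_intros)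
  ultimately have "avg m f \<in> Cb_infinity \<and> (\<exists>r\<ge>0. avg m f \<in> Lip_b r)"
    if "continuous_on UNIV f" "bounded (range f)" for f
    using smear_Cb_infinity[of "\<lambda>z. f z / Z" "\<lambda>_. b" \<eta>] smear_Lip_b[of "\<lambda>z. f z / Z" "\<lambda>_. b" \<eta>] b that
    by simp
  with \<open>kernel \<delta> m\<close> show ?thesis by blast
qed

text \<open>
  Convexity of an operator directly concerns finite convex combinations only, so averages are
  approximated by such combinations, with an error that is uniform in \<open>x\<close> and depends on \<open>f\<close> only
  through its Lipschitz constant. The weights come from a continuous partition of unity, subordinate
  to a finite cover by balls of radius \<open>\<eta>\<close>, so that all integrands remain continuous on the support
  of the kernel.
\<close>

lemma avg_riemann_sum:
  fixes m :: "real ^ 'd \<Rightarrow> real"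
  assumes "kernel \<delta> m" and "0 < \<eta>"
  obtains Z \<alpha> where "finite Z" and "Z \<subseteq> cball 0 \<delta>" and "\<And>z. 0 \<le> \<alpha> z" and "(\<Sum>z\<in>Z. \<alpha> z) = 1"
    and "\<And>L f x. L-lipschitz_on UNIV f \<Longrightarrow> \<bar>avg m f x - (\<Sum>z\<in>Z. \<alpha> z * f (x + z))\<bar> \<le> L * \<eta>"
proof -
  obtain Z :: "(real ^ 'd) set" where Z: "finite Z" "Z \<subseteq> cball 0 \<delta>" "cball 0 \<delta> \<subseteq> (\<Union>z\<in>Z. ball z \<eta>)"
    by (rule compactE_image[OF compact_cball, of "cball 0 \<delta>" "\<lambda>z. ball z \<eta>" 0 \<delta>])
       (use \<open>0 < \<eta>\<close> in auto)
  define hat where "hat z u = max 0 (\<eta> - dist z u)" for z u :: "real ^ 'd"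
  define W where "W u = (\<Sum>z\<in>Z. hat z u)" for u
  define w where "w z u = hat z u / W u" for z u
  have W: "0 < W u" if "u \<in> cball 0 \<delta>" for u
  proof -
    obtain z where "z \<in> Z" "dist z u < \<eta>" using Z(3) \<open>u \<in> cball 0 \<delta>\<close> by auto
    then have "0 < hat z u" by (simp add: hat_def)
    then show ?thesis
      unfolding W_def using \<open>z \<in> Z\<close> Z(1) by (intro sum_pos2[of Z z]) (auto simp: hat_def)
  qed
  have w_sum: "(\<Sum>z\<in>Z. w z u) = 1" if "u \<in> cball 0 \<delta>" for u
    using W[OF that] by (simp add: w_def W_def flip: sum_divide_distrib)
  have w_nonneg: "0 \<le> w z u" for z u
    by (auto simp: w_def W_def hat_def intro!: divide_nonneg_nonneg sum_nonneg)
  have w_cont: "continuous_on (cball 0 \<delta>) (w z)" for z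
    unfolding w_def W_def hat_def
    by (intro continuous_intros) (use W in \<open>auto simp: W_def hat_def less_le\<close>)
  have w_int: "integrable lborel (\<lambda>u. m u * w z u)" for z
    by (rule kernel_integrable[OF assms(1) w_cont])
  have m: "0 \<le> m u" "u \<notin> cball 0 \<delta> \<Longrightarrow> m u = 0" for u
    using assms(1) by (auto simp: kernel_def)
  have m_w: "m u * (\<Sum>z\<in>Z. w z u * c) = m u * c" for u c
    using w_sum[of u] m(2)[of u] by (cases "u \<in> cball 0 \<delta>") (auto simp flip: sum_distrib_right)
  define \<alpha> where "\<alpha> z = (\<integral>u. m u * w z u \<partial>lborel)" for z
  have "(\<Sum>z\<in>Z. \<alpha> z) = (\<integral>u. m u * (\<Sum>z\<in>Z. w z u * 1) \<partial>lborel)"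
    unfolding \<alpha>_def by (subst Bochner_Integration.integral_sum[symmetric]) (auto simp: w_int sum_distrib_left)
  also have "\<dots> = 1" unfolding m_w using assms(1) by (simp add: kernel_def)
  finally have sum: "(\<Sum>z\<in>Z. \<alpha> z) = 1" .
  have approx: "\<bar>avg m f x - (\<Sum>z\<in>Z. \<alpha> z * f (x + z))\<bar> \<le> L * \<eta>" if L: "L-lipschitz_on UNIV f" for L f x
  proof -
    have cont: "continuous_on UNIV f" using L by (rule lipschitz_on_continuous_on)
    have int: "integrable lborel (\<lambda>u. m u * (\<Sum>z\<in>Z. w z u * f (x + z)))"
      by (intro kernel_integrable[OF assms(1)] continuous_intros w_cont)
    have "(\<Sum>z\<in>Z. \<alpha> z * f (x + z)) = (\<integral>u. m u * (\<Sum>z\<in>Z. w z u * f (x + z)) \<partial>lborel)"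
    proof -
      have "(\<integral>u. m u * (\<Sum>z\<in>Z. w z u * f (x + z)) \<partial>lborel) = (\<integral>u. (\<Sum>z\<in>Z. m u * w z u * f (x + z)) \<partial>lborel)"
        by (simp add: sum_distrib_left mult.assoc)
      also have "\<dots> = (\<Sum>z\<in>Z. \<integral>u. m u * w z u * f (x + z) \<partial>lborel)"
        by (intro Bochner_Integration.integral_sum integrable_mult_left w_int)
      finally show ?thesis by (simp add: \<alpha>_def w_int)
    qed
    then have "avg m f x - (\<Sum>z\<in>Z. \<alpha> z * f (x + z)) =
        (\<integral>u. m u * f (x + u) - m u * (\<Sum>z\<in>Z. w z u * f (x + z)) \<partial>lborel)"
      using kernel_integrable_shift[OF assms(1) cont] int by (simp add: avg_def)
    also have "\<bar>\<dots>\<bar> \<le> (\<integral>u. m u * (L * \<eta>) \<partial>lborel)"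
      unfolding real_norm_def[symmetric]
    proof (rule order_trans[OF integral_norm_bound], rule integral_mono)
      fix u
      have "m u * f (x + u) - m u * (\<Sum>z\<in>Z. w z u * f (x + z)) =
          m u * (\<Sum>z\<in>Z. w z u * (f (x + u) - f (x + z)))"
        by (subst m_w[of u "f (x + u)", symmetric])
           (simp add: right_diff_distrib[symmetric] sum_subtractf[symmetric])
      moreover have "\<bar>\<Sum>z\<in>Z. w z u * (f (x + u) - f (x + z))\<bar> \<le> (\<Sum>z\<in>Z. w z u * (L * \<eta>))"
      proof (intro order_trans[OF sum_abs] sum_mono)
        fix z assume "z \<in> Z"
        show "\<bar>w z u * (f (x + u) - f (x + z))\<bar> \<le> w z u * (L * \<eta>)"
        proof (cases "dist z u < \<eta>")
          case True
          have "\<bar>f (x + u) - f (x + z)\<bar> \<le> L * dist (x + u) (x + z)"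
            using lipschitz_onD[OF L UNIV_I UNIV_I, of "x + u" "x + z"] by (simp only: dist_real_def)
          also have "\<dots> \<le> L * \<eta>"
            using True lipschitz_on_nonneg[OF L] by (intro mult_left_mono) (auto simp: dist_commute)
          finally show ?thesis
            using w_nonneg[of z u] by (simp add: abs_mult mult_left_mono)
        qed (simp add: w_def hat_def)
      qed
      then have "m u * \<bar>\<Sum>z\<in>Z. w z u * (f (x + u) - f (x + z))\<bar> \<le> m u * (\<Sum>z\<in>Z. w z u * (L * \<eta>))"
        using m(1) by (rule mult_left_mono)
      ultimately show "norm (m u * f (x + u) - m u * (\<Sum>z\<in>Z. w z u * f (x + z))) \<le> m u * (L * \<eta>)"
        unfolding m_w using m(1)[of u] by (simp add: abs_mult)
    qed (use kernel_integrable_shift[OF assms(1) cont] int kernel_integrable[OF assms(1), of "\<lambda>_. L * \<eta>"] in auto)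
    also have "\<dots> = L * \<eta>" using assms(1) by (simp add: kernel_def)
    finally show ?thesis .
  qed
  show ?thesis
    by (rule that[OF Z(1,2) _ sum approx]) (auto simp: \<alpha>_def m w_nonneg)
qed

section \<open>The weighted space and its mixed topology\<close>

lemma ball_kappa_iff:
  "f \<in> ball_kappa \<kappa> r \<longleftrightarrow> continuous_on UNIV f \<and> (\<forall>x. \<bar>f x\<bar> * \<kappa> x \<le> r)"
proof
  assume f: "f \<in> ball_kappa \<kappa> r"
  have "\<bar>f x\<bar> * \<kappa> x \<le> wnorm \<kappa> f" for x
    using f unfolding wnorm_def ball_kappa_def C_kappa_def by (intro cSUP_upper) auto
  then show "continuous_on UNIV f \<and> (\<forall>x. \<bar>f x\<bar> * \<kappa> x \<le> r)"
    using f by (auto simp: ball_kappa_def C_kappa_def intro: order_trans)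
next
  assume "continuous_on UNIV f \<and> (\<forall>x. \<bar>f x\<bar> * \<kappa> x \<le> r)"
  then show "f \<in> ball_kappa \<kappa> r"
    by (auto simp: ball_kappa_def C_kappa_def wnorm_def intro!: cSUP_least bdd_aboveI)
qed

lemma C_kappa_iff: "f \<in> C_kappa \<kappa> \<longleftrightarrow> (\<exists>r. f \<in> ball_kappa \<kappa> r)"
  by (auto simp: ball_kappa_def)

lemma C_kappa_continuous: "f \<in> C_kappa \<kappa> \<Longrightarrow> continuous_on UNIV f"
  by (simp add: C_kappa_def)

lemma ball_kappa_continuous: "f \<in> ball_kappa \<kappa> r \<Longrightarrow> continuous_on UNIV f"
  by (simp add: ball_kappa_iff)

lemma ball_kappa_D: "f \<in> ball_kappa \<kappa> r \<Longrightarrow> \<bar>f x\<bar> * \<kappa> x \<le> r"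
  by (simp add: ball_kappa_iff)

lemma ball_kappa_C: "f \<in> ball_kappa \<kappa> r \<Longrightarrow> f \<in> C_kappa \<kappa>"
  by (simp add: ball_kappa_def)

lemma ball_kappa_mono: "f \<in> ball_kappa \<kappa> r \<Longrightarrow> r \<le> s \<Longrightarrow> f \<in> ball_kappa \<kappa> s"
  by (auto simp: ball_kappa_def)

lemma le_supnorm_on:
  assumes "compact K" and "continuous_on UNIV g" and "x \<in> K"
  shows "\<bar>g x\<bar> \<le> supnorm_on K g"
proof -
  have "compact ((\<lambda>x. \<bar>g x\<bar>) ` K)"
    using assms by (intro compact_continuous_image continuous_intros) (auto intro: continuous_on_subset)
  then have "bdd_above ((\<lambda>x. \<bar>g x\<bar>) ` K)"
    by (intro bounded_imp_bdd_above compact_imp_bounded)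
  then show ?thesis using assms(3) by (auto simp: supnorm_on_def intro: cSUP_upper)
qed

lemma supnorm_on_le: "0 \<le> D \<Longrightarrow> (\<And>x. x \<in> K \<Longrightarrow> \<bar>g x\<bar> \<le> D) \<Longrightarrow> supnorm_on K g \<le> D"
  by (auto simp: supnorm_on_def intro: cSUP_least)

lemma supnorm_on_nonneg:
  assumes "compact K" and "continuous_on UNIV g"
  shows "0 \<le> supnorm_on K g"
  using le_supnorm_on[OF assms] by (cases "K = {}") (auto simp: supnorm_on_def intro: order_trans[OF abs_ge_zero])

lemma mixed_lim_iff:
  "mixed_lim \<kappa> F f \<longleftrightarrow> f \<in> C_kappa \<kappa> \<and> (\<exists>M. \<forall>n. F n \<in> ball_kappa \<kappa> M) \<and>
     (\<forall>K. compact K \<longrightarrow> uniform_limit K F f sequentially)"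
proof -
  have bdd: "(\<forall>n. F n \<in> C_kappa \<kappa>) \<and> bdd_above (range (\<lambda>n. wnorm \<kappa> (F n))) \<longleftrightarrow> (\<exists>M. \<forall>n. F n \<in> ball_kappa \<kappa> M)"
    by (auto simp: ball_kappa_def bdd_above_def)
  have "(\<lambda>n. supnorm_on K (\<lambda>x. F n x - f x)) \<longlonglongrightarrow> 0 \<longleftrightarrow> uniform_limit K F f sequentially"
    if K: "compact K" and F: "\<And>n. F n \<in> C_kappa \<kappa>" and f: "f \<in> C_kappa \<kappa>" for K
  proof
    have cont: "continuous_on UNIV (\<lambda>x. F n x - f x)" for n
      using F f by (intro continuous_intros C_kappa_continuous) auto
    show "uniform_limit K F f sequentially" if lim: "(\<lambda>n. supnorm_on K (\<lambda>x. F n x - f x)) \<longlonglongrightarrow> 0"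
    proof (rule uniform_limitI)
      fix e :: real assume "0 < e"
      then have "\<forall>\<^sub>F n in sequentially. supnorm_on K (\<lambda>x. F n x - f x) < e"
        using order_tendstoD(2)[OF lim] by simp
      then show "\<forall>\<^sub>F n in sequentially. \<forall>x\<in>K. dist (F n x) (f x) < e"
      proof eventually_elim
        case (elim n)
        show ?case
          using le_less_trans[OF le_supnorm_on[OF K cont[of n]] elim] by (simp add: dist_real_def)
      qed
    qed
    show "(\<lambda>n. supnorm_on K (\<lambda>x. F n x - f x)) \<longlonglongrightarrow> 0" if lim: "uniform_limit K F f sequentially"
    proof (rule tendstoI)
      fix e :: real assume "0 < e"
      then have "\<forall>\<^sub>F n in sequentially. \<forall>x\<in>K. dist (F n x) (f x) < e / 2"
        by (intro uniform_limitD[OF lim]) simp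
      then show "\<forall>\<^sub>F n in sequentially. dist (supnorm_on K (\<lambda>x. F n x - f x)) 0 < e"
      proof eventually_elim
        case (elim n)
        then have "supnorm_on K (\<lambda>x. F n x - f x) \<le> e / 2"
          using \<open>0 < e\<close> by (intro supnorm_on_le) (auto simp: dist_real_def less_imp_le)
        then show ?case using supnorm_on_nonneg[OF K cont, of n] \<open>0 < e\<close> by (simp add: dist_real_def)
      qed
    qed
  qed
  then have "(\<forall>K. compact K \<longrightarrow> (\<lambda>n. supnorm_on K (\<lambda>x. F n x - f x)) \<longlonglongrightarrow> 0) \<longleftrightarrow>
      (\<forall>K. compact K \<longrightarrow> uniform_limit K F f sequentially)"
    if "\<forall>n. F n \<in> C_kappa \<kappa>" "f \<in> C_kappa \<kappa>"
    using that by simp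
  then show ?thesis unfolding mixed_lim_def bdd[symmetric] by argo
qed

locale weight =
  fixes \<kappa> :: "real ^ 'd \<Rightarrow> real"
  assumes kappa_pos: "0 < \<kappa> x"
    and kappa_bounded: "bounded (range \<kappa>)"
    and kappa_cont: "continuous_on UNIV \<kappa>"
    and kappa_ratio: "bdd_above {\<kappa> x / \<kappa> (x - y) | x y. norm y \<le> 1}"
begin

abbreviation C where "C \<equiv> C_kappa \<kappa>"
abbreviation B where "B \<equiv> ball_kappa \<kappa>"

definition kmax where "kmax = Sup (range \<kappa>)"
definition krat where "krat = Sup {\<kappa> x / \<kappa> (x - y) | x y. norm y \<le> 1}"

lemma kappa_le: "\<kappa> x \<le> kmax"
  unfolding kmax_def by (intro cSUP_upper bounded_imp_bdd_above kappa_bounded) simp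

lemma kmax_pos: "0 < kmax"
  using kappa_le[of 0] kappa_pos[of 0] by linarith

lemma kappa_le_shift:
  assumes "norm y \<le> 1"
  shows "\<kappa> x \<le> krat * \<kappa> (x + y)"
proof -
  have "\<exists>x' y'. \<kappa> x / \<kappa> (x - (- y)) = \<kappa> x' / \<kappa> (x' - y') \<and> norm y' \<le> 1"
    by (rule exI[of _ x], rule exI[of _ "- y"]) (simp add: assms)
  then have "\<kappa> x / \<kappa> (x - (- y)) \<le> krat"
    unfolding krat_def by (intro cSup_upper kappa_ratio) simp
  then show ?thesis using kappa_pos[of "x + y"] by (simp add: divide_le_eq)
qed

lemma krat_pos: "0 < krat"
proof -
  have "1 \<le> krat" using kappa_le_shift[of 0 0] kappa_pos[of 0] by simp
  then show ?thesis by simp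
qed

lemma ball_nonneg: "f \<in> B r \<Longrightarrow> 0 \<le> r"
  using ball_kappa_D[of f \<kappa> r 0] kappa_pos[of 0] by (auto intro: order_trans[rotated] mult_nonneg_nonneg less_imp_le)

lemma ball_add: "f \<in> B r \<Longrightarrow> g \<in> B s \<Longrightarrow> (\<lambda>x. f x + g x) \<in> B (r + s)"
proof -
  assume f: "f \<in> B r" and g: "g \<in> B s"
  have "\<bar>f x + g x\<bar> * \<kappa> x \<le> r + s" for x
  proof -
    have "\<bar>f x + g x\<bar> * \<kappa> x \<le> (\<bar>f x\<bar> + \<bar>g x\<bar>) * \<kappa> x"
      using kappa_pos[of x] by (intro mult_right_mono) auto
    then show ?thesis using ball_kappa_D[OF f, of x] ball_kappa_D[OF g, of x] by (simp add: distrib_right)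
  qed
  then show ?thesis using f g by (auto simp: ball_kappa_iff intro!: continuous_intros)
qed

lemma ball_scale: "f \<in> B r \<Longrightarrow> (\<lambda>x. c * f x) \<in> B (\<bar>c\<bar> * r)"
  by (auto simp: ball_kappa_iff abs_mult mult.assoc intro!: continuous_intros mult_left_mono)

lemma ball_diff: "f \<in> B r \<Longrightarrow> g \<in> B s \<Longrightarrow> (\<lambda>x. f x - g x) \<in> B (r + s)"
  using ball_add[of f r "\<lambda>x. (-1) * g x" s] ball_scale[of g s "-1"] by simp

lemma C_add: "f \<in> C \<Longrightarrow> g \<in> C \<Longrightarrow> (\<lambda>x. f x + g x) \<in> C"
  using ball_add unfolding C_kappa_iff by blast

lemma C_diff: "f \<in> C \<Longrightarrow> g \<in> C \<Longrightarrow> (\<lambda>x. f x - g x) \<in> C"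
  using ball_diff unfolding C_kappa_iff by blast

lemma C_scale: "f \<in> C \<Longrightarrow> (\<lambda>x. c * f x) \<in> C"
  using ball_scale unfolding C_kappa_iff by blast

lemma C_zero: "(\<lambda>_. 0) \<in> C"
  unfolding C_kappa_iff by (auto simp: ball_kappa_iff)

lemma C_sum: "finite Z \<Longrightarrow> (\<And>z. z \<in> Z \<Longrightarrow> f z \<in> C) \<Longrightarrow> (\<lambda>x. \<Sum>z\<in>Z. a z * f z x) \<in> C"
  by (induction Z rule: finite_induct) (auto intro!: C_zero C_add C_scale)

lemma C_ball: "f \<in> C \<Longrightarrow> \<exists>r\<ge>0. f \<in> B r"
  unfolding C_kappa_iff using ball_nonneg by blast

lemma bounded_ball:
  assumes "continuous_on UNIV f" and "\<And>x. \<bar>f x\<bar> \<le> r"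
  shows "f \<in> B (r * kmax)"
  unfolding ball_kappa_iff
proof (intro conjI allI assms(1))
  show "\<bar>f x\<bar> * \<kappa> x \<le> r * kmax" for x
    using assms(2)[of x] kappa_le[of x] kappa_pos[of x] by (intro mult_mono) auto
qed

lemma Lip_b_continuous: "f \<in> Lip_b r \<Longrightarrow> continuous_on UNIV f"
  by (auto simp: Lip_b_def dest: lipschitz_on_continuous_on)

lemma Lip_b_nonneg: "f \<in> Lip_b r \<Longrightarrow> 0 \<le> r"
  by (auto simp: Lip_b_def dest: lipschitz_on_nonneg)

lemma Lip_b_mono: "f \<in> Lip_b r \<Longrightarrow> r \<le> s \<Longrightarrow> f \<in> Lip_b s"
  by (auto simp: Lip_b_def intro: lipschitz_on_mono order_trans)

lemma Lip_b_ball: "f \<in> Lip_b r \<Longrightarrow> f \<in> B (r * kmax)"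
  by (rule bounded_ball) (auto simp: Lip_b_def dest: lipschitz_on_continuous_on)

lemma Lip_b_C: "f \<in> Lip_b r \<Longrightarrow> f \<in> C"
  by (rule ball_kappa_C[OF Lip_b_ball])

lemma Lip_b_D: "f \<in> Lip_b r \<Longrightarrow> \<bar>f x - f y\<bar> \<le> r * norm (x - y)"
  by (auto simp: Lip_b_def dist_norm dest: lipschitz_onD)

lemma Cb_infinity_C:
  assumes "f \<in> Cb_infinity"
  shows "f \<in> C"
proof -
  have "f differentiable (at x)" "bounded (range f)" for x
    using assms by (auto simp: Cb_infinity_def dest: spec[of _ "[]"])
  then have "continuous_on UNIV f"
    by (intro continuous_at_imp_continuous_on ballI differentiable_imp_continuous_within)
  moreover obtain r where "\<And>x. \<bar>f x\<bar> \<le> r" using \<open>bounded (range f)\<close> by (auto simp: bounded_iff)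
  ultimately show ?thesis using bounded_ball ball_kappa_C by blast
qed

lemma avg_ball:
  assumes "kernel \<delta> m" and "\<delta> \<le> 1" and f: "f \<in> B r" and "continuous_on UNIV (avg m f)"
  shows "avg m f \<in> B (krat * r)"
  unfolding ball_kappa_iff
proof (intro conjI allI assms(4))
  fix x
  have "\<bar>f (x + u) - 0\<bar> \<le> krat * r / \<kappa> x" if "norm u \<le> \<delta>" for u
  proof -
    have "\<bar>f (x + u)\<bar> * \<kappa> x \<le> \<bar>f (x + u)\<bar> * (krat * \<kappa> (x + u))"
      using kappa_le_shift[of u x] that \<open>\<delta> \<le> 1\<close> by (intro mult_left_mono) auto
    also have "\<dots> \<le> krat * r"
      using ball_kappa_D[OF f, of "x + u"] krat_pos by (simp add: mult.left_commute mult_left_mono)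
    finally show ?thesis using kappa_pos[of x] by (simp add: le_divide_eq)
  qed
  from avg_close[OF assms(1) ball_kappa_continuous[OF f] this]
  show "\<bar>avg m f x\<bar> * \<kappa> x \<le> krat * r"
    using kappa_pos[of x] by (simp add: le_divide_eq)
qed

text \<open>
  Truncation at a level that \<open>f\<close> does not exceed near \<open>K\<close> makes \<open>f\<close> bounded without increasing
  \<open>\<bar>f\<bar>\<close>, and averaging makes it smooth. The bound on \<open>\<kappa> x / \<kappa> (x - y)\<close> controls the weighted norm of
  the average. It is essential that the resulting radius \<open>krat * r\<close> depends neither on \<open>K\<close> nor on \<open>\<eta>\<close>:
  the approximation is applied to sets \<open>K\<close> and tolerances \<open>\<eta>\<close> that are themselves chosen for a given
  radius.
\<close>

lemma smooth_dense:
  assumes f: "f \<in> B r" and K: "compact K" and "0 < \<eta>"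
  shows "\<exists>g L. g \<in> Cb_infinity \<and> 0 \<le> L \<and> g \<in> Lip_b L \<and> g \<in> B (krat * r) \<and> (\<forall>x\<in>K. \<bar>f x - g x\<bar> \<le> \<eta>)"
proof -
  define K1 where "K1 = {x + y | x y. x \<in> K \<and> y \<in> cball 0 1}"
  have "compact K1" unfolding K1_def by (rule compact_sums[OF K compact_cball])
  have f_cont: "continuous_on UNIV f" by (rule ball_kappa_continuous[OF f])
  have "compact (f ` K1)"
    using \<open>compact K1\<close> continuous_on_subset[OF f_cont] by (intro compact_continuous_image) auto
  then obtain N where N: "0 \<le> N" "\<And>x. x \<in> K1 \<Longrightarrow> \<bar>f x\<bar> \<le> N"
    using compact_imp_bounded bounded_pos by (metis image_eqI less_imp_le real_norm_def)
  define F where "F x = max (- N) (min N (f x))" for x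
  have F_cont: "continuous_on UNIV F" unfolding F_def by (intro continuous_intros f_cont)
  have F_bounded: "\<bar>F x\<bar> \<le> N" and F_le: "\<bar>F x\<bar> \<le> \<bar>f x\<bar>" for x
    using N(1) by (auto simp: F_def)
  have F_eq: "F x = f x" if "x \<in> K1" for x
    using N(2)[OF that] by (auto simp: F_def)
  have F_ball: "F \<in> B r"
    unfolding ball_kappa_iff
    using F_cont ball_kappa_D[OF f] mult_right_mono[OF F_le less_imp_le[OF kappa_pos]] order_trans by blast
  have "uniformly_continuous_on K1 F"
    using \<open>compact K1\<close> continuous_on_subset[OF F_cont] by (intro compact_uniformly_continuous) auto
  then obtain d where d: "0 < d" "\<And>x x'. x \<in> K1 \<Longrightarrow> x' \<in> K1 \<Longrightarrow> dist x' x < d \<Longrightarrow> dist (F x') (F x) < \<eta>"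
    using \<open>0 < \<eta>\<close> unfolding uniformly_continuous_on_def by metis
  define \<delta> where "\<delta> = min 1 (d / 2)"
  have "0 < \<delta>" "\<delta> \<le> 1" "\<delta> < d" using d(1) by (auto simp: \<delta>_def)
  obtain m :: "real ^ 'd \<Rightarrow> real" where m: "kernel \<delta> m"
    "\<And>f. continuous_on UNIV f \<Longrightarrow> bounded (range f) \<Longrightarrow> avg m f \<in> Cb_infinity \<and> (\<exists>r\<ge>0. avg m f \<in> Lip_b r)"
    using exists_smooth_kernel[OF \<open>0 < \<delta>\<close>] by blast
  have "bounded (range F)" using F_bounded by (auto simp: bounded_iff)
  then obtain L where L: "avg m F \<in> Cb_infinity" "0 \<le> L" "avg m F \<in> Lip_b L"
    using m(2)[OF F_cont] by blast
  have "\<bar>f x - avg m F x\<bar> \<le> \<eta>" if "x \<in> K" for x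
  proof -
    have in_K1: "x + u \<in> K1" if "norm u \<le> \<delta>" for u
      using \<open>x \<in> K\<close> that \<open>\<delta> \<le> 1\<close> by (force simp: K1_def)
    have "\<bar>F (x + u) - F x\<bar> \<le> \<eta>" if "norm u \<le> \<delta>" for u
      using d(2)[of x "x + u"] in_K1[OF that] in_K1[of 0] that \<open>0 < \<delta>\<close> \<open>\<delta> < d\<close>
      by (simp add: dist_norm)
    from avg_close[OF m(1) F_cont this] show ?thesis
      using F_eq[of x] in_K1[of 0] \<open>0 < \<delta>\<close> by (simp add: abs_minus_commute)
  qed
  then show ?thesis
    using L avg_ball[OF m(1) \<open>\<delta> \<le> 1\<close> F_ball Lip_b_continuous[OF L(3)]] by blast
qed

end

section \<open>Convex operators with local stability\<close>

text \<open>
  The local stability estimate of the iterates, as a property of a single operator. Its additive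
  error \<open>\<epsilon>\<close> does not scale with the distance of the two arguments.
\<close>

definition (in weight) controls ::
    "real \<Rightarrow> (real ^ 'd) set \<Rightarrow> (real ^ 'd) set \<Rightarrow> real \<Rightarrow> real
      \<Rightarrow> ((real ^ 'd \<Rightarrow> real) \<Rightarrow> real ^ 'd \<Rightarrow> real) \<Rightarrow> bool" where
  "controls r K K' c \<epsilon> \<Phi> \<longleftrightarrow> (\<forall>f\<in>B r. \<forall>g\<in>B r. \<forall>D\<ge>0.
     (\<forall>y\<in>K'. \<bar>f y - g y\<bar> \<le> D) \<longrightarrow> (\<forall>x\<in>K. \<bar>\<Phi> f x - \<Phi> g x\<bar> \<le> c * D + \<epsilon>))"

lemma (in weight) controlsD:
  assumes "controls r K K' c \<epsilon> \<Phi>" and "f \<in> B r" and "g \<in> B r" and "0 \<le> D"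
    and "\<And>y. y \<in> K' \<Longrightarrow> \<bar>f y - g y\<bar> \<le> D" and "x \<in> K"
  shows "\<bar>\<Phi> f x - \<Phi> g x\<bar> \<le> c * D + \<epsilon>"
  using assms unfolding controls_def by blast

text \<open>
  Jensen's inequality for finite convex combinations, by splitting off one point and renormalising
  the remaining weights.
\<close>

lemma (in weight) convex_op_sum:
  assumes "convex_op C \<Phi>" and "finite Z" and "\<And>z. z \<in> Z \<Longrightarrow> f z \<in> C"
    and "\<And>z. z \<in> Z \<Longrightarrow> 0 \<le> a z" and "(\<Sum>z\<in>Z. a z) = 1"
  shows "\<Phi> (\<lambda>x. \<Sum>z\<in>Z. a z * f z x) x \<le> (\<Sum>z\<in>Z. a z * \<Phi> (f z) x)"
  using assms(2-5)
proof (induction Z arbitrary: a rule: finite_induct)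
  case (insert z Z)
  show ?case
  proof (cases "a z = 1")
    case True
    then have "(\<Sum>z\<in>Z. a z) = 0" using insert.prems(3) insert.hyps by simp
    then have "\<forall>z\<in>Z. a z = 0"
      using insert.hyps insert.prems(2) by (subst (asm) sum_nonneg_eq_0_iff) auto
    then show ?thesis using True insert.hyps by simp
  next
    case False
    have sum: "(\<Sum>z\<in>Z. a z) = 1 - a z" using insert.prems(3) insert.hyps by simp
    moreover have "0 \<le> (\<Sum>z\<in>Z. a z)" using insert.prems(2) by (intro sum_nonneg) auto
    ultimately have "a z < 1" using False by linarith
    define b where "b y = a y / (1 - a z)" for y
    have b: "(1 - a z) * (\<Sum>y\<in>Z. b y * g y) = (\<Sum>y\<in>Z. a y * g y)" for g :: "_ \<Rightarrow> real"
      using \<open>a z < 1\<close> by (simp add: b_def sum_distrib_left)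
    have IH: "\<Phi> (\<lambda>x. \<Sum>y\<in>Z. b y * f y x) x \<le> (\<Sum>y\<in>Z. b y * \<Phi> (f y) x)"
      using insert.prems \<open>a z < 1\<close> sum
      by (intro insert.IH) (auto simp: b_def simp flip: sum_divide_distrib)
    have "\<Phi> (\<lambda>x. a z * f z x + (1 - a z) * (\<Sum>y\<in>Z. b y * f y x)) x
        \<le> a z * \<Phi> (f z) x + (1 - a z) * \<Phi> (\<lambda>x. \<Sum>y\<in>Z. b y * f y x) x"
      using assms(1) insert.prems \<open>a z < 1\<close> C_sum[OF insert.hyps(1), of f b]
      unfolding convex_op_def le_fun_def by simp
    also have "\<dots> \<le> a z * \<Phi> (f z) x + (1 - a z) * (\<Sum>y\<in>Z. b y * \<Phi> (f y) x)"
      using IH \<open>a z < 1\<close> by (intro add_left_mono mult_left_mono) auto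
    finally show ?thesis using insert.hyps by (simp add: b)
  qed
qed simp

text \<open>
  The slope of a convex function increases along a line. A perturbation of size \<open>s\<close> in the argument
  is thereby traded for a factor \<open>s\<close> in the value; together with the estimate \<open>controls\<close>, whose
  additive error is then multiplied by \<open>s\<close> as well, this allows the summation of about \<open>1 / s\<close> errors.
\<close>

lemma (in weight) convex_op_secant:
  assumes "convex_op C \<Phi>" and f: "f \<in> C" and b: "b \<in> C" and "0 \<le> s" "s \<le> 1"
  shows "\<Phi> (\<lambda>x. f x + s * b x) x - \<Phi> f x \<le> s * (\<Phi> (\<lambda>x. f x + b x) x - \<Phi> f x)"
proof -
  have "(\<lambda>x. s * (f x + b x) + (1 - s) * f x) = (\<lambda>x. f x + s * b x)"
    by (simp add: fun_eq_iff algebra_simps)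
  moreover have "\<Phi> (\<lambda>x. s * (f x + b x) + (1 - s) * f x) x \<le> s * \<Phi> (\<lambda>x. f x + b x) x + (1 - s) * \<Phi> f x"
    using assms(1) C_add[OF f b] f \<open>0 \<le> s\<close> \<open>s \<le> 1\<close> unfolding convex_op_def le_fun_def by simp
  ultimately show ?thesis by (simp add: algebra_simps)
qed

section \<open>The approximation scheme and its iterates\<close>

lemma num_steps_props:
  assumes "0 < h" and "0 \<le> t"
  shows "real (num_steps h t) * h \<le> t" and "t < (real (num_steps h t) + 1) * h"
proof -
  have eq: "{k::nat. real k * h \<le> t} = {..nat \<lfloor>t / h\<rfloor>}"
    using assms by (auto simp: pos_le_divide_eq[symmetric] le_nat_iff le_floor_iff)
  have "num_steps h t = nat \<lfloor>t / h\<rfloor>"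
    unfolding num_steps_def eq by (rule Max_eqI) auto
  then have "real (num_steps h t) = of_int \<lfloor>t / h\<rfloor>"
    using assms by simp
  then show "real (num_steps h t) * h \<le> t" and "t < (real (num_steps h t) + 1) * h"
    using assms of_int_floor_le[of "t / h"] floor_correct[of "t / h"]
    by (auto simp: pos_le_divide_eq[symmetric] pos_divide_less_eq[symmetric])
qed

lemma num_steps_of_nat:
  assumes "0 < h"
  shows "num_steps h (real k * h) = k"
  using num_steps_props[OF assms, of "real k * h"] assms
  by (simp add: mult_le_cancel_right mult_less_cancel_right)

locale scheme = weight \<kappa> for \<kappa> :: "real ^ 'd \<Rightarrow> real" +
  fixes h :: "nat \<Rightarrow> real"
    and I :: "real \<Rightarrow> (real ^ 'd \<Rightarrow> real) \<Rightarrow> (real ^ 'd \<Rightarrow> real)"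
  assumes h_pos: "0 < h n"
    and h_lim: "h \<longlonglongrightarrow> 0"
    and I_maps: "0 \<le> t \<Longrightarrow> I t \<in> C_kappa \<kappa> \<rightarrow> C_kappa \<kappa>"
    and assumption_A: "assumption_A \<kappa> h I"
begin

lemma I_C: "f \<in> C \<Longrightarrow> I (h n) f \<in> C"
  using I_maps[of "h n"] h_pos[of n] by auto

lemma I_convex: "convex_op C (I (h n))"
  and I_mono: "mono_on C (I (h n))"
  and I_zero: "I (h n) (\<lambda>_. 0) = (\<lambda>_. 0)"
  using assumption_A unfolding assumption_A_def by simp_all

text \<open>
  The constants of the stability assumptions are fixed by choice, so that the estimates for iterates
  can be expressed by explicit formulas.
\<close>

definition growth where
  "growth = (SOME \<omega>. \<omega> \<ge> 0 \<and> (\<forall>n. \<forall>f \<in> C. wnorm \<kappa> (I (h n) f) \<le> exp (\<omega> * h n) * wnorm \<kappa> f))"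

lemma growth_nonneg: "0 \<le> growth"
  and growth: "f \<in> C \<Longrightarrow> wnorm \<kappa> (I (h n) f) \<le> exp (growth * h n) * wnorm \<kappa> f"
proof -
  have "\<exists>\<omega>\<ge>0. \<forall>n. \<forall>f \<in> C. wnorm \<kappa> (I (h n) f) \<le> exp (\<omega> * h n) * wnorm \<kappa> f"
    using assumption_A unfolding assumption_A_def by (elim conjE) assumption
  then have "growth \<ge> 0 \<and> (\<forall>n. \<forall>f \<in> C. wnorm \<kappa> (I (h n) f) \<le> exp (growth * h n) * wnorm \<kappa> f)"
    unfolding growth_def by (rule someI_ex)
  then show "0 \<le> growth" "f \<in> C \<Longrightarrow> wnorm \<kappa> (I (h n) f) \<le> exp (growth * h n) * wnorm \<kappa> f"
    by auto
qed

lemma I_ball: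
  assumes "f \<in> B r"
  shows "I (h n) f \<in> B (exp (growth * h n) * r)"
proof -
  have "f \<in> C" "wnorm \<kappa> f \<le> r" using assms by (auto simp: ball_kappa_def)
  then have "wnorm \<kappa> (I (h n) f) \<le> exp (growth * h n) * r"
    using growth[of f n] by (meson exp_ge_zero mult_left_mono order_trans)
  then show ?thesis using I_C[OF \<open>f \<in> C\<close>] by (simp add: ball_kappa_def)
qed

definition kappa_lip where
  "kappa_lip = (SOME \<omega> :: real \<Rightarrow> real. (\<forall>r\<ge>0. 0 \<le> \<omega> r) \<and> mono_on {0..} \<omega> \<and>
        (\<forall>r\<ge>0. \<forall>n. \<forall>f \<in> B r. \<forall>g \<in> B r.
           wnorm \<kappa> (\<lambda>x. I (h n) f x - I (h n) g x) \<le> exp (h n * \<omega> r) * wnorm \<kappa> (\<lambda>x. f x - g x)))"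

lemma kappa_lip_nonneg: "0 \<le> r \<Longrightarrow> 0 \<le> kappa_lip r"
  and kappa_lip: "f \<in> B r \<Longrightarrow> g \<in> B r \<Longrightarrow>
     wnorm \<kappa> (\<lambda>x. I (h n) f x - I (h n) g x) \<le> exp (h n * kappa_lip r) * wnorm \<kappa> (\<lambda>x. f x - g x)"
proof -
  have "\<exists>\<omega> :: real \<Rightarrow> real. (\<forall>r\<ge>0. 0 \<le> \<omega> r) \<and> mono_on {0..} \<omega> \<and>
        (\<forall>r\<ge>0. \<forall>n. \<forall>f \<in> B r. \<forall>g \<in> B r.
           wnorm \<kappa> (\<lambda>x. I (h n) f x - I (h n) g x) \<le> exp (h n * \<omega> r) * wnorm \<kappa> (\<lambda>x. f x - g x))"
    using assumption_A unfolding assumption_A_def by (elim conjE) assumption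
  then have "(\<forall>r\<ge>0. 0 \<le> kappa_lip r) \<and> mono_on {0..} kappa_lip \<and>
        (\<forall>r\<ge>0. \<forall>n. \<forall>f \<in> B r. \<forall>g \<in> B r.
           wnorm \<kappa> (\<lambda>x. I (h n) f x - I (h n) g x) \<le> exp (h n * kappa_lip r) * wnorm \<kappa> (\<lambda>x. f x - g x))"
    unfolding kappa_lip_def by (rule someI_ex)
  then show "0 \<le> r \<Longrightarrow> 0 \<le> kappa_lip r"
    "f \<in> B r \<Longrightarrow> g \<in> B r \<Longrightarrow>
     wnorm \<kappa> (\<lambda>x. I (h n) f x - I (h n) g x) \<le> exp (h n * kappa_lip r) * wnorm \<kappa> (\<lambda>x. f x - g x)"
    using ball_nonneg[of f r] by auto
qed

lemma I_kappa_lip: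
  assumes "f \<in> B r" and "g \<in> B r" and "(\<lambda>x. f x - g x) \<in> B M"
  shows "(\<lambda>x. I (h n) f x - I (h n) g x) \<in> B (exp (h n * kappa_lip r) * M)"
proof -
  have "wnorm \<kappa> (\<lambda>x. I (h n) f x - I (h n) g x) \<le> exp (h n * kappa_lip r) * M"
    using kappa_lip[OF assms(1,2), of n] assms(3) by (simp add: ball_kappa_def) (meson exp_ge_zero mult_left_mono order_trans)
  then show ?thesis
    using C_diff[OF I_C I_C] assms(1,2) ball_kappa_C by (auto simp: ball_kappa_def)
qed

definition lip_growth where
  "lip_growth = (SOME c. c \<ge> 0 \<and> (\<forall>r\<ge>0. \<forall>n. \<forall>f \<in> Lip_b r. I (h n) f \<in> Lip_b (exp (c * h n) * r)))"

lemma lip_growth_nonneg: "0 \<le> lip_growth"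
  and I_Lip_b: "f \<in> Lip_b r \<Longrightarrow> I (h n) f \<in> Lip_b (exp (lip_growth * h n) * r)"
proof -
  have "\<exists>c\<ge>0. \<forall>r\<ge>0. \<forall>n. \<forall>f \<in> Lip_b r. I (h n) f \<in> Lip_b (exp (c * h n) * r)"
    using assumption_A unfolding assumption_A_def by (elim conjE) assumption
  then have "lip_growth \<ge> 0 \<and> (\<forall>r\<ge>0. \<forall>n. \<forall>f \<in> Lip_b r. I (h n) f \<in> Lip_b (exp (lip_growth * h n) * r))"
    unfolding lip_growth_def by (rule someI_ex)
  then show "0 \<le> lip_growth" "f \<in> Lip_b r \<Longrightarrow> I (h n) f \<in> Lip_b (exp (lip_growth * h n) * r)"
    using Lip_b_nonneg[of f r] by auto
qed

definition J :: "nat \<Rightarrow> nat \<Rightarrow> (real ^ 'd \<Rightarrow> real) \<Rightarrow> real ^ 'd \<Rightarrow> real" where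
  "J n k = I (h n) ^^ k"

lemma J_0 [simp]: "J n 0 f = f"
  and J_Suc: "J n (Suc k) f = I (h n) (J n k f)"
  and J_add: "J n (j + k) f = J n j (J n k f)"
  by (auto simp: J_def funpow_add)

lemma J_Suc': "J n (Suc k) f = J n k (I (h n) f)"
  using J_add[of n k 1 f] J_Suc[of n 0 f] by simp

lemma J_C: "f \<in> C \<Longrightarrow> J n k f \<in> C"
  by (induction k) (auto simp: J_Suc I_C)

lemma J_mono:
  assumes "f \<in> C" and "g \<in> C" and "\<And>x. f x \<le> g x"
  shows "J n k f x \<le> J n k g x"
proof -
  have "J n k f \<le> J n k g"
  proof (induction k)
    case (Suc k)
    then show ?case
      unfolding J_Suc by (intro mono_onD[OF I_mono] J_C assms)
  qed (use assms(3) in \<open>auto simp: le_fun_def\<close>)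
  then show ?thesis by (simp add: le_fun_def)
qed

lemma J_zero: "J n k (\<lambda>_. 0) = (\<lambda>_. 0)"
  by (induction k) (auto simp: J_Suc I_zero)

lemma J_convex: "convex_op C (J n k)"
  unfolding convex_op_def
proof (intro ballI)
  fix f g and u :: real
  assume f: "f \<in> C" and g: "g \<in> C" and u: "u \<in> {0..1}"
  show "J n k (\<lambda>x. u * f x + (1 - u) * g x) \<le> (\<lambda>x. u * J n k f x + (1 - u) * J n k g x)"
  proof (induction k)
    case (Suc k)
    have "I (h n) (J n k (\<lambda>x. u * f x + (1 - u) * g x)) \<le> I (h n) (\<lambda>x. u * J n k f x + (1 - u) * J n k g x)"
      by (intro mono_onD[OF I_mono] J_C C_add C_scale f g Suc)
    also have "\<dots> \<le> (\<lambda>x. u * I (h n) (J n k f) x + (1 - u) * I (h n) (J n k g) x)"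
      using I_convex J_C[OF f] J_C[OF g] u unfolding convex_op_def by blast
    finally show ?case by (simp add: J_Suc)
  qed simp
qed

lemma J_ball':
  assumes "f \<in> B r"
  shows "J n k f \<in> B (exp (growth * (real k * h n)) * r)"
proof (induction k)
  case (Suc k)
  then show ?case
    using I_ball[OF Suc, of n] by (simp add: J_Suc algebra_simps exp_add)
qed (use assms in simp)

lemma J_ball:
  assumes "f \<in> B r" and "real k * h n \<le> T"
  shows "J n k f \<in> B (exp (growth * T) * r)"
  using J_ball'[OF assms(1), of n k] assms(2) growth_nonneg ball_nonneg[OF assms(1)]
  by (elim ball_kappa_mono) (auto intro!: mult_right_mono mult_left_mono)

definition kappa_lip_upto where
  "kappa_lip_upto r T = exp (T * kappa_lip (exp (growth * T) * r))"

text \<open>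
  Up to time \<open>T\<close> the iterates of functions from the ball of radius \<open>r\<close> stay in the ball of radius
  \<open>exp (growth * T) * r\<close>, so the one-step Lipschitz constant of that larger ball applies to every step.
\<close>

lemma J_kappa_lip:
  assumes "f \<in> B r" and "g \<in> B r" and "(\<lambda>x. f x - g x) \<in> B M" and "real k * h n \<le> T"
  shows "(\<lambda>x. J n k f x - J n k g x) \<in> B (kappa_lip_upto r T * M)"
proof -
  let ?R = "exp (growth * T) * r"
  have "0 \<le> r" "0 \<le> M" using assms ball_nonneg by blast+
  have "(\<lambda>x. J n j f x - J n j g x) \<in> B (exp (real j * h n * kappa_lip ?R) * M)" if "j \<le> k" for j
    using that
  proof (induction j)
    case (Suc j)
    have "real j * h n \<le> real k * h n" using Suc.prems h_pos[of n] by (intro mult_right_mono) auto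
    then have "real j * h n \<le> T" using assms(4) by linarith
    have "(\<lambda>x. J n j f x - J n j g x) \<in> B (exp (real j * h n * kappa_lip ?R) * M)"
      using Suc by simp
    from I_kappa_lip[OF J_ball[OF assms(1) \<open>real j * h n \<le> T\<close>] J_ball[OF assms(2) \<open>real j * h n \<le> T\<close>] this]
    show ?case by (simp add: J_Suc distrib_right exp_add mult.assoc)
  qed (use assms(3) in simp)
  from this[of k] have "(\<lambda>x. J n k f x - J n k g x) \<in> B (exp (real k * h n * kappa_lip ?R) * M)" by simp
  then show ?thesis
    using assms(4) kappa_lip_nonneg[of ?R] \<open>0 \<le> r\<close> \<open>0 \<le> M\<close> unfolding kappa_lip_upto_def
    by (elim ball_kappa_mono) (auto intro!: mult_right_mono)
qed

lemma J_Lip_b':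
  assumes "f \<in> Lip_b r"
  shows "J n k f \<in> Lip_b (exp (lip_growth * (real k * h n)) * r)"
proof (induction k)
  case (Suc k)
  then show ?case
    using I_Lip_b[OF Suc, of n] by (simp add: J_Suc algebra_simps exp_add)
qed (use assms in simp)

lemma J_Lip_b:
  assumes "f \<in> Lip_b r" and "real k * h n \<le> T"
  shows "J n k f \<in> Lip_b (exp (lip_growth * T) * r)"
  using J_Lip_b'[OF assms(1), of n k] assms(2) lip_growth_nonneg Lip_b_nonneg[OF assms(1)]
  by (elim Lip_b_mono) (auto intro!: mult_right_mono mult_left_mono)

lemma iterate_eq_J: "iterate I h n t f = J n (num_steps (h n) t) f"
  by (simp add: iterate_def J_def)

text \<open>
  Time \<open>k * h n\<close> corresponds to exactly \<open>k\<close> steps, which turns the assumption on \<open>iterate\<close> into one on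
  arbitrary powers of the one-step operator.
\<close>

lemma J_local:
  assumes "0 < \<epsilon>" and "0 \<le> r" and "0 \<le> T" and "compact K"
  obtains K' c where "compact K'" and "0 \<le> c"
    and "\<And>n k. real k * h n \<le> T \<Longrightarrow> controls r K K' c \<epsilon> (J n k)"
proof -
  have "\<forall>\<epsilon>>0. \<forall>r\<ge>0. \<forall>T\<ge>0. \<forall>K. compact K \<longrightarrow> (\<exists>K' c. compact K' \<and> 0 \<le> c \<and>
        (\<forall>t\<in>{0..T}. \<forall>n. \<forall>f \<in> B r. \<forall>g \<in> B r.
           supnorm_on K (\<lambda>x. iterate I h n t f x - iterate I h n t g x)
             \<le> c * supnorm_on K' (\<lambda>x. f x - g x) + \<epsilon>))"
    using assumption_A unfolding assumption_A_def by (elim conjE) assumption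
  from this[THEN spec, THEN mp, OF assms(1), THEN spec, THEN mp, OF assms(2),
      THEN spec, THEN mp, OF assms(3), THEN spec, THEN mp, OF assms(4)]
  obtain K' c where K': "compact K'" "0 \<le> c"
    "\<And>t n f g. t \<in> {0..T} \<Longrightarrow> f \<in> B r \<Longrightarrow> g \<in> B r \<Longrightarrow>
        supnorm_on K (\<lambda>x. iterate I h n t f x - iterate I h n t g x) \<le> c * supnorm_on K' (\<lambda>x. f x - g x) + \<epsilon>"
    by blast
  show ?thesis
  proof (rule that[OF K'(1,2)])
    fix n k assume k: "real k * h n \<le> T"
    show "controls r K K' c \<epsilon> (J n k)"
      unfolding controls_def
    proof (intro ballI allI impI)
      fix f g x and D :: real
      assume f: "f \<in> B r" and g: "g \<in> B r" and "0 \<le> D"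
        and fg: "\<forall>y\<in>K'. \<bar>f y - g y\<bar> \<le> D" and "x \<in> K"
      have "real k * h n \<in> {0..T}" using k h_pos[of n] by simp
      from K'(3)[OF this f g, of n]
      have "supnorm_on K (\<lambda>x. J n k f x - J n k g x) \<le> c * supnorm_on K' (\<lambda>x. f x - g x) + \<epsilon>"
        by (simp add: iterate_eq_J num_steps_of_nat[OF h_pos])
      moreover have "\<bar>J n k f x - J n k g x\<bar> \<le> supnorm_on K (\<lambda>x. J n k f x - J n k g x)"
        by (intro le_supnorm_on[OF \<open>compact K\<close> _ \<open>x \<in> K\<close>] continuous_intros
            C_kappa_continuous[OF J_C] ball_kappa_C[OF f] ball_kappa_C[OF g])
      moreover have "c * supnorm_on K' (\<lambda>x. f x - g x) \<le> c * D"
        using fg by (intro mult_left_mono supnorm_on_le \<open>0 \<le> D\<close> K'(2)) auto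
      ultimately show "\<bar>J n k f x - J n k g x\<bar> \<le> c * D + \<epsilon>" by linarith
    qed
  qed
qed

lemma consistency:
  assumes "f \<in> Cb_infinity"
  obtains a M where "a \<in> B M" and "\<And>n. (\<lambda>x. (I (h n) f x - f x) / h n) \<in> B M"
    and "\<And>K. compact K \<Longrightarrow> uniform_limit K (\<lambda>n x. (I (h n) f x - f x) / h n) a sequentially"
proof -
  have "\<forall>f \<in> Cb_infinity. \<exists>g \<in> C. mixed_lim_at_right_0 \<kappa> (\<lambda>t x. (I t f x - f x) / t) g"
    using assumption_A unfolding assumption_A_def by (elim conjE) assumption
  then obtain a where "mixed_lim_at_right_0 \<kappa> (\<lambda>t x. (I t f x - f x) / t) a" using assms by blast
  then have a: "mixed_lim \<kappa> (\<lambda>n x. (I (h n) f x - f x) / h n) a"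
    using h_pos h_lim by (simp add: mixed_lim_at_right_0_def)
  then obtain M1 where M1: "\<And>n. (\<lambda>x. (I (h n) f x - f x) / h n) \<in> B M1" by (auto simp: mixed_lim_iff)
  obtain M2 where M2: "a \<in> B M2" using a C_ball[of a] by (auto simp: mixed_lim_iff)
  show ?thesis
    by (rule that[of a "max M1 M2"])
       (use a in \<open>auto simp: mixed_lim_iff intro: ball_kappa_mono[OF M1] ball_kappa_mono[OF M2]\<close>)
qed

text \<open>
  By Jensen's inequality a convex operator maps an average of translates below the average of the
  images of the translates, and these are almost translates of the image. Jensen's inequality is
  applied to Riemann sums of mesh \<open>\<eta>\<close>; since the one-step operator is Lipschitz in the weighted norm,
  the error is of order \<open>\<eta>\<close> and disappears in the limit.
\<close>

lemma I_avg_le: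
  assumes "0 < \<epsilon>"
  obtains \<delta>0 n0 where "0 < \<delta>0"
    and "\<And>\<delta> m n r f y. \<delta> \<le> \<delta>0 \<Longrightarrow> kernel \<delta> m \<Longrightarrow> n \<ge> n0 \<Longrightarrow> f \<in> Lip_b r \<Longrightarrow> continuous_on UNIV (avg m f) \<Longrightarrow>
      I (h n) (avg m f) y \<le> avg m (I (h n) f) y + r * \<epsilon> * h n / \<kappa> y"
proof -
  have "\<forall>\<epsilon>>0. \<exists>\<delta>>0. \<exists>n0. \<forall>r\<ge>0. \<forall>f \<in> Lip_b r. \<forall>x. norm x \<le> \<delta> \<longrightarrow> (\<forall>n\<ge>n0.
        I (h n) (shift x f) \<le> (\<lambda>y. shift x (I (h n) f) y + r * \<epsilon> * h n / \<kappa> y))"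
    using assumption_A unfolding assumption_A_def by (elim conjE) assumption
  from this[THEN spec, THEN mp, OF assms] obtain \<delta>0 n0 where "0 < \<delta>0" and shift: "\<And>r f x n. 0 \<le> r \<Longrightarrow> f \<in> Lip_b r \<Longrightarrow> norm x \<le> \<delta>0 \<Longrightarrow> n \<ge> n0 \<Longrightarrow>
        I (h n) (shift x f) \<le> (\<lambda>y. shift x (I (h n) f) y + r * \<epsilon> * h n / \<kappa> y)"
    by blast
  show ?thesis
  proof (rule that[OF \<open>0 < \<delta>0\<close>])
    fix \<delta> r :: real and m f :: "real ^ 'd \<Rightarrow> real" and n y
    assume "\<delta> \<le> \<delta>0" and m: "kernel \<delta> m" and n: "n \<ge> n0" and f: "f \<in> Lip_b r"
      and cont: "continuous_on UNIV (avg m f)"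
    have "0 \<le> r" by (rule Lip_b_nonneg[OF f])
    have fr: "\<bar>f x\<bar> \<le> r" and f_lip: "r-lipschitz_on UNIV f" for x
      using f by (auto simp: Lip_b_def)
    define r' where "r' = exp (lip_growth * h n) * r"
    have If: "I (h n) f \<in> Lip_b r'" unfolding r'_def by (rule I_Lip_b[OF f])
    define L where "L = exp (h n * kappa_lip (r * kmax))"
    have avg_ball: "avg m f \<in> B (r * kmax)"
      using avg_close[OF m Lip_b_continuous[OF f], of _ 0 r] fr by (intro bounded_ball cont) simp
    have bound: "I (h n) (avg m f) y \<le> avg m (I (h n) f) y + r * \<epsilon> * h n / \<kappa> y + (r' + L * r * kmax / \<kappa> y) * \<eta>"
      if "0 < \<eta>" for \<eta>
    proof -
      obtain Z \<alpha> where Z: "finite Z" "Z \<subseteq> cball 0 \<delta>" "\<And>z. 0 \<le> \<alpha> z" "(\<Sum>z\<in>Z. \<alpha> z) = 1"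
        "\<And>L f x. L-lipschitz_on UNIV f \<Longrightarrow> \<bar>avg m f x - (\<Sum>z\<in>Z. \<alpha> z * f (x + z))\<bar> \<le> L * \<eta>"
        using avg_riemann_sum[OF m \<open>0 < \<eta>\<close>] by blast
      have shift_Lip: "shift z f \<in> Lip_b r" for z
        using fr lipschitz_onD[OF f_lip, of "z + _" "z + _"] \<open>0 \<le> r\<close>
        by (auto simp: Lip_b_def shift_def intro!: lipschitz_onI)
      define q where "q x = (\<Sum>z\<in>Z. \<alpha> z * shift z f x)" for x
      have "\<bar>q x\<bar> \<le> r" for x
      proof -
        have "\<bar>q x\<bar> \<le> (\<Sum>z\<in>Z. \<alpha> z * r)"
          unfolding q_def using Z(3) fr
          by (intro order_trans[OF sum_abs] sum_mono) (auto simp: abs_mult shift_def intro!: mult_left_mono)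
        then show ?thesis using Z(4) by (simp flip: sum_distrib_right)
      qed
      then have q_ball: "q \<in> B (r * kmax)"
        by (intro bounded_ball) (auto simp: q_def[abs_def] intro!: continuous_intros Lip_b_continuous[OF shift_Lip])
      have "\<bar>avg m f x - q x\<bar> \<le> r * \<eta>" for x
        using Z(5)[OF f_lip, of x] by (simp add: q_def shift_def add.commute)
      then have "(\<lambda>x. avg m f x - q x) \<in> B (r * \<eta> * kmax)"
        by (intro bounded_ball continuous_intros cont ball_kappa_continuous[OF q_ball])
      from I_kappa_lip[OF avg_ball q_ball this, of n]
      have "\<bar>I (h n) (avg m f) y - I (h n) q y\<bar> * \<kappa> y \<le> L * (r * \<eta> * kmax)"
        unfolding L_def by (rule ball_kappa_D)
      then have "I (h n) (avg m f) y \<le> I (h n) q y + L * (r * \<eta> * kmax) / \<kappa> y"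
        using kappa_pos[of y] by (simp add: pos_le_divide_eq[symmetric] abs_le_iff)
      also have "I (h n) q y \<le> (\<Sum>z\<in>Z. \<alpha> z * I (h n) (shift z f) y)"
        unfolding q_def by (rule convex_op_sum[OF I_convex Z(1) _ _ Z(4)]) (auto intro: Lip_b_C[OF shift_Lip] Z(3))
      also have "\<dots> \<le> (\<Sum>z\<in>Z. \<alpha> z * (I (h n) f (y + z) + r * \<epsilon> * h n / \<kappa> y))"
      proof (intro sum_mono mult_left_mono Z(3))
        fix z assume "z \<in> Z"
        then have "norm z \<le> \<delta>0" using Z(2) \<open>\<delta> \<le> \<delta>0\<close> by auto
        from shift[OF \<open>0 \<le> r\<close> f this n]
        show "I (h n) (shift z f) y \<le> I (h n) f (y + z) + r * \<epsilon> * h n / \<kappa> y"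
          by (simp add: le_fun_def shift_def add.commute)
      qed
      also have "\<dots> = (\<Sum>z\<in>Z. \<alpha> z * I (h n) f (y + z)) + r * \<epsilon> * h n / \<kappa> y"
        by (simp only: distrib_left sum.distrib sum_distrib_right[symmetric] Z(4) mult_1)
      also have "(\<Sum>z\<in>Z. \<alpha> z * I (h n) f (y + z)) \<le> avg m (I (h n) f) y + r' * \<eta>"
        using Z(5)[of r' "I (h n) f" y] If by (simp add: Lip_b_def abs_le_iff)
      finally show ?thesis by (simp add: algebra_simps)
    qed
    show "I (h n) (avg m f) y \<le> avg m (I (h n) f) y + r * \<epsilon> * h n / \<kappa> y"
    proof (rule tendsto_lowerbound)
      have "((\<lambda>\<eta>. avg m (I (h n) f) y + r * \<epsilon> * h n / \<kappa> y + (r' + L * r * kmax / \<kappa> y) * \<eta>) \<longlongrightarrow>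
          avg m (I (h n) f) y + r * \<epsilon> * h n / \<kappa> y + (r' + L * r * kmax / \<kappa> y) * 0) (at_right 0)"
        by (intro tendsto_intros)
      then show "((\<lambda>\<eta>. avg m (I (h n) f) y + r * \<epsilon> * h n / \<kappa> y + (r' + L * r * kmax / \<kappa> y) * \<eta>) \<longlongrightarrow>
          avg m (I (h n) f) y + r * \<epsilon> * h n / \<kappa> y) (at_right 0)" by simp
      show "\<forall>\<^sub>F \<eta> in at_right 0. I (h n) (avg m f) y \<le>
          avg m (I (h n) f) y + r * \<epsilon> * h n / \<kappa> y + (r' + L * r * kmax / \<kappa> y) * \<eta>"
        using bound by (auto simp: eventually_at_filter)
    qed simp
  qed
qed

end

section \<open>Time regularity of the iterates\<close>

lemma (in weight) kappa_lower:
  assumes "compact K"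
  obtains \<kappa>0 where "0 < \<kappa>0" and "\<And>x. x \<in> K \<Longrightarrow> \<kappa>0 \<le> \<kappa> x"
proof (cases "K = {}")
  case False
  then obtain y where "y \<in> K" "\<And>x. x \<in> K \<Longrightarrow> \<kappa> y \<le> \<kappa> x"
    using continuous_attains_inf[OF assms, of \<kappa>] continuous_on_subset[OF kappa_cont] by auto
  then show ?thesis using that[of "\<kappa> y"] kappa_pos by blast
qed (use that[of 1] in auto)

context scheme
begin

text \<open>
  The first step moves a smooth function by \<open>O (h n)\<close> in the weighted norm, because the difference
  quotients are bounded. The increment of the \<open>(k+1)\<close>-st step is the image of this first increment
  under \<open>k\<close> further steps, hence of the same order.
\<close>

lemma J_smooth_time:
  assumes "g \<in> Cb_infinity"
  obtains A where "0 \<le> A" and "\<And>n k. real k * h n \<le> 1 \<Longrightarrow> (\<lambda>x. J n k g x - g x) \<in> B (A * (real k * h n))"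
proof -
  obtain a M where aM: "a \<in> B M" "\<And>n. (\<lambda>x. (I (h n) g x - g x) / h n) \<in> B M"
    using consistency[OF assms] by metis
  obtain r where r: "0 \<le> r" "g \<in> B r" using C_ball[OF Cb_infinity_C[OF assms]] by auto
  define R where "R = exp growth * r"
  define A where "A = kappa_lip_upto R 1 * M"
  have "0 \<le> M" by (rule ball_nonneg[OF aM(1)])
  then have "0 \<le> A" by (simp add: A_def kappa_lip_upto_def)
  have gR: "g \<in> B R"
    using ball_kappa_mono[OF r(2), of R] r(1) growth_nonneg by (simp add: R_def mult_le_cancel_right1)
  have "(\<lambda>x. J n k g x - g x) \<in> B (A * (real k * h n))" if "real k * h n \<le> 1" for n k
    using that
  proof (induction k)
    case (Suc k)
    have "real k * h n + h n \<le> 1" using Suc.prems by (simp add: distrib_right)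
    moreover have "0 \<le> real k * h n" using h_pos[of n] by simp
    ultimately have k: "real k * h n \<le> 1" and hn: "h n \<le> 1"
      using h_pos[of n] by linarith+
    have "I (h n) g \<in> B (exp (growth * 1) * r)"
      using J_ball[OF r(2), of 1 n 1] hn by (simp add: J_Suc)
    then have IgR: "I (h n) g \<in> B R" by (simp add: R_def)
    have "(\<lambda>x. I (h n) g x - g x) \<in> B (h n * M)"
      using ball_scale[OF aM(2)[of n], of "h n"] h_pos[of n] by simp
    from J_kappa_lip[OF IgR gR this k]
    have "(\<lambda>x. J n (Suc k) g x - J n k g x) \<in> B (A * h n)"
      by (simp add: J_Suc' A_def mult_ac)
    from ball_add[OF this Suc.IH[OF k]]
    show ?case by (simp add: algebra_simps)
  qed (simp add: ball_kappa_iff)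
  then show ?thesis using that[OF \<open>0 \<le> A\<close>] by blast
qed

text \<open>
  Reduction to a smooth function that is close to \<open>f\<close> on \<open>K\<close> and on the compact set that governs the
  values on \<open>K\<close>. The bound is uniform in the step size, so that it survives every passage to the limit.
\<close>

lemma J_time_0:
  assumes "f \<in> C" and "compact K" and "0 < \<epsilon>"
  obtains \<delta> where "0 < \<delta>" and "\<And>n k x. real k * h n \<le> \<delta> \<Longrightarrow> x \<in> K \<Longrightarrow> \<bar>J n k f x - f x\<bar> \<le> \<epsilon>"
proof -
  obtain r where r: "0 \<le> r" "f \<in> B r" using C_ball[OF assms(1)] by auto
  \<comment> \<open>A common radius for \<open>f\<close> and its smooth approximations.\<close>
  define R where "R = max r (krat * r)"
  have "0 \<le> R" using r by (simp add: R_def)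
  obtain K' c where K': "compact K'" "0 \<le> c"
    "\<And>n k. real k * h n \<le> 1 \<Longrightarrow> controls R K K' c (\<epsilon> / 4) (J n k)"
    using J_local[of "\<epsilon> / 4" R 1 K] \<open>0 \<le> R\<close> assms by (metis zero_less_divide_iff zero_less_numeral zero_le_one)
  define \<eta> where "\<eta> = \<epsilon> / (4 * (c + 1))"
  have \<eta>: "0 < \<eta>" "c * \<eta> \<le> \<epsilon> / 4" "\<eta> \<le> \<epsilon> / 4"
    using \<open>0 < \<epsilon>\<close> \<open>0 \<le> c\<close> by (auto simp: \<eta>_def field_simps)
  obtain g where g: "g \<in> Cb_infinity" "g \<in> B (krat * r)" "\<And>x. x \<in> K \<union> K' \<Longrightarrow> \<bar>f x - g x\<bar> \<le> \<eta>"
    using smooth_dense[OF r(2) compact_Un[OF assms(2) K'(1)] \<eta>(1)] by blast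
  have R: "f \<in> B R" "g \<in> B R"
    using ball_kappa_mono[OF r(2), of R] ball_kappa_mono[OF g(2), of R] by (auto simp: R_def)
  obtain A where A: "0 \<le> A" "\<And>n k. real k * h n \<le> 1 \<Longrightarrow> (\<lambda>x. J n k g x - g x) \<in> B (A * (real k * h n))"
    using J_smooth_time[OF g(1)] by blast
  obtain \<kappa>0 where \<kappa>0: "0 < \<kappa>0" "\<And>x. x \<in> K \<Longrightarrow> \<kappa>0 \<le> \<kappa> x" using kappa_lower[OF assms(2)] by blast
  define \<delta> where "\<delta> = min 1 (\<epsilon> * \<kappa>0 / (4 * (A + 1)))"
  have "0 < \<delta>" using \<open>0 < \<epsilon>\<close> \<kappa>0(1) \<open>0 \<le> A\<close> by (simp add: \<delta>_def)
  show ?thesis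
  proof (rule that[OF \<open>0 < \<delta>\<close>])
    fix n k x assume k: "real k * h n \<le> \<delta>" and x: "x \<in> K"
    then have k1: "real k * h n \<le> 1" by (simp add: \<delta>_def)
    have 1: "\<bar>J n k f x - J n k g x\<bar> \<le> c * \<eta> + \<epsilon> / 4"
      using g(3) \<eta>(1) by (intro controlsD[OF K'(3)[OF k1] R _ _ x]) auto
    have "\<bar>J n k g x - g x\<bar> * \<kappa>0 \<le> \<bar>J n k g x - g x\<bar> * \<kappa> x"
      using \<kappa>0(2)[OF x] by (intro mult_left_mono) auto
    also have "\<dots> \<le> A * (real k * h n)" by (rule ball_kappa_D[OF A(2)[OF k1]])
    also have "\<dots> \<le> (A + 1) * (\<epsilon> * \<kappa>0 / (4 * (A + 1)))"
      using k \<open>0 \<le> A\<close> h_pos[of n] by (intro mult_mono) (auto simp: \<delta>_def)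
    also have "\<dots> = \<epsilon> / 4 * \<kappa>0" using \<open>0 \<le> A\<close> by (simp add: field_simps)
    finally have 2: "\<bar>J n k g x - g x\<bar> \<le> \<epsilon> / 4" using \<kappa>0(1) by simp
    have 3: "\<bar>f x - g x\<bar> \<le> \<eta>" using g(3) x by auto
    show "\<bar>J n k f x - f x\<bar> \<le> \<epsilon>" using 1 2 3 \<eta> by linarith
  qed
qed

lemma J_time:
  assumes "f \<in> C" and "compact K" and "0 < \<epsilon>" and "0 \<le> T"
  obtains \<delta> where "0 < \<delta>" and "\<And>n j k x. \<bar>real j * h n - real k * h n\<bar> \<le> \<delta> \<Longrightarrow> real j * h n \<le> T \<Longrightarrow>
      real k * h n \<le> T \<Longrightarrow> x \<in> K \<Longrightarrow> \<bar>J n j f x - J n k f x\<bar> \<le> \<epsilon>"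
proof -
  obtain r where r: "0 \<le> r" "f \<in> B r" using C_ball[OF assms(1)] by auto
  define R where "R = exp (growth * 1) * r"
  have "0 \<le> R" using r by (simp add: R_def)
  obtain K' c where K': "compact K'" "0 \<le> c"
    "\<And>n k. real k * h n \<le> T \<Longrightarrow> controls R K K' c (\<epsilon> / 2) (J n k)"
    using J_local[of "\<epsilon> / 2" R T K] \<open>0 \<le> R\<close> assms by (metis half_gt_zero)
  define \<eta> where "\<eta> = \<epsilon> / (2 * (c + 1))"
  have \<eta>: "0 < \<eta>" "c * \<eta> \<le> \<epsilon> / 2"
    using \<open>0 < \<epsilon>\<close> \<open>0 \<le> c\<close> by (auto simp: \<eta>_def field_simps)
  obtain \<delta> where \<delta>: "0 < \<delta>" "\<And>n k x. real k * h n \<le> \<delta> \<Longrightarrow> x \<in> K' \<Longrightarrow> \<bar>J n k f x - f x\<bar> \<le> \<eta>"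
    using J_time_0[OF assms(1) K'(1) \<eta>(1)] by blast
  have fR: "f \<in> B R"
    using ball_kappa_mono[OF r(2), of R] r(1) growth_nonneg by (simp add: R_def mult_le_cancel_right1)
  have step: "\<bar>J n (i + k) f x - J n k f x\<bar> \<le> \<epsilon>"
    if i: "real i * h n \<le> min 1 \<delta>" and k: "real k * h n \<le> T" and x: "x \<in> K" for n i k x
  proof -
    have "J n i f \<in> B R" using J_ball[OF r(2), of i n 1] i by (simp add: R_def)
    moreover have "\<bar>J n i f y - f y\<bar> \<le> \<eta>" if "y \<in> K'" for y using \<delta>(2) i that by simp
    ultimately have "\<bar>J n k (J n i f) x - J n k f x\<bar> \<le> c * \<eta> + \<epsilon> / 2"
      using \<eta>(1) by (intro controlsD[OF K'(3)[OF k] _ fR _ _ x]) auto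
    then show ?thesis using \<eta>(2) by (simp add: J_add add.commute[of i k])
  qed
  show ?thesis
  proof (rule that[of "min 1 \<delta>"])
    fix n j k x
    assume jk: "\<bar>real j * h n - real k * h n\<bar> \<le> min 1 \<delta>" and j: "real j * h n \<le> T" and k: "real k * h n \<le> T"
      and x: "x \<in> K"
    show "\<bar>J n j f x - J n k f x\<bar> \<le> \<epsilon>"
    proof (cases "k \<le> j")
      case True
      then have "real (j - k) * h n \<le> min 1 \<delta>" using jk by (auto simp: of_nat_diff left_diff_distrib abs_le_iff)
      from step[OF this k x] True show ?thesis by simp
    next
      case False
      then have "real (k - j) * h n \<le> min 1 \<delta>" using jk by (auto simp: of_nat_diff left_diff_distrib abs_le_iff)
      from step[OF this j x] False show ?thesis by (simp add: abs_minus_commute)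
    qed
  qed (use \<delta>(1) in simp)
qed

end

section \<open>Limits of the iterates along filters\<close>

text \<open>
  Limits along an arbitrary filter instead of a subsequence, so that compactness can be used in the
  form of Tychonoff's theorem. Pointwise convergence suffices as a requirement; locally uniform
  convergence is a consequence of the Lipschitz and stability estimates.
\<close>

locale limit_family = scheme \<kappa> h I for \<kappa> :: "real ^ 'd \<Rightarrow> real" and h I +
  fixes F :: "nat filter" and S :: "real \<Rightarrow> (real ^ 'd \<Rightarrow> real) \<Rightarrow> real ^ 'd \<Rightarrow> real"
  assumes F_nontrivial: "F \<noteq> bot"
    and F_le: "F \<le> sequentially"
    and S_lim: "0 \<le> t \<Longrightarrow> f \<in> C_kappa \<kappa> \<Longrightarrow> ((\<lambda>n. J n (num_steps (h n) t) f x) \<longlongrightarrow> S t f x) F"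
begin

abbreviation steps where "steps t n \<equiv> num_steps (h n) t"

lemma steps_le: "0 \<le> t \<Longrightarrow> real (steps t n) * h n \<le> t"
  by (rule num_steps_props[OF h_pos])

lemma h_lim_F: "(h \<longlongrightarrow> 0) F"
  using h_lim F_le by (rule tendsto_mono[rotated])

lemma steps_lim:
  assumes "0 \<le> t"
  shows "((\<lambda>n. real (steps t n) * h n) \<longlongrightarrow> t) F"
proof (rule tendsto_sandwich)
  have "((\<lambda>n. t - h n) \<longlongrightarrow> t - 0) F" by (intro tendsto_intros h_lim_F)
  then show "((\<lambda>n. t - h n) \<longlongrightarrow> t) F" by simp
  show "\<forall>\<^sub>F n in F. t - h n \<le> real (steps t n) * h n"
    using num_steps_props(2)[OF h_pos assms] by (intro always_eventually allI) (simp add: distrib_right algebra_simps less_imp_le)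
  show "\<forall>\<^sub>F n in F. real (steps t n) * h n \<le> t"
    using steps_le[OF assms] by simp
qed simp

lemma S_controls:
  assumes J: "\<And>n k. real k * h n \<le> T \<Longrightarrow> controls r K K' c \<epsilon> (J n k)" and t: "0 \<le> t" "t \<le> T"
  shows "controls r K K' c \<epsilon> (S t)"
  unfolding controls_def
proof (intro ballI allI impI)
  fix f g x and D :: real
  assume f: "f \<in> B r" and g: "g \<in> B r" and D: "0 \<le> D"
    and fg: "\<forall>y\<in>K'. \<bar>f y - g y\<bar> \<le> D" and x: "x \<in> K"
  have "((\<lambda>n. \<bar>J n (steps t n) f x - J n (steps t n) g x\<bar>) \<longlongrightarrow> \<bar>S t f x - S t g x\<bar>) F"
    by (intro tendsto_intros S_lim t ball_kappa_C[OF f] ball_kappa_C[OF g])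
  moreover have "\<bar>J n (steps t n) f x - J n (steps t n) g x\<bar> \<le> c * D + \<epsilon>" for n
    using steps_le[OF t(1), of n] t(2) fg by (intro controlsD[OF J f g D _ x]) auto
  ultimately show "\<bar>S t f x - S t g x\<bar> \<le> c * D + \<epsilon>"
    using F_nontrivial by (intro tendsto_upperbound) auto
qed

lemma S_local:
  assumes "0 < \<epsilon>" and "0 \<le> r" and "0 \<le> T" and "compact K"
  obtains K' c where "compact K'" and "0 \<le> c"
    and "\<And>t. 0 \<le> t \<Longrightarrow> t \<le> T \<Longrightarrow> controls r K K' c \<epsilon> (S t)"
  using J_local[OF assms] S_controls by metis

lemma S_bound:
  assumes "f \<in> B r" and "0 \<le> t" and "t \<le> T"
  shows "\<bar>S t f x\<bar> * \<kappa> x \<le> exp (growth * T) * r"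
proof (rule tendsto_upperbound)
  show "((\<lambda>n. \<bar>J n (steps t n) f x\<bar> * \<kappa> x) \<longlongrightarrow> \<bar>S t f x\<bar> * \<kappa> x) F"
    by (intro tendsto_intros S_lim assms ball_kappa_C[OF assms(1)])
  show "\<forall>\<^sub>F n in F. \<bar>J n (steps t n) f x\<bar> * \<kappa> x \<le> exp (growth * T) * r"
    using steps_le[OF assms(2)] assms(3) by (intro always_eventually allI ball_kappa_D J_ball assms(1)) (auto intro: order_trans)
qed (rule F_nontrivial)

lemma S_Lip_b:
  assumes "f \<in> Lip_b r" and "0 \<le> t" and "t \<le> T"
  shows "S t f \<in> Lip_b (exp (lip_growth * T) * r)"
proof -
  let ?L = "exp (lip_growth * T) * r"
  have J: "J n (steps t n) f \<in> Lip_b ?L" for n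
    using steps_le[OF assms(2), of n] assms(3) by (intro J_Lip_b[OF assms(1)]) auto
  have lim: "((\<lambda>n. J n (steps t n) f x) \<longlongrightarrow> S t f x) F" for x
    by (intro S_lim assms Lip_b_C[OF assms(1)])
  have "\<bar>S t f x\<bar> \<le> ?L" for x
  proof (rule tendsto_upperbound[OF tendsto_rabs[OF lim] _ F_nontrivial])
    show "\<forall>\<^sub>F n in F. \<bar>J n (steps t n) f x\<bar> \<le> ?L"
      using J by (auto simp: Lip_b_def)
  qed
  moreover have "\<bar>S t f x - S t f y\<bar> \<le> ?L * norm (x - y)" for x y
  proof (rule tendsto_upperbound[OF tendsto_rabs[OF tendsto_diff[OF lim lim]] _ F_nontrivial])
    show "\<forall>\<^sub>F n in F. \<bar>J n (steps t n) f x - J n (steps t n) f y\<bar> \<le> ?L * norm (x - y)"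
      using Lip_b_D[OF J] by auto
  qed
  ultimately show ?thesis
    using Lip_b_nonneg[OF assms(1)] by (auto simp: Lip_b_def lipschitz_on_def dist_norm)
qed

text \<open>
  The iterates of \<open>f\<close> are equi-Lipschitz, and for such functions pointwise convergence on a finite
  net controls the convergence on a compact set.
\<close>

lemma S_uniform_Lip_b:
  assumes f: "f \<in> Lip_b r" and t: "0 \<le> t" and K: "compact K"
  shows "uniform_limit K (\<lambda>n. J n (steps t n) f) (S t f) F"
proof (rule uniform_limitI)
  fix \<epsilon> :: real assume "0 < \<epsilon>"
  define L where "L = exp (lip_growth * t) * r"
  have "0 \<le> L" using Lip_b_nonneg[OF f] by (simp add: L_def)
  define \<eta> where "\<eta> = \<epsilon> / (3 * (L + 1))"
  have \<eta>: "0 < \<eta>" "L * \<eta> < \<epsilon> / 3"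
    using \<open>0 < \<epsilon>\<close> \<open>0 \<le> L\<close> by (auto simp: \<eta>_def field_simps)
  obtain Z where Z: "finite Z" "Z \<subseteq> K" "K \<subseteq> (\<Union>z\<in>Z. ball z \<eta>)"
    by (rule compactE_image[OF K, of K "\<lambda>z. ball z \<eta>"]) (use \<open>0 < \<eta>\<close> in auto)
  have "\<forall>\<^sub>F n in F. \<forall>z\<in>Z. dist (J n (steps t n) f z) (S t f z) < \<epsilon> / 3"
    using \<open>0 < \<epsilon>\<close> by (intro eventually_ball_finite Z(1) ballI tendstoD[OF S_lim[OF t Lip_b_C[OF f]]]) simp
  then show "\<forall>\<^sub>F n in F. \<forall>x\<in>K. dist (J n (steps t n) f x) (S t f x) < \<epsilon>"
  proof eventually_elim
    case (elim n)
    show ?case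
    proof
      fix x assume "x \<in> K"
      then obtain z where z: "z \<in> Z" "dist z x < \<eta>" using Z(3) by auto
      have lip: "\<bar>g x - g z\<bar> < \<epsilon> / 3" if "g \<in> Lip_b L" for g
      proof -
        have "\<bar>g x - g z\<bar> \<le> L * norm (x - z)" by (rule Lip_b_D[OF that])
        also have "\<dots> \<le> L * \<eta>"
          using z(2) \<open>0 \<le> L\<close> by (intro mult_left_mono) (auto simp: dist_norm norm_minus_commute)
        finally show ?thesis using \<eta>(2) by linarith
      qed
      have "\<bar>J n (steps t n) f x - J n (steps t n) f z\<bar> < \<epsilon> / 3"
        unfolding L_def by (intro lip) (simp add: L_def J_Lip_b[OF f] steps_le[OF t])
      moreover have "\<bar>S t f x - S t f z\<bar> < \<epsilon> / 3"
        by (intro lip) (simp add: L_def S_Lip_b[OF f t])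
      moreover have "\<bar>J n (steps t n) f z - S t f z\<bar> < \<epsilon> / 3"
        using elim z(1) by (simp add: dist_real_def)
      ultimately show "dist (J n (steps t n) f x) (S t f x) < \<epsilon>"
        unfolding dist_real_def by linarith
    qed
  qed
qed

lemma S_uniform:
  assumes f: "f \<in> C" and t: "0 \<le> t" and K: "compact K"
  shows "uniform_limit K (\<lambda>n. J n (steps t n) f) (S t f) F"
proof (rule uniform_limitI)
  fix \<epsilon> :: real assume "0 < \<epsilon>"
  obtain r where r: "0 \<le> r" "f \<in> B r" using C_ball[OF f] by auto
  define R where "R = max r (krat * r)"
  have "0 \<le> R" using r by (simp add: R_def)
  have "0 < \<epsilon> / 8" using \<open>0 < \<epsilon>\<close> by simp
  obtain K' c where K': "compact K'" "0 \<le> c"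
    and J: "\<And>n k. real k * h n \<le> t \<Longrightarrow> controls R K K' c (\<epsilon> / 8) (J n k)"
    using J_local[OF \<open>0 < \<epsilon> / 8\<close> \<open>0 \<le> R\<close> t K] by blast
  define \<eta> where "\<eta> = \<epsilon> / (8 * (c + 1))"
  have \<eta>: "0 < \<eta>" "c * \<eta> \<le> \<epsilon> / 8"
    using \<open>0 < \<epsilon>\<close> \<open>0 \<le> c\<close> by (auto simp: \<eta>_def field_simps)
  obtain g L where g: "g \<in> Lip_b L" "g \<in> B (krat * r)" "\<And>x. x \<in> K' \<Longrightarrow> \<bar>f x - g x\<bar> \<le> \<eta>"
    using smooth_dense[OF r(2) K'(1) \<eta>(1)] by blast
  have R: "f \<in> B R" "g \<in> B R"
    using ball_kappa_mono[OF r(2), of R] ball_kappa_mono[OF g(2), of R] by (auto simp: R_def)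
  have "\<forall>\<^sub>F n in F. \<forall>x\<in>K. dist (J n (steps t n) g x) (S t g x) < \<epsilon> / 8"
    using \<open>0 < \<epsilon>\<close> by (intro uniform_limitD[OF S_uniform_Lip_b[OF g(1) t K]]) simp
  then show "\<forall>\<^sub>F n in F. \<forall>x\<in>K. dist (J n (steps t n) f x) (S t f x) < \<epsilon>"
  proof eventually_elim
    case (elim n)
    show ?case
    proof
      fix x assume x: "x \<in> K"
      have "\<bar>J n (steps t n) f x - J n (steps t n) g x\<bar> \<le> c * \<eta> + \<epsilon> / 8"
        using \<eta>(1) by (intro controlsD[OF J[OF steps_le[OF t]] R _ g(3) x]) auto
      moreover have "\<bar>S t f x - S t g x\<bar> \<le> c * \<eta> + \<epsilon> / 8"
        using \<eta>(1) by (intro controlsD[OF S_controls[OF J t order_refl] R _ g(3) x]) auto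
      moreover have "\<bar>J n (steps t n) g x - S t g x\<bar> < \<epsilon> / 8"
        using elim x by (simp add: dist_real_def)
      ultimately show "dist (J n (steps t n) f x) (S t f x) < \<epsilon>"
        unfolding dist_real_def using \<eta>(2) \<open>0 < \<epsilon>\<close> by linarith
    qed
  qed
qed

lemma S_ball:
  assumes "f \<in> B r" and "0 \<le> t" and "t \<le> T"
  shows "S t f \<in> B (exp (growth * T) * r)"
proof -
  have f: "f \<in> C" by (rule ball_kappa_C[OF assms(1)])
  have "isCont (S t f) x" for x
  proof -
    have "continuous_on (cball x 1) (S t f)"
    proof (rule uniform_limit_theorem[OF _ S_uniform[OF f assms(2) compact_cball] F_nontrivial])
      show "\<forall>\<^sub>F n in F. continuous_on (cball x 1) (J n (steps t n) f)"
        by (intro always_eventually allI continuous_on_subset[OF C_kappa_continuous[OF J_C[OF f]]]) simp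
    qed
    then show ?thesis by (rule continuous_on_interior) simp
  qed
  then show ?thesis
    using S_bound[OF assms] by (auto simp: ball_kappa_iff intro: continuous_at_imp_continuous_on)
qed

lemma S_C: "f \<in> C \<Longrightarrow> 0 \<le> t \<Longrightarrow> S t f \<in> C"
  using C_ball[of f] S_ball[of f _ t t] ball_kappa_C by blast

end

section \<open>Limits of the iterates are strongly continuous semigroups\<close>

lemma decseq_fun_iff:
  fixes f :: "nat \<Rightarrow> 'a \<Rightarrow> real"
  shows "decseq f \<longleftrightarrow> (\<forall>m n x. m \<le> n \<longrightarrow> f n x \<le> f m x)"
  by (subst decseq_def) (auto simp: le_fun_def)

lemma uniform_limit_const_fun: "uniform_limit K (\<lambda>_. f) f F"
  by (rule uniform_limitI) simp

text \<open>
  Dini's theorem: the open sets \<open>{x. f n x < \<epsilon>}\<close> increase with \<open>n\<close> and cover \<open>K\<close>.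
\<close>

lemma dini_to_0:
  fixes f :: "nat \<Rightarrow> 'a::t2_space \<Rightarrow> real"
  assumes "compact K" and "\<And>n. continuous_on UNIV (f n)" and "decseq f"
    and "\<And>x. (\<lambda>n. f n x) \<longlonglongrightarrow> 0" and "0 < \<epsilon>"
  shows "\<exists>N. \<forall>n\<ge>N. \<forall>x\<in>K. \<bar>f n x\<bar> < \<epsilon>"
proof -
  have open_U: "open {x. f n x < \<epsilon>}" for n
    by (intro open_Collect_less assms(2) continuous_intros)
  have "K \<subseteq> (\<Union>n\<in>UNIV. {x. f n x < \<epsilon>})"
  proof
    fix x
    have "\<forall>\<^sub>F n in sequentially. f n x < \<epsilon>" by (rule order_tendstoD(2)[OF assms(4,5)])
    then show "x \<in> (\<Union>n\<in>UNIV. {x. f n x < \<epsilon>})" by (auto dest: eventually_happens)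
  qed
  then obtain M where M: "finite M" "K \<subseteq> (\<Union>n\<in>M. {x. f n x < \<epsilon>})"
    using compactE_image[OF assms(1), of UNIV "\<lambda>n. {x. f n x < \<epsilon>}"] open_U by metis
  have "\<bar>f n x\<bar> < \<epsilon>" if n: "n \<ge> Max (insert 0 M)" and "x \<in> K" for n x
  proof -
    obtain i where i: "i \<in> M" "f i x < \<epsilon>" using M(2) \<open>x \<in> K\<close> by auto
    then have "i \<le> n" using M(1) n by (meson Max_ge finite_insert insertCI order_trans)
    then have "f n x \<le> f i x" using assms(3) by (auto simp: decseq_fun_iff)
    moreover have "0 \<le> f n x"
    proof (rule tendsto_upperbound[OF assms(4)])
      show "\<forall>\<^sub>F j in sequentially. f j x \<le> f n x"
        using assms(3) by (auto simp: decseq_fun_iff eventually_sequentially intro!: exI[of _ n])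
    qed simp
    ultimately show ?thesis using i(2) by simp
  qed
  then show ?thesis by blast
qed

context limit_family
begin

text \<open>
  The function and the number of steps may vary together with \<open>n\<close>. The semigroup property, the
  passage to the limit in estimates for averages, and the irrelevance of rounding in the number of
  steps are all instances.
\<close>

lemma S_joint:
  assumes f: "f \<in> C" and t: "0 \<le> t" and K: "compact K"
    and bounded: "\<forall>\<^sub>F n in F. g n \<in> B r"
    and lim: "\<And>K. compact K \<Longrightarrow> uniform_limit K g f F"
    and k: "((\<lambda>n. real (k n) * h n) \<longlongrightarrow> t) F"
  shows "uniform_limit K (\<lambda>n. J n (k n) (g n)) (S t f) F"
proof (rule uniform_limitI)
  fix \<epsilon> :: real assume "0 < \<epsilon>"
  obtain s where s: "0 \<le> s" "f \<in> B s" using C_ball[OF f] by auto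
  define R where "R = max r s"
  have "0 \<le> R" using s by (simp add: R_def)
  have fR: "f \<in> B R" using ball_kappa_mono[OF s(2), of R] by (simp add: R_def)
  have "0 < \<epsilon> / 5" "0 \<le> t + 1" using \<open>0 < \<epsilon>\<close> t by auto
  obtain K' c where K': "compact K'" "0 \<le> c"
    and J: "\<And>n k. real k * h n \<le> t + 1 \<Longrightarrow> controls R K K' c (\<epsilon> / 5) (J n k)"
    using J_local[OF \<open>0 < \<epsilon> / 5\<close> \<open>0 \<le> R\<close> \<open>0 \<le> t + 1\<close> K] by blast
  define \<eta> where "\<eta> = \<epsilon> / (5 * (c + 1))"
  have \<eta>: "0 < \<eta>" "c * \<eta> \<le> \<epsilon> / 5"
    using \<open>0 < \<epsilon>\<close> \<open>0 \<le> c\<close> by (auto simp: \<eta>_def field_simps)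
  obtain \<delta> where \<delta>: "0 < \<delta>" "\<And>n j k x. \<bar>real j * h n - real k * h n\<bar> \<le> \<delta> \<Longrightarrow> real j * h n \<le> t + 1 \<Longrightarrow>
      real k * h n \<le> t + 1 \<Longrightarrow> x \<in> K \<Longrightarrow> \<bar>J n j f x - J n k f x\<bar> \<le> \<epsilon> / 5"
    using J_time[OF f K \<open>0 < \<epsilon> / 5\<close> \<open>0 \<le> t + 1\<close>] by blast
  have "((\<lambda>n. real (k n) * h n - real (steps t n) * h n) \<longlongrightarrow> t - t) F"
    by (intro tendsto_intros k steps_lim t)
  from tendstoD[OF this \<open>0 < \<delta>\<close>]
  have "\<forall>\<^sub>F n in F. \<bar>real (k n) * h n - real (steps t n) * h n\<bar> < \<delta>"
    by (simp add: dist_real_def)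
  moreover have "\<forall>\<^sub>F n in F. real (k n) * h n < t + 1"
    by (rule order_tendstoD(2)[OF k]) simp
  moreover have "\<forall>\<^sub>F n in F. \<forall>x\<in>K. dist (J n (steps t n) f x) (S t f x) < \<epsilon> / 5"
    by (rule uniform_limitD[OF S_uniform[OF f t K] \<open>0 < \<epsilon> / 5\<close>])
  moreover have "\<forall>\<^sub>F n in F. \<forall>x\<in>K'. dist (g n x) (f x) < \<eta>"
    by (rule uniform_limitD[OF lim[OF K'(1)] \<open>0 < \<eta>\<close>])
  ultimately show "\<forall>\<^sub>F n in F. \<forall>x\<in>K. dist (J n (k n) (g n) x) (S t f x) < \<epsilon>"
    using bounded
  proof eventually_elim
    case (elim n)
    show ?case
    proof
      fix x assume x: "x \<in> K"
      have "g n \<in> B R" using ball_kappa_mono[OF elim(5), of R] by (simp add: R_def)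
      then have "\<bar>J n (k n) (g n) x - J n (k n) f x\<bar> \<le> c * \<eta> + \<epsilon> / 5"
        using elim(2,4) \<eta>(1) x by (intro controlsD[OF J _ fR]) (auto simp: dist_real_def less_imp_le)
      moreover have "\<bar>J n (k n) f x - J n (steps t n) f x\<bar> \<le> \<epsilon> / 5"
        using elim(1,2) steps_le[OF t, of n] x by (intro \<delta>(2)) auto
      moreover have "\<bar>J n (steps t n) f x - S t f x\<bar> < \<epsilon> / 5"
        using elim(3) x by (simp add: dist_real_def)
      ultimately show "dist (J n (k n) (g n) x) (S t f x) < \<epsilon>"
        unfolding dist_real_def using \<eta>(2) by linarith
    qed
  qed
qed

lemma S_joint_pointwise:
  assumes f: "f \<in> C" and t: "0 \<le> t" and k: "((\<lambda>n. real (k n) * h n) \<longlongrightarrow> t) F"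
  shows "((\<lambda>n. J n (k n) f x) \<longlongrightarrow> S t f x) F"
proof -
  obtain r where "f \<in> B r" using C_ball[OF f] by auto
  then have "uniform_limit {x} (\<lambda>n. J n (k n) f) (S t f) F"
    by (intro S_joint[where r = r, OF f t _ _ _ k]) (use \<open>f \<in> B r\<close> in \<open>auto intro: uniform_limit_const_fun\<close>)
  then show ?thesis by (rule tendsto_uniform_limitI) simp
qed

lemma S_zero_time: "f \<in> C \<Longrightarrow> S 0 f = f"
proof
  fix x assume "f \<in> C"
  have "((\<lambda>n. J n 0 f x) \<longlongrightarrow> S 0 f x) F"
    by (rule S_joint_pointwise[OF \<open>f \<in> C\<close>]) simp_all
  then show "S 0 f x = f x" using F_nontrivial by (simp add: tendsto_const_iff)
qed

text \<open>
  The numbers of steps up to \<open>s\<close> and up to \<open>t\<close> need not add up to the number of steps up to \<open>s + t\<close>,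
  but their sum times \<open>h n\<close> still tends to \<open>s + t\<close>.
\<close>

lemma S_add:
  assumes f: "f \<in> C" and s: "0 \<le> s" and t: "0 \<le> t"
  shows "S (s + t) f = S s (S t f)"
proof
  fix x
  obtain r where r: "f \<in> B r" using C_ball[OF f] by auto
  have "uniform_limit {x} (\<lambda>n. J n (steps s n) (J n (steps t n) f)) (S s (S t f)) F"
    by (rule S_joint[OF S_C[OF f t] s _ _ S_uniform[OF f t] steps_lim[OF s]])
       (auto intro!: always_eventually J_ball[OF r] steps_le[OF t])
  then have "((\<lambda>n. J n (steps s n) (J n (steps t n) f) x) \<longlongrightarrow> S s (S t f) x) F"
    by (rule tendsto_uniform_limitI) simp
  moreover have "((\<lambda>n. J n (steps s n + steps t n) f x) \<longlongrightarrow> S (s + t) f x) F"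
    using tendsto_add[OF steps_lim[OF s] steps_lim[OF t]]
    by (intro S_joint_pointwise f) (auto simp: distrib_right s t)
  ultimately show "S (s + t) f x = S s (S t f) x"
    using tendsto_unique[OF F_nontrivial] by (simp add: J_add)
qed

lemma S_mono:
  assumes "f \<in> C" and "g \<in> C" and "\<And>x. f x \<le> g x" and "0 \<le> t"
  shows "S t f x \<le> S t g x"
  by (rule tendsto_le[OF F_nontrivial S_lim[OF assms(4,2)] S_lim[OF assms(4,1)]])
     (simp add: J_mono assms)

lemma S_zero: "0 \<le> t \<Longrightarrow> S t (\<lambda>_. 0) = (\<lambda>_. 0)"
proof
  fix x assume "0 \<le> t"
  from S_lim[OF this C_zero, of x] show "S t (\<lambda>_. 0) x = 0"
    using F_nontrivial by (simp add: J_zero tendsto_const_iff)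
qed

lemma S_convex: "0 \<le> t \<Longrightarrow> convex_op C (S t)"
  unfolding convex_op_def le_fun_def
proof (intro ballI allI)
  fix f g x and u :: real
  assume t: "0 \<le> t" and f: "f \<in> C" and g: "g \<in> C" and u: "u \<in> {0..1}"
  show "S t (\<lambda>x. u * f x + (1 - u) * g x) x \<le> u * S t f x + (1 - u) * S t g x"
  proof (rule tendsto_le[OF F_nontrivial])
    show "((\<lambda>n. J n (steps t n) (\<lambda>x. u * f x + (1 - u) * g x) x) \<longlongrightarrow>
        S t (\<lambda>x. u * f x + (1 - u) * g x) x) F"
      by (intro S_lim t C_add C_scale f g)
    show "((\<lambda>n. u * J n (steps t n) f x + (1 - u) * J n (steps t n) g x) \<longlongrightarrow> u * S t f x + (1 - u) * S t g x) F"
      by (intro tendsto_intros S_lim t f g)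
    show "\<forall>\<^sub>F n in F. J n (steps t n) (\<lambda>x. u * f x + (1 - u) * g x) x
        \<le> u * J n (steps t n) f x + (1 - u) * J n (steps t n) g x"
    proof (intro always_eventually allI)
      fix n
      have "\<forall>f\<in>C. \<forall>g\<in>C. \<forall>u\<in>{0..1}. J n (steps t n) (\<lambda>x. u * f x + (1 - u) * g x)
          \<le> (\<lambda>x. u * J n (steps t n) f x + (1 - u) * J n (steps t n) g x)"
        using J_convex unfolding convex_op_def .
      then show "J n (steps t n) (\<lambda>x. u * f x + (1 - u) * g x) x
          \<le> u * J n (steps t n) f x + (1 - u) * J n (steps t n) g x"
        using f g u unfolding le_fun_def by blast
    qed
  qed
qed

lemma S_kappa_lip:
  assumes f: "f \<in> B r" and g: "g \<in> B r" and fg: "(\<lambda>x. f x - g x) \<in> B M" and t: "0 \<le> t" "t \<le> T"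
  shows "\<bar>S t f x - S t g x\<bar> * \<kappa> x \<le> kappa_lip_upto r T * M"
proof (rule tendsto_upperbound)
  show "((\<lambda>n. \<bar>J n (steps t n) f x - J n (steps t n) g x\<bar> * \<kappa> x) \<longlongrightarrow> \<bar>S t f x - S t g x\<bar> * \<kappa> x) F"
    by (intro tendsto_intros S_lim t ball_kappa_C[OF f] ball_kappa_C[OF g])
  show "\<forall>\<^sub>F n in F. \<bar>J n (steps t n) f x - J n (steps t n) g x\<bar> * \<kappa> x \<le> kappa_lip_upto r T * M"
  proof (intro always_eventually allI)
    fix n
    have "real (steps t n) * h n \<le> T" using steps_le[OF t(1), of n] t(2) by simp
    from J_kappa_lip[OF f g fg this]
    show "\<bar>J n (steps t n) f x - J n (steps t n) g x\<bar> * \<kappa> x \<le> kappa_lip_upto r T * M"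
      by (rule ball_kappa_D)
  qed
qed (rule F_nontrivial)

lemma S_time:
  assumes f: "f \<in> C" and K: "compact K" and "0 < \<epsilon>" and T: "0 \<le> T"
  obtains \<delta> where "0 < \<delta>" and "\<And>s t x. 0 \<le> s \<Longrightarrow> s \<le> T \<Longrightarrow> 0 \<le> t \<Longrightarrow> t \<le> T \<Longrightarrow> \<bar>s - t\<bar> < \<delta> \<Longrightarrow> x \<in> K \<Longrightarrow>
      \<bar>S s f x - S t f x\<bar> \<le> \<epsilon>"
proof -
  obtain \<delta> where \<delta>: "0 < \<delta>" "\<And>n j k x. \<bar>real j * h n - real k * h n\<bar> \<le> \<delta> \<Longrightarrow> real j * h n \<le> T \<Longrightarrow>
      real k * h n \<le> T \<Longrightarrow> x \<in> K \<Longrightarrow> \<bar>J n j f x - J n k f x\<bar> \<le> \<epsilon>"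
    using J_time[OF assms] by blast
  show ?thesis
  proof (rule that[OF \<delta>(1)])
    fix s t x assume s: "0 \<le> s" "s \<le> T" and t: "0 \<le> t" "t \<le> T" and st: "\<bar>s - t\<bar> < \<delta>" and x: "x \<in> K"
    show "\<bar>S s f x - S t f x\<bar> \<le> \<epsilon>"
    proof (rule tendsto_upperbound)
      show "((\<lambda>n. \<bar>J n (steps s n) f x - J n (steps t n) f x\<bar>) \<longlongrightarrow> \<bar>S s f x - S t f x\<bar>) F"
        by (intro tendsto_intros S_lim s t f)
      have "((\<lambda>n. \<bar>real (steps s n) * h n - real (steps t n) * h n\<bar>) \<longlongrightarrow> \<bar>s - t\<bar>) F"
        by (intro tendsto_intros steps_lim s t)
      then have "\<forall>\<^sub>F n in F. \<bar>real (steps s n) * h n - real (steps t n) * h n\<bar> < \<delta>"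
        by (rule order_tendstoD(2)[OF _ st])
      then show "\<forall>\<^sub>F n in F. \<bar>J n (steps s n) f x - J n (steps t n) f x\<bar> \<le> \<epsilon>"
      proof eventually_elim
        case (elim n)
        then show ?case
          using steps_le[OF s(1), of n] steps_le[OF t(1), of n] s(2) t(2) x by (intro \<delta>(2)) auto
      qed
    qed (rule F_nontrivial)
  qed
qed

lemma S_joint_cont:
  assumes f: "f \<in> C" and K: "compact K"
    and bounded: "\<forall>\<^sub>F i in G. g i \<in> B r"
    and lim: "\<And>K. compact K \<Longrightarrow> uniform_limit K g f G"
    and s: "(s \<longlongrightarrow> t) G" "\<forall>\<^sub>F i in G. 0 \<le> s i" and t: "0 \<le> t"
  shows "uniform_limit K (\<lambda>i. S (s i) (g i)) (S t f) G"
proof (rule uniform_limitI)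
  fix \<epsilon> :: real assume "0 < \<epsilon>"
  obtain q where q: "0 \<le> q" "f \<in> B q" using C_ball[OF f] by auto
  define R where "R = max r q"
  have "0 \<le> R" using q by (simp add: R_def)
  have fR: "f \<in> B R" using ball_kappa_mono[OF q(2), of R] by (simp add: R_def)
  have "0 < \<epsilon> / 4" "0 \<le> t + 1" using \<open>0 < \<epsilon>\<close> t by auto
  obtain K' c where K': "compact K'" "0 \<le> c"
    and S: "\<And>s. 0 \<le> s \<Longrightarrow> s \<le> t + 1 \<Longrightarrow> controls R K K' c (\<epsilon> / 4) (S s)"
    using S_local[OF \<open>0 < \<epsilon> / 4\<close> \<open>0 \<le> R\<close> \<open>0 \<le> t + 1\<close> K] by blast
  define \<eta> where "\<eta> = \<epsilon> / (4 * (c + 1))"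
  have \<eta>: "0 < \<eta>" "c * \<eta> \<le> \<epsilon> / 4"
    using \<open>0 < \<epsilon>\<close> \<open>0 \<le> c\<close> by (auto simp: \<eta>_def field_simps)
  obtain \<delta> where \<delta>: "0 < \<delta>" "\<And>s' t' x. 0 \<le> s' \<Longrightarrow> s' \<le> t + 1 \<Longrightarrow> 0 \<le> t' \<Longrightarrow> t' \<le> t + 1 \<Longrightarrow> \<bar>s' - t'\<bar> < \<delta> \<Longrightarrow> x \<in> K \<Longrightarrow>
      \<bar>S s' f x - S t' f x\<bar> \<le> \<epsilon> / 4"
    using S_time[OF f K \<open>0 < \<epsilon> / 4\<close> \<open>0 \<le> t + 1\<close>] by blast
  have "\<forall>\<^sub>F i in G. dist (s i) t < min \<delta> 1" using \<delta>(1) by (intro tendstoD[OF s(1)]) simp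
  moreover have "\<forall>\<^sub>F i in G. \<forall>x\<in>K'. dist (g i x) (f x) < \<eta>"
    by (rule uniform_limitD[OF lim[OF K'(1)] \<open>0 < \<eta>\<close>])
  ultimately show "\<forall>\<^sub>F i in G. \<forall>x\<in>K. dist (S (s i) (g i) x) (S t f x) < \<epsilon>"
    using bounded s(2)
  proof eventually_elim
    case (elim i)
    have "\<bar>s i - t\<bar> < \<delta>" "\<bar>s i - t\<bar> < 1" using elim(1) by (simp_all add: dist_real_def)
    then have si: "s i \<le> t + 1" "\<bar>s i - t\<bar> < \<delta>" by linarith+
    show ?case
    proof
      fix x assume x: "x \<in> K"
      have "g i \<in> B R" using ball_kappa_mono[OF elim(3), of R] by (simp add: R_def)
      moreover have "\<bar>g i y - f y\<bar> \<le> \<eta>" if "y \<in> K'" for y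
        using elim(2) that by (auto simp: dist_real_def less_imp_le)
      ultimately have "\<bar>S (s i) (g i) x - S (s i) f x\<bar> \<le> c * \<eta> + \<epsilon> / 4"
        by (intro controlsD[OF S[OF elim(4) si(1)] _ fR less_imp_le[OF \<eta>(1)] _ x])
      moreover have "\<bar>S (s i) f x - S t f x\<bar> \<le> \<epsilon> / 4"
        by (rule \<delta>(2)[OF elim(4) si(1) t _ si(2) x]) simp
      ultimately show "dist (S (s i) (g i) x) (S t f x) < \<epsilon>"
        unfolding dist_real_def using \<eta>(2) \<open>0 < \<epsilon>\<close> by linarith
    qed
  qed
qed

text \<open>
  Dini's theorem makes the convergence of the arguments locally uniform, and \<open>S t\<close> is continuous for
  locally uniform convergence of functions from one ball.
\<close>

lemma S_decreases_to_0:
  assumes G: "\<And>n. G n \<in> C" and dec: "decreases_to_0 G" and t: "0 \<le> t"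
  shows "decreases_to_0 (\<lambda>n. S t (G n))"
  unfolding decreases_to_0_def
proof (intro conjI allI)
  have G_dec: "decseq G" and G_lim: "(\<lambda>n. G n x) \<longlonglongrightarrow> 0" for x
    using dec by (auto simp: decreases_to_0_def)
  then show "decseq (\<lambda>n. S t (G n))"
    by (auto simp: decseq_fun_iff intro!: S_mono G t)
  obtain r where r: "G 0 \<in> B r" using C_ball[OF G] by blast
  have G_nonneg: "0 \<le> G n x" for n x
  proof (rule tendsto_upperbound[OF G_lim])
    show "\<forall>\<^sub>F j in sequentially. G j x \<le> G n x"
      using G_dec by (auto simp: decseq_fun_iff eventually_sequentially intro!: exI[of _ n])
  qed simp
  have G_ball: "G n \<in> B r" for n
    unfolding ball_kappa_iff
  proof (intro conjI allI C_kappa_continuous[OF G])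
    fix x
    have "G n x \<le> G 0 x" using G_dec by (auto simp: decseq_fun_iff)
    then have "\<bar>G n x\<bar> * \<kappa> x \<le> \<bar>G 0 x\<bar> * \<kappa> x"
      using G_nonneg[of n x] kappa_pos[of x] by (intro mult_right_mono) auto
    then show "\<bar>G n x\<bar> * \<kappa> x \<le> r" using ball_kappa_D[OF r, of x] by simp
  qed
  have unif: "uniform_limit K G (\<lambda>_. 0) sequentially" if "compact K" for K
  proof (rule uniform_limitI)
    fix e :: real assume "0 < e"
    from dini_to_0[OF that C_kappa_continuous[OF G] G_dec G_lim this]
    show "\<forall>\<^sub>F n in sequentially. \<forall>x\<in>K. dist (G n x) 0 < e"
      by (auto simp: eventually_sequentially)
  qed
  fix x
  have "uniform_limit {x} (\<lambda>n. S t (G n)) (S t (\<lambda>_. 0)) sequentially"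
    by (rule S_joint_cont[where r = r, OF C_zero _ _ unif]) (use G_ball t in auto)
  then show "(\<lambda>n. S t (G n) x) \<longlonglongrightarrow> 0"
    unfolding S_zero[OF t] by (rule tendsto_uniform_limitI) simp
qed

lemma S_sequence_uniform:
  assumes f: "f \<in> C" and "\<And>n. 0 \<le> s n" and "s \<longlonglongrightarrow> t" and K: "compact K"
  shows "uniform_limit K (\<lambda>n. S (s n) f) (S t f) sequentially"
proof -
  obtain r where r: "f \<in> B r" using C_ball[OF f] by auto
  have "0 \<le> t" using assms(2) by (intro LIMSEQ_le_const[OF assms(3)]) auto
  show ?thesis
    by (rule S_joint_cont[where g = "\<lambda>_. f" and r = r, OF f K _ _ assms(3) _ \<open>0 \<le> t\<close>])
       (use r assms(2) in \<open>auto intro: uniform_limit_const_fun\<close>)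
qed

theorem S_convex_monotone_semigroup: "convex_monotone_semigroup \<kappa> S"
  unfolding convex_monotone_semigroup_def
proof (intro conjI allI impI ballI)
  show "S t \<in> C \<rightarrow> C" if "0 \<le> t" for t using S_C that by auto
  show "convex_op C (S t)" if "0 \<le> t" for t by (rule S_convex[OF that])
  show "mono_on C (S t)" if "0 \<le> t" for t
    by (intro mono_onI) (auto simp: le_fun_def intro!: S_mono that)
  show "decreases_to_0 (\<lambda>n. S t (G n))" if "0 \<le> t" "(\<forall>n. G n \<in> C) \<and> decreases_to_0 G" for t G
    using S_decreases_to_0 that by blast
  show "S 0 f = f" if "f \<in> C" for f by (rule S_zero_time[OF that])
  show "S (s + t) f = S s (S t f)" if "f \<in> C" "0 \<le> s" "0 \<le> t" for f s t by (rule S_add[OF that])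
  show "bdd_above ((\<lambda>t. wnorm \<kappa> (S t (\<lambda>x. r / \<kappa> x))) ` {0..T})" if "0 \<le> r" "0 \<le> T" for r T
  proof -
    have "(\<lambda>x. r / \<kappa> x) \<in> B r"
      using kappa_pos \<open>0 \<le> r\<close>
      by (auto simp: ball_kappa_iff abs_of_pos less_imp_neq[THEN not_sym] intro!: continuous_intros kappa_cont)
    then have "S t (\<lambda>x. r / \<kappa> x) \<in> B (exp (growth * T) * r)" if "t \<in> {0..T}" for t
      using S_ball that by auto
    then show ?thesis by (intro bdd_aboveI[of _ "exp (growth * T) * r"]) (auto simp: ball_kappa_def)
  qed
  show "limsup (\<lambda>n. ereal (S (s n) f (X n))) \<le> ereal (S t f x)"
    if f: "f \<in> C" and st: "(\<forall>n. 0 \<le> s n) \<and> s \<longlonglongrightarrow> t \<and> X \<longlonglongrightarrow> x" for f s t X x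
  proof -
    have X: "X \<longlonglongrightarrow> x" and s: "s \<longlonglongrightarrow> t" "\<And>n. 0 \<le> s n" using st by auto
    have "0 \<le> t" using s(2) by (intro LIMSEQ_le_const[OF s(1)]) auto
    have "uniform_limit (cball x 1) (\<lambda>n. S (s n) f) (S t f) sequentially"
      by (rule S_sequence_uniform[OF f s(2,1) compact_cball])
    moreover have "isCont (S t f) x"
      using C_kappa_continuous[OF S_C[OF f \<open>0 \<le> t\<close>]] by (simp add: continuous_on_eq_continuous_at)
    then have "(\<lambda>n. S t f (X n)) \<longlonglongrightarrow> S t f x"
      using X isCont_tendsto_compose by blast
    moreover have "\<forall>\<^sub>F n in sequentially. X n \<in> cball x 1"
      using tendstoD[OF X, of 1] by (auto simp: dist_commute elim: eventually_mono)
    ultimately have "(\<lambda>n. S (s n) f (X n) - S t f (X n)) \<longlonglongrightarrow> 0"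
      and lim: "(\<lambda>n. S t f (X n)) \<longlonglongrightarrow> S t f x"
      by (auto intro!: tendstoI dest!: uniform_limitD elim: eventually_elim2 simp: dist_real_def)
    from tendsto_add[OF this] have "(\<lambda>n. S (s n) f (X n)) \<longlonglongrightarrow> S t f x" by simp
    then have "(\<lambda>n. ereal (S (s n) f (X n))) \<longlonglongrightarrow> ereal (S t f x)" by simp
    from lim_imp_Limsup[OF _ this] show ?thesis by simp
  qed
qed

theorem S_strongly_continuous: "strongly_continuous \<kappa> S"
  unfolding strongly_continuous_def mixed_lim_at_right_0_def mixed_lim_iff
proof (intro ballI allI impI conjI)
  fix f and s :: "nat \<Rightarrow> real" assume f: "f \<in> C" and s: "(\<forall>n. 0 < s n) \<and> s \<longlonglongrightarrow> 0"
  show "f \<in> C" by (rule f)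
  obtain r where r: "f \<in> B r" using C_ball[OF f] by auto
  have "bounded (range s)" using s by (intro convergent_imp_bounded) auto
  then obtain T where T: "\<And>n. \<bar>s n\<bar> \<le> T" by (auto simp: bounded_iff)
  have "S (s n) f \<in> B (exp (growth * T) * r)" for n
    using T[of n] s by (intro S_ball[OF r]) (auto simp: less_imp_le)
  then show "\<exists>M. \<forall>n. S (s n) f \<in> B M" by blast
  show "uniform_limit K (\<lambda>n. S (s n) f) f sequentially" if "compact K" for K
    using S_sequence_uniform[OF f _ _ that, of s 0] s by (simp add: S_zero_time[OF f] less_imp_le)
qed

end

section \<open>Generators and averages\<close>

text \<open>
  A lower bound on the right difference quotients integrates to a global bound although the range
  \<open>d\<close> in which it holds depends on \<open>s\<close>: the function \<open>\<phi> s + c * s\<close> cannot have a last point at which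
  it is at least \<open>\<phi> 0\<close>, except for the right end point.
\<close>

lemma lower_dini_bound:
  fixes \<phi> :: "real \<Rightarrow> real"
  assumes cont: "continuous_on {0..t} \<phi>" and "0 \<le> t"
    and step: "\<And>s. 0 \<le> s \<Longrightarrow> s < t \<Longrightarrow> \<exists>d>0. \<forall>u. 0 < u \<and> u < d \<and> s + u \<le> t \<longrightarrow> \<phi> s - c * u \<le> \<phi> (s + u)"
  shows "\<phi> 0 - c * t \<le> \<phi> t"
proof -
  define \<psi> where "\<psi> s = \<phi> s + c * s" for s
  define X where "X = {s \<in> {0..t}. \<psi> 0 \<le> \<psi> s}"
  have "continuous_on {0..t} \<psi>" unfolding \<psi>_def by (intro continuous_intros cont)
  then have "closed X"
    unfolding X_def by (intro continuous_on_closed_Collect_le closed_atLeastAtMost continuous_on_const)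
  then have "compact X"
    unfolding X_def compact_eq_bounded_closed by (auto intro: bounded_subset[of "{0..t}"])
  moreover have "0 \<in> X" using \<open>0 \<le> t\<close> by (simp add: X_def)
  ultimately obtain s where s: "s \<in> X" "\<And>s'. s' \<in> X \<Longrightarrow> s' \<le> s"
    using compact_attains_sup[of X] by auto
  have "s = t"
  proof (rule ccontr)
    assume "s \<noteq> t"
    then have "0 \<le> s" "s < t" using s(1) by (auto simp: X_def)
    then obtain d where d: "0 < d" "\<And>u. 0 < u \<and> u < d \<and> s + u \<le> t \<Longrightarrow> \<phi> s - c * u \<le> \<phi> (s + u)"
      using step by blast
    define u where "u = min (d / 2) (t - s)"
    have u: "0 < u" "u < d" "s + u \<le> t" using d(1) \<open>s < t\<close> by (auto simp: u_def)
    then have "\<psi> s \<le> \<psi> (s + u)" using d(2)[of u] by (simp add: \<psi>_def algebra_simps)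
    then have "s + u \<in> X" using s(1) u by (auto simp: X_def)
    then show False using s(2) u(1) by fastforce
  qed
  then show ?thesis using s(1) by (simp add: X_def \<psi>_def)
qed

lemma avg_uniform_limit:
  fixes f :: "real ^ 'd \<Rightarrow> real"
  assumes m: "kernel \<delta> m" and K: "compact K"
    and g: "\<forall>\<^sub>F i in F. continuous_on UNIV (g i)" and f: "continuous_on UNIV f"
    and lim: "\<And>K. compact K \<Longrightarrow> uniform_limit K g f F"
  shows "uniform_limit K (\<lambda>i. avg m (g i)) (avg m f) F"
proof (rule uniform_limitI)
  fix e :: real assume "0 < e"
  define K1 where "K1 = {x + y | x y. x \<in> K \<and> y \<in> cball 0 \<delta>}"
  have "compact K1" unfolding K1_def by (rule compact_sums[OF K compact_cball])
  then have "\<forall>\<^sub>F i in F. \<forall>x\<in>K1. dist (g i x) (f x) < e / 2"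
    using \<open>0 < e\<close> by (intro uniform_limitD[OF lim]) auto
  with g show "\<forall>\<^sub>F i in F. \<forall>x\<in>K. dist (avg m (g i) x) (avg m f x) < e"
  proof eventually_elim
    case (elim i)
    show ?case
    proof
      fix x assume "x \<in> K"
      have "\<bar>g i (x + u) - f (x + u)\<bar> \<le> e / 2" if "norm u \<le> \<delta>" for u
      proof -
        have "x + u \<in> K1" using \<open>x \<in> K\<close> that by (auto simp: K1_def)
        then show ?thesis using elim(2) by (auto simp: dist_real_def less_imp_le)
      qed
      from avg_diff_le[OF m elim(1) f this] show "dist (avg m (g i) x) (avg m f x) < e"
        using \<open>0 < e\<close> by (simp add: dist_real_def)
    qed
  qed
qed

context scheme
begin

text \<open>
  With \<open>q = (I (h n) f - f) / h n\<close>, the increment of one step is \<open>J n j (f + h n * q) - J n j f\<close>.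
  Convexity bounds it above by \<open>h n * (J n j (f + q) - J n j f)\<close>. For a lower bound, \<open>f\<close> is reached
  from \<open>p = f + h n * q\<close> in the direction \<open>- q\<close>, with the slope \<open>J n j (p - q) - J n j p\<close>. For short
  times \<open>J n j\<close> is locally close to the identity, and \<open>q\<close> is close to \<open>a\<close>, so both bounds are close to
  \<open>h n * a\<close>; the increments are then added up.
\<close>

lemma J_generator:
  assumes a: "a \<in> B M" and b: "\<And>n. (\<lambda>x. (I (h n) f x - f x) / h n) \<in> B M"
    and lim: "\<And>K. compact K \<Longrightarrow> uniform_limit K (\<lambda>n x. (I (h n) f x - f x) / h n) a sequentially"
    and f: "f \<in> C" and K: "compact K" and "0 < \<epsilon>"
  obtains \<delta> where "0 < \<delta>"
    and "\<forall>\<^sub>F n in sequentially. \<forall>k. real k * h n \<le> \<delta> \<longrightarrow>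
           (\<forall>x\<in>K. \<bar>J n k f x - f x - real k * h n * a x\<bar> \<le> real k * h n * \<epsilon>)"
proof -
  define q where "q n x = (I (h n) f x - f x) / h n" for n x
  have q: "q n \<in> B M" for n unfolding q_def by (rule b)
  have If: "I (h n) f = (\<lambda>x. f x + h n * q n x)" for n
    using h_pos[of n] by (simp add: q_def fun_eq_iff)
  obtain r where r: "0 \<le> r" "f \<in> B r" using C_ball[OF f] by auto
  have "0 \<le> M" by (rule ball_nonneg[OF a])
  define R where "R = r + M"
  have "0 \<le> R" using r \<open>0 \<le> M\<close> by (simp add: R_def)
  have "0 < \<epsilon> / 8" using \<open>0 < \<epsilon>\<close> by simp
  obtain K' c where K': "compact K'" "0 \<le> c"
    and J: "\<And>n k. real k * h n \<le> 1 \<Longrightarrow> controls R K K' c (\<epsilon> / 8) (J n k)"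
    using J_local[OF \<open>0 < \<epsilon> / 8\<close> \<open>0 \<le> R\<close> zero_le_one K] by blast
  define \<eta> where "\<eta> = \<epsilon> / (8 * (c + 1))"
  have \<eta>: "0 < \<eta>" "c * \<eta> \<le> \<epsilon> / 8"
    using \<open>0 < \<epsilon>\<close> \<open>0 \<le> c\<close> by (auto simp: \<eta>_def field_simps)
  have aC: "a \<in> C" by (rule ball_kappa_C[OF a])
  obtain d0 where d0: "0 < d0" "\<And>n k x. real k * h n \<le> d0 \<Longrightarrow> x \<in> K \<Longrightarrow> \<bar>J n k f x - f x\<bar> \<le> \<epsilon> / 8"
    using J_time_0[OF f K \<open>0 < \<epsilon> / 8\<close>] by blast
  obtain d1 where d1: "0 < d1"
    "\<And>n k x. real k * h n \<le> d1 \<Longrightarrow> x \<in> K \<Longrightarrow> \<bar>J n k (\<lambda>x. f x + a x) x - (f x + a x)\<bar> \<le> \<epsilon> / 8"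
    using J_time_0[OF C_add[OF f aC] K \<open>0 < \<epsilon> / 8\<close>] by blast
  obtain d2 where d2: "0 < d2"
    "\<And>n k x. real k * h n \<le> d2 \<Longrightarrow> x \<in> K \<Longrightarrow> \<bar>J n k (\<lambda>x. f x - a x) x - (f x - a x)\<bar> \<le> \<epsilon> / 8"
    using J_time_0[OF C_diff[OF f aC] K \<open>0 < \<epsilon> / 8\<close>] by blast
  define \<delta> where "\<delta> = min 1 (min d0 (min d1 d2))"
  have "0 < \<delta>" and \<delta>: "\<delta> \<le> 1" "\<delta> \<le> d0" "\<delta> \<le> d1" "\<delta> \<le> d2" using d0(1) d1(1) d2(1) by (auto simp: \<delta>_def)
  obtain \<kappa>0 where \<kappa>0: "0 < \<kappa>0" "\<And>x. x \<in> K' \<Longrightarrow> \<kappa>0 \<le> \<kappa> x" using kappa_lower[OF K'(1)] by blast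
  have q_le: "\<bar>q n x\<bar> \<le> M / \<kappa>0" if "x \<in> K'" for n x
  proof -
    have "\<bar>q n x\<bar> * \<kappa>0 \<le> \<bar>q n x\<bar> * \<kappa> x" using \<kappa>0(2)[OF that] by (intro mult_left_mono) auto
    also have "\<dots> \<le> M" by (rule ball_kappa_D[OF q])
    finally show ?thesis using \<kappa>0(1) by (simp add: le_divide_eq)
  qed
  have "(\<lambda>n. h n * (M / \<kappa>0)) \<longlonglongrightarrow> 0 * (M / \<kappa>0)" by (intro tendsto_intros h_lim)
  then have "\<forall>\<^sub>F n in sequentially. h n * (M / \<kappa>0) < \<eta> / 2"
    using \<eta>(1) by (intro order_tendstoD(2)) auto
  moreover have "\<forall>\<^sub>F n in sequentially. h n < 1" by (rule order_tendstoD(2)[OF h_lim]) simp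
  moreover have "\<forall>\<^sub>F n in sequentially. \<forall>x\<in>K'. dist (q n x) (a x) < \<eta> / 2"
    using \<eta>(1) unfolding q_def by (intro uniform_limitD[OF lim] K'(1)) simp
  ultimately have "\<forall>\<^sub>F n in sequentially. \<forall>k. real k * h n \<le> \<delta> \<longrightarrow>
           (\<forall>x\<in>K. \<bar>J n k f x - f x - real k * h n * a x\<bar> \<le> real k * h n * \<epsilon>)"
  proof eventually_elim
    case (elim n)
    have qa: "\<bar>q n y - a y\<bar> \<le> \<eta> / 2" and hq: "\<bar>h n * q n y\<bar> \<le> \<eta> / 2" if "y \<in> K'" for y
    proof -
      show "\<bar>q n y - a y\<bar> \<le> \<eta> / 2" using elim(3) that by (auto simp: dist_real_def less_imp_le)
      have "\<bar>h n * q n y\<bar> \<le> h n * (M / \<kappa>0)"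
        using mult_left_mono[OF q_le[OF that, of n], of "h n"] h_pos[of n] by (simp add: abs_mult)
      then show "\<bar>h n * q n y\<bar> \<le> \<eta> / 2" using elim(1) by linarith
    qed
    define p where "p x = f x + h n * q n x" for x
    have qC: "q n \<in> C" by (rule ball_kappa_C[OF q])
    have fR: "f \<in> B R" and faR: "(\<lambda>x. f x + a x) \<in> B R" "(\<lambda>x. f x - a x) \<in> B R"
      and fqR: "(\<lambda>x. f x + q n x) \<in> B R"
      using ball_kappa_mono[OF r(2), of R] \<open>0 \<le> M\<close> ball_add[OF r(2) a] ball_diff[OF r(2) a] ball_add[OF r(2) q]
      by (auto simp: R_def)
    have pR: "p \<in> B R"
    proof -
      have "p \<in> B (r + \<bar>h n\<bar> * M)" unfolding p_def by (rule ball_add[OF r(2) ball_scale[OF q]])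
      then show ?thesis
        using elim(2) h_pos[of n] \<open>0 \<le> M\<close> by (elim ball_kappa_mono) (simp add: R_def mult_left_le_one_le)
    qed
    have pqR: "(\<lambda>x. p x - q n x) \<in> B R"
    proof -
      have "(\<lambda>x. f x + (h n - 1) * q n x) \<in> B (r + \<bar>h n - 1\<bar> * M)" by (rule ball_add[OF r(2) ball_scale[OF q]])
      then have "(\<lambda>x. p x - q n x) \<in> B (r + \<bar>h n - 1\<bar> * M)" by (simp add: p_def algebra_simps)
      then show ?thesis
        using elim(2) h_pos[of n] \<open>0 \<le> M\<close> by (elim ball_kappa_mono) (simp add: R_def mult_left_le_one_le)
    qed
    have step: "\<bar>J n (Suc j) f x - J n j f x - h n * a x\<bar> \<le> h n * \<epsilon>"
      if j: "real j * h n \<le> \<delta>" and x: "x \<in> K" for j x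
    proof -
      have j1: "real j * h n \<le> 1" using j \<delta>(1) by simp
      have f0: "\<bar>J n j f x - f x\<bar> \<le> \<epsilon> / 8" using j \<delta> by (intro d0(2) x) simp
      have f1: "\<bar>J n j (\<lambda>x. f x + a x) x - (f x + a x)\<bar> \<le> \<epsilon> / 8" using j \<delta> by (intro d1(2) x) simp
      have f2: "\<bar>J n j (\<lambda>x. f x - a x) x - (f x - a x)\<bar> \<le> \<epsilon> / 8" using j \<delta> by (intro d2(2) x) simp
      have g1: "\<bar>J n j (\<lambda>x. f x + q n x) x - J n j (\<lambda>x. f x + a x) x\<bar> \<le> c * \<eta> + \<epsilon> / 8"
      proof (rule controlsD[OF J[OF j1] fqR faR(1) less_imp_le[OF \<eta>(1)] _ x])
        fix y assume "y \<in> K'"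
        from qa[OF this] show "\<bar>f y + q n y - (f y + a y)\<bar> \<le> \<eta>" using \<eta>(1) by linarith
      qed
      have g2: "\<bar>J n j (\<lambda>x. p x - q n x) x - J n j (\<lambda>x. f x - a x) x\<bar> \<le> c * \<eta> + \<epsilon> / 8"
      proof (rule controlsD[OF J[OF j1] pqR faR(2) less_imp_le[OF \<eta>(1)] _ x])
        fix y assume "y \<in> K'"
        from qa[OF this] hq[OF this] show "\<bar>p y - q n y - (f y - a y)\<bar> \<le> \<eta>"
          unfolding p_def by linarith
      qed
      have g3: "\<bar>J n j p x - J n j f x\<bar> \<le> c * \<eta> + \<epsilon> / 8"
      proof (rule controlsD[OF J[OF j1] pR fR less_imp_le[OF \<eta>(1)] _ x])
        fix y assume "y \<in> K'"
        from hq[OF this] show "\<bar>p y - f y\<bar> \<le> \<eta>" unfolding p_def using \<eta>(1) by linarith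
      qed
      have Jp: "J n (Suc j) f = J n j p" by (simp add: J_Suc' If p_def[abs_def])
      have "J n j p x - J n j f x \<le> h n * (J n j (\<lambda>x. f x + q n x) x - J n j f x)"
        unfolding p_def using h_pos[of n] elim(2) by (intro convex_op_secant[OF J_convex f qC]) auto
      also have "\<dots> \<le> h n * (a x + \<epsilon>)"
        using h_pos[of n] f0 f1 g1 \<eta>(2) \<open>0 < \<epsilon>\<close> by (intro mult_left_mono) linarith+
      finally have upper: "J n j p x - J n j f x \<le> h n * (a x + \<epsilon>)" .
      have "J n j (\<lambda>x. p x + h n * (- q n x)) x - J n j p x
          \<le> h n * (J n j (\<lambda>x. p x + (- q n x)) x - J n j p x)"
        using h_pos[of n] elim(2) C_scale[OF qC, of "-1"]
        by (intro convex_op_secant[OF J_convex ball_kappa_C[OF pR]]) auto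
      then have "J n j f x - J n j p x \<le> h n * (J n j (\<lambda>x. p x - q n x) x - J n j p x)"
        by (simp add: p_def)
      also have "\<dots> \<le> h n * (\<epsilon> - a x)"
        using h_pos[of n] f0 f2 g2 g3 \<eta>(2) \<open>0 < \<epsilon>\<close> by (intro mult_left_mono) linarith+
      finally show ?thesis using upper by (simp add: Jp abs_le_iff algebra_simps)
    qed
    show ?case
    proof (intro allI impI ballI)
      fix k x assume "real k * h n \<le> \<delta>" and x: "x \<in> K"
      then show "\<bar>J n k f x - f x - real k * h n * a x\<bar> \<le> real k * h n * \<epsilon>"
      proof (induction k)
        case (Suc k)
        then have k: "real k * h n \<le> \<delta>" using h_pos[of n] by (simp add: distrib_right)
        from Suc.IH[OF k x] step[OF k x] show ?case
          by (simp add: distrib_right)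
      qed simp
    qed
  qed
  then show ?thesis by (rule that[OF \<open>0 < \<delta>\<close>])
qed

end

context limit_family
begin

text \<open>
  The limit \<open>a\<close> of the difference quotients is taken along the whole sequence of step sizes. Any two
  limit families therefore have the same derivative at time 0 on smooth functions.
\<close>

lemma S_generator:
  assumes a: "a \<in> B M" and b: "\<And>n. (\<lambda>x. (I (h n) f x - f x) / h n) \<in> B M"
    and lim: "\<And>K. compact K \<Longrightarrow> uniform_limit K (\<lambda>n x. (I (h n) f x - f x) / h n) a sequentially"
    and f: "f \<in> C" and K: "compact K" and "0 < \<epsilon>"
  obtains \<delta> where "0 < \<delta>" and "\<And>s x. 0 \<le> s \<Longrightarrow> s \<le> \<delta> \<Longrightarrow> x \<in> K \<Longrightarrow> \<bar>S s f x - f x - s * a x\<bar> \<le> s * \<epsilon>"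
proof -
  obtain \<delta> where \<delta>: "0 < \<delta>" "\<forall>\<^sub>F n in sequentially. \<forall>k. real k * h n \<le> \<delta> \<longrightarrow>
           (\<forall>x\<in>K. \<bar>J n k f x - f x - real k * h n * a x\<bar> \<le> real k * h n * \<epsilon>)"
    using J_generator[OF assms] by blast
  show ?thesis
  proof (rule that[OF \<delta>(1)])
    fix s x assume s: "0 \<le> s" "s \<le> \<delta>" and x: "x \<in> K"
    show "\<bar>S s f x - f x - s * a x\<bar> \<le> s * \<epsilon>"
    proof (rule tendsto_le[OF F_nontrivial])
      show "((\<lambda>n. \<bar>J n (steps s n) f x - f x - real (steps s n) * h n * a x\<bar>) \<longlongrightarrow> \<bar>S s f x - f x - s * a x\<bar>) F"
        by (intro tendsto_intros S_lim steps_lim s f)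
      show "((\<lambda>n. real (steps s n) * h n * \<epsilon>) \<longlongrightarrow> s * \<epsilon>) F"
        by (intro tendsto_intros steps_lim s)
      show "\<forall>\<^sub>F n in F. \<bar>J n (steps s n) f x - f x - real (steps s n) * h n * a x\<bar> \<le> real (steps s n) * h n * \<epsilon>"
        using filter_leD[OF F_le \<delta>(2)]
        by eventually_elim (use x s(2) steps_le[OF s(1)] order_trans in blast)
    qed
  qed
qed

lemma S_smooth_time:
  assumes A: "\<And>n k. real k * h n \<le> 1 \<Longrightarrow> (\<lambda>x. J n k g x - g x) \<in> B (A * (real k * h n))"
    and g: "g \<in> C" and s: "0 \<le> s" "s \<le> 1"
  shows "\<bar>S s g x - g x\<bar> * \<kappa> x \<le> A * s"
proof (rule tendsto_le[OF F_nontrivial])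
  show "((\<lambda>n. \<bar>J n (steps s n) g x - g x\<bar> * \<kappa> x) \<longlongrightarrow> \<bar>S s g x - g x\<bar> * \<kappa> x) F"
    by (intro tendsto_intros S_lim s g)
  show "((\<lambda>n. A * (real (steps s n) * h n)) \<longlongrightarrow> A * s) F"
    by (intro tendsto_intros steps_lim s)
  show "\<forall>\<^sub>F n in F. \<bar>J n (steps s n) g x - g x\<bar> * \<kappa> x \<le> A * (real (steps s n) * h n)"
    using steps_le[OF s(1)] s(2) by (intro always_eventually allI ball_kappa_D[OF A]) (meson order_trans)
qed

text \<open>
  The averages \<open>v n k\<close> of the iterates of \<open>f\<close> are almost supersolutions of the scheme: exchanging one
  step with the average costs at most \<open>r' * \<epsilon> * h n / \<kappa>\<close>, and the remaining steps enlarge this error by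
  a bounded factor only. Induction over the number of steps gives a total error proportional to
  \<open>\<epsilon> * s\<close>, and the estimate passes to the limit. The constant involves \<open>\<epsilon>\<close> only linearly and does not
  depend on the kernel, whose derivatives may blow up as \<open>\<epsilon>\<close> tends to 0.
\<close>

lemma S_avg_le:
  assumes f: "f \<in> Lip_b r" and T: "0 \<le> T" and \<epsilon>: "0 < \<epsilon>" "\<epsilon> \<le> 1"
  defines "r' \<equiv> exp (lip_growth * T) * r"
  obtains \<delta>0 where "0 < \<delta>0"
    and "\<And>\<delta> m s t y. \<delta> \<le> \<delta>0 \<Longrightarrow> kernel \<delta> m \<Longrightarrow>
      (\<And>g. continuous_on UNIV g \<Longrightarrow> bounded (range g) \<Longrightarrow> continuous_on UNIV (avg m g)) \<Longrightarrow>
      0 \<le> s \<Longrightarrow> 0 \<le> t \<Longrightarrow> s + t \<le> T \<Longrightarrow>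
      S s (avg m (S t f)) y \<le> avg m (S (t + s) f) y + kappa_lip_upto (r' * kmax + r') T * r' * \<epsilon> * s / \<kappa> y"
proof -
  define R where "R = r' * kmax + r'"
  define A where "A = kappa_lip_upto R T * r'"
  have "0 \<le> r'" using Lip_b_nonneg[OF f] by (simp add: r'_def)
  obtain \<delta>0 n0 where \<delta>0: "0 < \<delta>0"
    and I_avg: "\<And>\<delta> m n r f y. \<delta> \<le> \<delta>0 \<Longrightarrow> kernel \<delta> m \<Longrightarrow> n \<ge> n0 \<Longrightarrow> f \<in> Lip_b r \<Longrightarrow> continuous_on UNIV (avg m f) \<Longrightarrow>
      I (h n) (avg m f) y \<le> avg m (I (h n) f) y + r * \<epsilon> * h n / \<kappa> y"
    using I_avg_le[OF \<epsilon>(1)] by blast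
  show ?thesis
  proof (rule that[OF \<delta>0])
    fix \<delta> :: real and m :: "real ^ 'd \<Rightarrow> real" and s t y
    assume \<delta>: "\<delta> \<le> \<delta>0" and m: "kernel \<delta> m"
      and m_cont: "\<And>g. continuous_on UNIV g \<Longrightarrow> bounded (range g) \<Longrightarrow> continuous_on UNIV (avg m g)"
      and s: "0 \<le> s" and t: "0 \<le> t" and st: "s + t \<le> T"
    define v where "v n k = avg m (J n k f)" for n k
    have avg_cont: "continuous_on UNIV (avg m g)" if "g \<in> Lip_b r'" for g
      using that by (intro m_cont Lip_b_continuous[OF that]) (auto simp: Lip_b_def bounded_iff)
    have avg_ball: "avg m g \<in> B (r' * kmax)" if "g \<in> Lip_b r'" for g
      using avg_close[OF m Lip_b_continuous[OF that], of _ 0 r'] that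
      by (intro bounded_ball avg_cont[OF that]) (auto simp: Lip_b_def)
    have JL: "J n k f \<in> Lip_b r'" if "real k * h n \<le> T" for n k
      unfolding r'_def by (rule J_Lip_b[OF f that])
    have discrete: "J n j (v n k) y \<le> v n (k + j) y + A * \<epsilon> * (real j * h n) / \<kappa> y"
      if n: "n \<ge> n0" "h n \<le> 1" and kj: "real (k + j) * h n \<le> T" for n j k
      using kj
    proof (induction j arbitrary: k)
      case (Suc j)
      have le: "real i * h n \<le> T" if "i \<le> k + Suc j" for i
      proof -
        have "real i * h n \<le> real (k + Suc j) * h n" using that h_pos[of n] by (intro mult_right_mono) auto
        then show ?thesis using Suc.prems by simp
      qed
      have lek: "real k * h n \<le> T" by (rule le) simp
      have vk: "v n k \<in> C" and vk1: "v n (Suc k) \<in> B (r' * kmax)"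
        unfolding v_def using avg_ball[OF JL[OF le[of k]]] avg_ball[OF JL[OF le[of "Suc k"]]]
        by (auto intro: ball_kappa_C)
      define z where "z x = v n (Suc k) x + r' * \<epsilon> * h n / \<kappa> x" for x
      have err: "(\<lambda>x. r' * \<epsilon> * h n / \<kappa> x) \<in> B (r' * \<epsilon> * h n)"
        using kappa_pos \<open>0 \<le> r'\<close> \<epsilon> h_pos[of n]
        by (auto simp: ball_kappa_iff abs_of_pos abs_mult less_imp_neq[THEN not_sym] intro!: continuous_intros kappa_cont)
      have "r' * \<epsilon> * h n \<le> r' * 1 * 1"
        using \<open>0 \<le> r'\<close> \<epsilon> h_pos[of n] n(2) by (intro mult_mono) auto
      then have zR: "z \<in> B R" and vR: "v n (Suc k) \<in> B R"
        using ball_kappa_mono[OF ball_add[OF vk1 err], of R] ball_kappa_mono[OF vk1, of R] \<open>0 \<le> r'\<close>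
        by (auto simp: z_def[abs_def] R_def)
      have "J n (Suc j) (v n k) y = J n j (I (h n) (v n k)) y" by (simp add: J_Suc')
      also have "\<dots> \<le> J n j z y"
      proof (rule J_mono[OF I_C[OF vk] ball_kappa_C[OF zR]])
        fix x
        show "I (h n) (v n k) x \<le> z x"
          using I_avg[OF \<delta> m n(1) JL[OF lek] avg_cont[OF JL[OF lek]], of x] by (simp add: v_def z_def J_Suc)
      qed
      also have "\<dots> \<le> J n j (v n (Suc k)) y + A * \<epsilon> * h n / \<kappa> y"
      proof -
        have "(\<lambda>x. z x - v n (Suc k) x) \<in> B (r' * \<epsilon> * h n)" using err by (simp add: z_def)
        from ball_kappa_D[OF J_kappa_lip[OF zR vR this le[of j]], of y]
        have "\<bar>J n j z y - J n j (v n (Suc k)) y\<bar> * \<kappa> y \<le> A * \<epsilon> * h n"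
          by (simp add: A_def mult_ac)
        then show ?thesis using kappa_pos[of y] by (simp add: pos_le_divide_eq[symmetric] abs_le_iff)
      qed
      also have "J n j (v n (Suc k)) y \<le> v n (Suc k + j) y + A * \<epsilon> * (real j * h n) / \<kappa> y"
        using Suc.prems by (intro Suc.IH) simp
      finally show ?case by (simp add: add_divide_distrib algebra_simps)
    qed simp
    have fC: "f \<in> C" by (rule Lip_b_C[OF f])
    have SL: "S t f \<in> Lip_b r'" unfolding r'_def using s st by (intro S_Lip_b[OF f t]) simp
    have JLt: "J n (steps t n) f \<in> Lip_b r'" for n
      using steps_le[OF t, of n] s st by (intro JL) simp
    have sum_le: "real (steps t n + steps s n) * h n \<le> T" for n
      using steps_le[OF t, of n] steps_le[OF s, of n] st by (simp add: distrib_right)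
    have sum_lim: "((\<lambda>n. real (steps t n + steps s n) * h n) \<longlongrightarrow> t + s) F"
      using tendsto_add[OF steps_lim[OF t] steps_lim[OF s]] by (simp add: distrib_right)
    have "uniform_limit {y} (\<lambda>n. J n (steps s n) (v n (steps t n))) (S s (avg m (S t f))) F"
    proof (rule S_joint[OF ball_kappa_C[OF avg_ball[OF SL]] s _ _ _ steps_lim[OF s]])
      show "\<forall>\<^sub>F n in F. v n (steps t n) \<in> B (r' * kmax)"
        unfolding v_def by (intro always_eventually allI avg_ball JLt)
      show "uniform_limit K (\<lambda>n. v n (steps t n)) (avg m (S t f)) F" if "compact K" for K
        unfolding v_def
        by (rule avg_uniform_limit[OF m that _ Lip_b_continuous[OF SL] S_uniform[OF fC t]])
           (intro always_eventually allI Lip_b_continuous[OF JLt])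
    qed simp
    then have lhs: "((\<lambda>n. J n (steps s n) (v n (steps t n)) y) \<longlongrightarrow> S s (avg m (S t f)) y) F"
      by (rule tendsto_uniform_limitI) simp
    have "uniform_limit {y} (\<lambda>n. v n (steps t n + steps s n)) (avg m (S (t + s) f)) F"
      unfolding v_def
    proof (rule avg_uniform_limit[OF m])
      show "\<forall>\<^sub>F n in F. continuous_on UNIV (J n (steps t n + steps s n) f)"
        by (intro always_eventually allI C_kappa_continuous[OF J_C[OF fC]])
      show "continuous_on UNIV (S (t + s) f)" using s t by (intro C_kappa_continuous[OF S_C[OF fC]]) simp
      show "uniform_limit K (\<lambda>n. J n (steps t n + steps s n) f) (S (t + s) f) F" if "compact K" for K
        by (rule S_joint[where r = "r * kmax", OF fC _ that _ _ sum_lim])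
           (use s t Lip_b_ball[OF f] in \<open>auto intro: uniform_limit_const_fun\<close>)
    qed simp
    then have rhs: "((\<lambda>n. v n (steps t n + steps s n) y) \<longlongrightarrow> avg m (S (t + s) f) y) F"
      by (rule tendsto_uniform_limitI) simp
    have "S s (avg m (S t f)) y \<le> avg m (S (t + s) f) y + A * \<epsilon> * s / \<kappa> y"
    proof (rule tendsto_le[OF F_nontrivial _ lhs])
      show "((\<lambda>n. v n (steps t n + steps s n) y + A * \<epsilon> * (real (steps s n) * h n) / \<kappa> y) \<longlongrightarrow>
          avg m (S (t + s) f) y + A * \<epsilon> * s / \<kappa> y) F"
        using kappa_pos[of y] by (intro tendsto_intros rhs steps_lim s) simp
      have "\<forall>\<^sub>F n in F. h n < 1" by (rule order_tendstoD(2)[OF h_lim_F]) simp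
      moreover have "\<forall>\<^sub>F n in F. n \<ge> n0" by (rule filter_leD[OF F_le eventually_ge_at_top])
      ultimately show "\<forall>\<^sub>F n in F. J n (steps s n) (v n (steps t n)) y \<le>
          v n (steps t n + steps s n) y + A * \<epsilon> * (real (steps s n) * h n) / \<kappa> y"
        by eventually_elim (intro discrete sum_le; simp)
    qed
    then show "S s (avg m (S t f)) y \<le> avg m (S (t + s) f) y + kappa_lip_upto (r' * kmax + r') T * r' * \<epsilon> * s / \<kappa> y"
      by (simp add: A_def R_def)
  qed
qed

end

section \<open>Comparison and uniqueness\<close>

context scheme
begin

text \<open>
  The function \<open>\<phi> s = S2 (t - s) (w s) x\<close> interpolates between \<open>S2 t (w 0) x\<close> and \<open>w t x\<close>, where \<open>w s\<close>
  is the average of \<open>S1 s f\<close>. For small \<open>u\<close> the value \<open>w (s + u)\<close> is at least \<open>S1 u (w s)\<close> up to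
  \<open>O (\<epsilon> * u)\<close>, and \<open>S1 u (w s)\<close> equals \<open>S2 u (w s)\<close> up to \<open>o (u)\<close>, because \<open>w s\<close> is smooth and the
  generators agree there. Applying \<open>S2 (t - s - u)\<close> shows that \<open>\<phi>\<close> decreases at most at a rate of order
  \<open>\<epsilon>\<close>. The remainder \<open>o (u)\<close> is not uniform in \<open>s\<close>, which is harmless for a bound on Dini derivatives.
\<close>

lemma comparison_Lip_b:
  assumes L1: "limit_family \<kappa> h I F1 S1" and L2: "limit_family \<kappa> h I F2 S2"
    and f: "f \<in> Lip_b r" and t: "0 \<le> t"
  shows "S2 t f x \<le> S1 t f x"
proof -
  interpret L1: limit_family \<kappa> h I F1 S1 by (rule L1)
  interpret L2: limit_family \<kappa> h I F2 S2 by (rule L2)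
  define r' where "r' = exp (lip_growth * t) * r"
  define A where "A = kappa_lip_upto (r' * kmax + r') t * r'"
  define R0 where "R0 = exp (growth * t) * (r' * kmax) + A"
  define A1 where "A1 = kappa_lip_upto R0 t * A"
  define A2 where "A2 = kappa_lip_upto (r' * kmax) t * (r * kmax)"
  have "0 \<le> r" by (rule Lip_b_nonneg[OF f])
  then have "0 \<le> r'" by (simp add: r'_def)
  then have "0 \<le> A" by (simp add: A_def kappa_lip_upto_def)
  have "r \<le> r'"
    using \<open>0 \<le> r\<close> lip_growth_nonneg t by (simp add: r'_def mult_le_cancel_right1)
  have f': "f \<in> Lip_b r'" by (rule Lip_b_mono[OF f \<open>r \<le> r'\<close>])
  have fC: "f \<in> C" by (rule Lip_b_C[OF f])
  have bound: "S2 t f x \<le> S1 t f x + \<epsilon> * (r' + (A1 / \<kappa> x + 1) * t + A2 / \<kappa> x)"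
    if \<epsilon>: "0 < \<epsilon>" "\<epsilon> \<le> 1" for \<epsilon>
  proof -
    obtain \<delta>0 where \<delta>0: "0 < \<delta>0"
      and super: "\<And>\<delta> m s u y. \<delta> \<le> \<delta>0 \<Longrightarrow> kernel \<delta> m \<Longrightarrow>
        (\<And>g. continuous_on UNIV g \<Longrightarrow> bounded (range g) \<Longrightarrow> continuous_on UNIV (avg m g)) \<Longrightarrow>
        0 \<le> s \<Longrightarrow> 0 \<le> u \<Longrightarrow> s + u \<le> t \<Longrightarrow>
        S1 s (avg m (S1 u f)) y \<le> avg m (S1 (u + s) f) y + A * \<epsilon> * s / \<kappa> y"
      using L1.S_avg_le[OF f t \<epsilon>] unfolding r'_def A_def by blast
    define \<delta> where "\<delta> = min \<delta>0 \<epsilon>"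
    have \<delta>: "0 < \<delta>" "\<delta> \<le> \<delta>0" "\<delta> \<le> \<epsilon>" using \<delta>0 \<epsilon> by (auto simp: \<delta>_def)
    obtain m :: "real ^ 'd \<Rightarrow> real" where m: "kernel \<delta> m"
      and m_smooth: "\<And>g. continuous_on UNIV g \<Longrightarrow> bounded (range g) \<Longrightarrow>
        avg m g \<in> Cb_infinity \<and> (\<exists>L\<ge>0. avg m g \<in> Lip_b L)"
      using exists_smooth_kernel[OF \<delta>(1)] by blast
    have m_cont: "continuous_on UNIV (avg m g)" if "continuous_on UNIV g" "bounded (range g)" for g
      using m_smooth[OF that] Lip_b_continuous by blast
    have Lip_bounded: "bounded (range g)" if "g \<in> Lip_b L" for g :: "real ^ 'd \<Rightarrow> real" and L
      using that by (auto simp: Lip_b_def bounded_iff)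
    have avg_ball': "avg m g \<in> B (L * kmax)" if "g \<in> Lip_b L" for g L
      using avg_close[OF m Lip_b_continuous[OF that], of _ 0 L] that
      by (intro bounded_ball m_cont Lip_b_continuous[OF that] Lip_bounded[OF that]) (auto simp: Lip_b_def)
    have avg_near: "\<bar>avg m g y - g y\<bar> \<le> L * \<delta>" if "g \<in> Lip_b L" for g L y
    proof (rule avg_close[OF m Lip_b_continuous[OF that]])
      fix u :: "real ^ 'd" assume "norm u \<le> \<delta>"
      then show "\<bar>g (y + u) - g y\<bar> \<le> L * \<delta>"
        using Lip_b_D[OF that, of "y + u" y] mult_left_mono[OF _ Lip_b_nonneg[OF that], of "norm u" \<delta>] by simp
    qed
    have SL: "S1 s f \<in> Lip_b r'" if "0 \<le> s" "s \<le> t" for s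
      unfolding r'_def by (rule L1.S_Lip_b[OF f that])
    define w where "w s = avg m (S1 s f)" for s
    have w_smooth: "w s \<in> Cb_infinity" and w_ball: "w s \<in> B (r' * kmax)" if "0 \<le> s" "s \<le> t" for s
      unfolding w_def
      using m_smooth[OF Lip_b_continuous[OF SL[OF that]] Lip_bounded[OF SL[OF that]]] avg_ball'[OF SL[OF that]] by auto
    have w_C: "w s \<in> C" if "0 \<le> s" "s \<le> t" for s
      by (rule ball_kappa_C[OF w_ball[OF that]])
    define \<phi> where "\<phi> s = S2 (t - s) (w s) x" for s
    have \<phi>_cont: "continuous_on {0..t} \<phi>"
      unfolding continuous_on_def
    proof
      fix s assume s: "s \<in> {0..t}"
      let ?F = "at s within {0..t}"
      have in_range: "\<forall>\<^sub>F s' in ?F. s' \<in> {0..t}" by (auto simp: eventually_at_filter)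
      have w_lim: "uniform_limit K w (w s) ?F" if "compact K" for K
        unfolding w_def
      proof (rule avg_uniform_limit[OF m that])
        show "\<forall>\<^sub>F s' in ?F. continuous_on UNIV (S1 s' f)"
          using in_range by eventually_elim (use Lip_b_continuous[OF SL] in auto)
        show "continuous_on UNIV (S1 s f)" using Lip_b_continuous[OF SL] s by auto
        show "uniform_limit K' (\<lambda>s'. S1 s' f) (S1 s f) ?F" if "compact K'" for K'
        proof (rule L1.S_joint_cont[where g = "\<lambda>_. f", OF fC that _ uniform_limit_const_fun])
          show "\<forall>\<^sub>F s' in ?F. f \<in> B (r * kmax)" using Lip_b_ball[OF f] by simp
          show "((\<lambda>s'. s') \<longlongrightarrow> s) ?F" by (rule tendsto_ident_at)
          show "\<forall>\<^sub>F s' in ?F. 0 \<le> s'" using in_range by eventually_elim simp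
        qed (use s in simp)
      qed
      have "uniform_limit {x} (\<lambda>s'. S2 (t - s') (w s')) (S2 (t - s) (w s)) ?F"
      proof (rule L2.S_joint_cont[OF _ _ _ w_lim])
        show "w s \<in> C" using w_C s by auto
        show "\<forall>\<^sub>F s' in ?F. w s' \<in> B (r' * kmax)" using in_range by eventually_elim (use w_ball in auto)
        show "((\<lambda>s'. t - s') \<longlongrightarrow> t - s) ?F" by (intro tendsto_intros)
        show "\<forall>\<^sub>F s' in ?F. 0 \<le> t - s'" using in_range by eventually_elim simp
      qed (use s in auto)
      then show "(\<phi> \<longlongrightarrow> \<phi> s) ?F"
        unfolding \<phi>_def by (rule tendsto_uniform_limitI) simp
    qed
    define c where "c = A1 * \<epsilon> / \<kappa> x + \<epsilon>"
    have step: "\<exists>d>0. \<forall>u. 0 < u \<and> u < d \<and> s + u \<le> t \<longrightarrow> \<phi> s - c * u \<le> \<phi> (s + u)"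
      if s: "0 \<le> s" "s < t" for s
    proof -
      define g where "g = w s"
      have g_smooth: "g \<in> Cb_infinity" and g_ball: "g \<in> B (r' * kmax)" and gC: "g \<in> C"
        using w_smooth[of s] w_ball[of s] w_C[of s] s by (auto simp: g_def)
      obtain a M where a: "a \<in> B M" "\<And>n. (\<lambda>x. (I (h n) g x - g x) / h n) \<in> B M"
        "\<And>K. compact K \<Longrightarrow> uniform_limit K (\<lambda>n x. (I (h n) g x - g x) / h n) a sequentially"
        using consistency[OF g_smooth] by blast
      obtain N where N: "0 \<le> N" "\<And>n k. real k * h n \<le> 1 \<Longrightarrow> (\<lambda>x. J n k g x - g x) \<in> B (N * (real k * h n))"
        using J_smooth_time[OF g_smooth] by blast
      \<comment> \<open>The radius \<open>Q\<close> depends on the kernel through \<open>N\<close>; it enters only the choice of the range of \<open>u\<close>.\<close>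
      define Q where "Q = R0 + 4 * N"
      have "0 \<le> R0" using \<open>0 \<le> A\<close> \<open>0 \<le> r'\<close> kmax_pos by (simp add: R0_def)
      then have "0 \<le> Q" using N(1) by (simp add: Q_def)
      have "0 < \<epsilon> / 2" using \<epsilon> by simp
      obtain K' c' where K': "compact K'" "0 \<le> c'"
        and loc: "\<And>\<tau>. 0 \<le> \<tau> \<Longrightarrow> \<tau> \<le> t \<Longrightarrow> controls Q {x} K' c' (\<epsilon> / 2) (S2 \<tau>)"
        using L2.S_local[OF \<open>0 < \<epsilon> / 2\<close> \<open>0 \<le> Q\<close> t compact_sing[of x]] by blast
      define \<eta> where "\<eta> = \<epsilon> / (4 * (c' + 1))"
      have \<eta>: "0 < \<eta>" "c' * (2 * \<eta>) \<le> \<epsilon> / 2"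
        using \<epsilon> \<open>0 \<le> c'\<close> by (auto simp: \<eta>_def field_simps)
      obtain d1 where d1: "0 < d1" "\<And>u y. 0 \<le> u \<Longrightarrow> u \<le> d1 \<Longrightarrow> y \<in> K' \<Longrightarrow> \<bar>S1 u g y - g y - u * a y\<bar> \<le> u * \<eta>"
        using L1.S_generator[OF a gC K'(1) \<eta>(1)] by blast
      obtain d2 where d2: "0 < d2" "\<And>u y. 0 \<le> u \<Longrightarrow> u \<le> d2 \<Longrightarrow> y \<in> K' \<Longrightarrow> \<bar>S2 u g y - g y - u * a y\<bar> \<le> u * \<eta>"
        using L2.S_generator[OF a gC K'(1) \<eta>(1)] by blast
      have "\<phi> s - c * u \<le> \<phi> (s + u)" if u: "0 < u" "u < min 1 (min d1 d2)" "s + u \<le> t" for u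
      proof -
        define \<tau> where "\<tau> = t - s - u"
        have \<tau>: "0 \<le> \<tau>" "\<tau> \<le> t" using u s by (auto simp: \<tau>_def)
        have u1: "u \<le> 1" "u \<le> d1" "u \<le> d2" "0 \<le> u" "u \<le> t" using u s by auto
        have S1g: "S1 u g \<in> C" and S2g: "S2 u g \<in> B (exp (growth * t) * (r' * kmax))"
          using L1.S_C[OF gC] L2.S_ball[OF g_ball] u1 by auto
        \<comment> \<open>\<open>e\<close> is the remainder divided by \<open>u\<close>: bounded in the weighted norm and small on \<open>K'\<close>.\<close>
        define e where "e y = \<bar>S1 u g y - S2 u g y\<bar> / u" for y
        define p where "p y = S2 u g y - A * \<epsilon> * u / \<kappa> y" for y
        have p_err: "(\<lambda>y. A * \<epsilon> * u / \<kappa> y) \<in> B (A * \<epsilon> * u)"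
          using kappa_pos \<open>0 \<le> A\<close> \<epsilon> u(1)
          by (auto simp: ball_kappa_iff abs_of_pos abs_mult less_imp_neq[THEN not_sym] intro!: continuous_intros kappa_cont)
        have "A * \<epsilon> * u \<le> A * 1 * 1" using \<open>0 \<le> A\<close> \<epsilon> u1 by (intro mult_mono) auto
        then have pR: "p \<in> B R0" and S2R: "S2 u g \<in> B R0"
          using ball_kappa_mono[OF ball_diff[OF S2g p_err], of R0] ball_kappa_mono[OF S2g, of R0] \<open>0 \<le> A\<close>
          by (auto simp: p_def[abs_def] R0_def)
        have e_ball: "e \<in> B (2 * N)"
          unfolding ball_kappa_iff
        proof (intro conjI allI)
          show "continuous_on UNIV e"
            unfolding e_def using u(1)
            by (intro continuous_intros C_kappa_continuous[OF S1g] ball_kappa_continuous[OF S2g]) auto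
          fix y
          have "e y * \<kappa> y = \<bar>S1 u g y - S2 u g y\<bar> * \<kappa> y / u" by (simp add: e_def)
          also have "\<dots> \<le> (\<bar>S1 u g y - g y\<bar> * \<kappa> y + \<bar>S2 u g y - g y\<bar> * \<kappa> y) / u"
            unfolding distrib_right[symmetric] using u(1) kappa_pos[of y]
            by (intro divide_right_mono mult_right_mono) auto
          also have "\<dots> \<le> (N * u + N * u) / u"
            using u(1) u1 by (intro divide_right_mono add_mono L1.S_smooth_time[OF N(2) gC] L2.S_smooth_time[OF N(2) gC]) auto
          also have "\<dots> = 2 * N" using u(1) by simp
          finally show "\<bar>e y\<bar> * \<kappa> y \<le> 2 * N" using u(1) by (simp add: e_def)
        qed
        have e_small: "e y \<le> 2 * \<eta>" if "y \<in> K'" for y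
        proof -
          have "\<bar>S1 u g y - S2 u g y\<bar> \<le> u * (2 * \<eta>)"
            using d1(2)[of u y] d2(2)[of u y] u1 that by (simp add: algebra_simps)
          then show ?thesis using u(1) by (simp add: e_def divide_le_eq mult.commute)
        qed
        \<comment> \<open>Both errors are subtracted in turn: the one of order \<open>\<epsilon>\<close> is estimated in the weighted norm, with a constant independent of the kernel, and \<open>u * e\<close> by convexity.\<close>
        define l where "l y = p y - u * e y" for y
        have lQ: "l \<in> B Q" and leQ: "(\<lambda>y. l y + e y) \<in> B Q"
        proof -
          have "l \<in> B (R0 + \<bar>u\<bar> * (2 * N))" unfolding l_def by (rule ball_diff[OF pR ball_scale[OF e_ball]])
          moreover have "u * (2 * N) \<le> 2 * N" using u1 N(1) by (simp add: mult_left_le_one_le)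
          ultimately have l: "l \<in> B (R0 + 2 * N)" using u(1) by (elim ball_kappa_mono) simp
          show "l \<in> B Q" using l N(1) by (elim ball_kappa_mono) (simp add: Q_def)
          show "(\<lambda>y. l y + e y) \<in> B Q" by (rule ball_kappa_mono[OF ball_add[OF l e_ball]]) (simp add: Q_def)
        qed
        have wsu: "w (s + u) \<in> C" using w_C[of "s + u"] s u by auto
        have l_le: "l y \<le> w (s + u) y" for y
        proof -
          have "S1 u g y \<le> w (s + u) y + A * \<epsilon> * u / \<kappa> y"
            unfolding g_def w_def using super[OF \<delta>(2) m m_cont, of u s y] s u by simp
          moreover have "u * e y = \<bar>S1 u g y - S2 u g y\<bar>" using u(1) by (simp add: e_def)
          ultimately show ?thesis unfolding l_def p_def by linarith
        qed
        have "\<phi> s = S2 (\<tau> + u) g x" by (simp add: \<phi>_def \<tau>_def g_def)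
        also have "\<dots> = S2 \<tau> (S2 u g) x" using L2.S_add[OF gC \<tau>(1) u1(4)] by simp
        also have "\<dots> \<le> S2 \<tau> p x + A1 * \<epsilon> * u / \<kappa> x"
        proof -
          have "(\<lambda>y. S2 u g y - p y) \<in> B (A * \<epsilon> * u)" using p_err by (simp add: p_def)
          from L2.S_kappa_lip[OF S2R pR this \<tau>, of x]
          have "\<bar>S2 \<tau> (S2 u g) x - S2 \<tau> p x\<bar> * \<kappa> x \<le> A1 * \<epsilon> * u" by (simp add: A1_def mult.assoc)
          then show ?thesis using kappa_pos[of x] by (simp add: pos_le_divide_eq[symmetric] abs_le_iff)
        qed
        also have "S2 \<tau> p x \<le> S2 \<tau> l x + u * \<epsilon>"
        proof -
          have "S2 \<tau> (\<lambda>y. l y + u * e y) x - S2 \<tau> l x \<le> u * (S2 \<tau> (\<lambda>y. l y + e y) x - S2 \<tau> l x)"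
            using u1 by (intro convex_op_secant[OF L2.S_convex[OF \<tau>(1)] ball_kappa_C[OF lQ] ball_kappa_C[OF e_ball]]) auto
          also have "\<dots> \<le> u * \<epsilon>"
          proof (intro mult_left_mono u1(4))
            have "\<bar>S2 \<tau> (\<lambda>y. l y + e y) x - S2 \<tau> l x\<bar> \<le> c' * (2 * \<eta>) + \<epsilon> / 2"
            proof (rule controlsD[OF loc[OF \<tau>] leQ lQ])
              show "\<bar>l y + e y - l y\<bar> \<le> 2 * \<eta>" if "y \<in> K'" for y
                using e_small[OF that] u(1) by (simp add: e_def)
            qed (use \<eta>(1) in auto)
            then show "S2 \<tau> (\<lambda>y. l y + e y) x - S2 \<tau> l x \<le> \<epsilon>" using \<eta>(2) by linarith
          qed
          finally show ?thesis by (simp add: l_def)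
        qed
        also have "S2 \<tau> l x \<le> S2 \<tau> (w (s + u)) x"
          by (rule L2.S_mono[OF ball_kappa_C[OF lQ] wsu l_le \<tau>(1)])
        also have "\<dots> = \<phi> (s + u)" by (simp add: \<phi>_def \<tau>_def algebra_simps)
        finally show ?thesis by (simp add: c_def algebra_simps)
      qed
      then show ?thesis using d1(1) d2(1) by (intro exI[of _ "min 1 (min d1 d2)"]) auto
    qed
    from lower_dini_bound[OF \<phi>_cont t step] have "\<phi> 0 - c * t \<le> \<phi> t" by simp
    moreover have "\<phi> t \<le> S1 t f x + r' * \<epsilon>"
    proof -
      have wt: "w t \<in> C" using w_C[of t] t by auto
      have "\<bar>avg m (S1 t f) x - S1 t f x\<bar> \<le> r' * \<delta>" using t by (intro avg_near SL) auto
      moreover have "r' * \<delta> \<le> r' * \<epsilon>" using \<delta>(3) \<open>0 \<le> r'\<close> by (rule mult_left_mono)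
      ultimately show ?thesis by (simp add: \<phi>_def L2.S_zero_time[OF wt]) (simp add: w_def)
    qed
    moreover have "S2 t f x \<le> \<phi> 0 + A2 * \<epsilon> / \<kappa> x"
    proof -
      have w0: "w 0 = avg m f" by (simp add: w_def L1.S_zero_time[OF fC])
      have "\<bar>f y - avg m f y\<bar> \<le> r * \<epsilon>" for y
        using avg_near[OF f, of y] mult_left_mono[OF \<delta>(3) \<open>0 \<le> r\<close>] by (simp add: abs_minus_commute)
      then have "(\<lambda>y. f y - avg m f y) \<in> B (r * \<epsilon> * kmax)"
        by (intro bounded_ball continuous_intros Lip_b_continuous[OF f] m_cont Lip_bounded[OF f]) auto
      from L2.S_kappa_lip[OF Lip_b_ball[OF f'] avg_ball'[OF f'] this t order_refl, of x]
      have "\<bar>S2 t f x - S2 t (avg m f) x\<bar> * \<kappa> x \<le> A2 * \<epsilon>" by (simp add: A2_def mult_ac)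
      then show ?thesis
        using kappa_pos[of x] by (simp add: \<phi>_def w0 pos_le_divide_eq[symmetric] abs_le_iff)
    qed
    ultimately show ?thesis by (simp add: c_def algebra_simps)
  qed
  show ?thesis
  proof (rule tendsto_lowerbound)
    have "((\<lambda>\<epsilon>. S1 t f x + \<epsilon> * (r' + (A1 / \<kappa> x + 1) * t + A2 / \<kappa> x)) \<longlongrightarrow>
        S1 t f x + 0 * (r' + (A1 / \<kappa> x + 1) * t + A2 / \<kappa> x)) (at_right 0)"
      by (intro tendsto_intros)
    then show "((\<lambda>\<epsilon>. S1 t f x + \<epsilon> * (r' + (A1 / \<kappa> x + 1) * t + A2 / \<kappa> x)) \<longlongrightarrow> S1 t f x) (at_right 0)"
      by simp
    have "\<forall>\<^sub>F \<epsilon> in at_right (0::real). \<epsilon> < 1" by (rule eventually_at_right_less[THEN eventually_rev_mp]) (rule eventually_at_rightI[of 0 1], auto)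
    moreover have "\<forall>\<^sub>F \<epsilon> in at_right (0::real). 0 < \<epsilon>" by (rule eventually_at_right_less)
    ultimately show "\<forall>\<^sub>F \<epsilon> in at_right 0. S2 t f x \<le> S1 t f x + \<epsilon> * (r' + (A1 / \<kappa> x + 1) * t + A2 / \<kappa> x)"
      by eventually_elim (use bound in auto)
  qed simp
qed

text \<open>
  Exchanging the two families in the comparison gives equality on Lipschitz functions, and these are
  dense for the convergence for which both families are continuous.
\<close>

theorem limit_family_unique:
  assumes L1: "limit_family \<kappa> h I F1 S1" and L2: "limit_family \<kappa> h I F2 S2"
    and f: "f \<in> C" and t: "0 \<le> t"
  shows "S1 t f x = S2 t f x"
proof -
  interpret L1: limit_family \<kappa> h I F1 S1 by (rule L1)
  interpret L2: limit_family \<kappa> h I F2 S2 by (rule L2)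
  obtain r where r: "0 \<le> r" "f \<in> B r" using C_ball[OF f] by auto
  define R where "R = max r (krat * r)"
  have "0 \<le> R" using r by (simp add: R_def)
  have "\<bar>S1 t f x - S2 t f x\<bar> \<le> \<epsilon>" if "0 < \<epsilon>" for \<epsilon>
  proof -
    have "0 < \<epsilon> / 4" using that by simp
    obtain K1 c1 where K1: "compact K1" "0 \<le> c1"
      "\<And>s. 0 \<le> s \<Longrightarrow> s \<le> t \<Longrightarrow> controls R {x} K1 c1 (\<epsilon> / 4) (S1 s)"
      using L1.S_local[OF \<open>0 < \<epsilon> / 4\<close> \<open>0 \<le> R\<close> t compact_sing[of x]] by blast
    obtain K2 c2 where K2: "compact K2" "0 \<le> c2"
      "\<And>s. 0 \<le> s \<Longrightarrow> s \<le> t \<Longrightarrow> controls R {x} K2 c2 (\<epsilon> / 4) (S2 s)"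
      using L2.S_local[OF \<open>0 < \<epsilon> / 4\<close> \<open>0 \<le> R\<close> t compact_sing[of x]] by blast
    define \<eta> where "\<eta> = \<epsilon> / 4 / (c1 + c2 + 1)"
    have \<eta>: "0 < \<eta>" "c1 * \<eta> \<le> \<epsilon> / 4" "c2 * \<eta> \<le> \<epsilon> / 4"
    proof -
      have "c1 + c2 + 1 \<noteq> 0" using K1(2) K2(2) by linarith
      from nonzero_eq_divide_eq[OF this, THEN iffD1, OF \<eta>_def]
      have eq: "(c1 + c2 + 1) * \<eta> = \<epsilon> / 4" by (simp only: mult.commute)
      show "0 < \<eta>" using \<open>0 < \<epsilon>\<close> K1(2) K2(2) by (simp add: \<eta>_def)
      then have "0 \<le> c1 * \<eta>" "0 \<le> c2 * \<eta>" using K1(2) K2(2) by simp_all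
      then show "c1 * \<eta> \<le> \<epsilon> / 4" "c2 * \<eta> \<le> \<epsilon> / 4" using eq \<open>0 < \<eta>\<close> by (simp_all add: distrib_right)
    qed
    obtain g L where g: "g \<in> Lip_b L" "g \<in> B (krat * r)" "\<And>x. x \<in> K1 \<union> K2 \<Longrightarrow> \<bar>f x - g x\<bar> \<le> \<eta>"
      using smooth_dense[OF r(2) compact_Un[OF K1(1) K2(1)] \<eta>(1)] by blast
    have R: "f \<in> B R" "g \<in> B R"
      using ball_kappa_mono[OF r(2), of R] ball_kappa_mono[OF g(2), of R] by (auto simp: R_def)
    have "\<bar>S1 t f x - S1 t g x\<bar> \<le> c1 * \<eta> + \<epsilon> / 4"
      using g(3) \<eta>(1) by (intro controlsD[OF K1(3)[OF t order_refl] R]) auto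
    moreover have "\<bar>S2 t f x - S2 t g x\<bar> \<le> c2 * \<eta> + \<epsilon> / 4"
      using g(3) \<eta>(1) by (intro controlsD[OF K2(3)[OF t order_refl] R]) auto
    moreover have "S1 t g x = S2 t g x"
      using comparison_Lip_b[OF L1 L2 g(1) t, of x] comparison_Lip_b[OF L2 L1 g(1) t, of x] by simp
    ultimately show ?thesis using \<eta> by linarith
  qed
  then show ?thesis using field_le_epsilon[of "\<bar>S1 t f x - S2 t f x\<bar>" 0] by simp
qed

end

section \<open>Existence and convergence of the whole sequence\<close>

text \<open>
  Tychonoff's theorem in place of a diagonal argument: the sequence of functions \<open>a n\<close> lies in a
  compact product of intervals, so that it has a cluster point along \<open>G\<close>.
\<close>

lemma bounded_family_converges_along_filter:
  fixes a :: "nat \<Rightarrow> 'i \<Rightarrow> real"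
  assumes "G \<noteq> bot" and bounded: "\<And>n i. \<bar>a n i\<bar> \<le> b i"
  obtains F l where "F \<le> G" and "F \<noteq> bot" and "\<And>i. ((\<lambda>n. a n i) \<longlongrightarrow> l i) F"
proof -
  let ?U = "PiE UNIV (\<lambda>i. {- b i..b i})"
  have "compactin (product_topology (\<lambda>_. euclidean) UNIV) ?U"
    by (simp add: compactin_PiE)
  then have "compact ?U" by (simp add: euclidean_product_topology)
  moreover have "filtermap a G \<noteq> bot" using assms(1) by (simp add: filtermap_bot_iff)
  moreover have "\<forall>\<^sub>F x in filtermap a G. x \<in> ?U"
  proof -
    have "- b i \<le> a n i \<and> a n i \<le> b i" for n i using bounded[of n i] by linarith
    then show ?thesis by (simp add: eventually_filtermap PiE_UNIV_domain)
  qed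
  ultimately obtain l where l: "inf (nhds l) (filtermap a G) \<noteq> bot"
    unfolding compact_filter by blast
  define F where "F = inf G (filtercomap a (nhds l))"
  have "F \<noteq> bot"
  proof
    assume "F = bot"
    then have "\<forall>\<^sub>F n in inf G (filtercomap a (nhds l)). False" by (simp add: F_def)
    then obtain P Q where PQ: "eventually P G" "eventually Q (filtercomap a (nhds l))" "\<And>n. P n \<Longrightarrow> \<not> Q n"
      unfolding eventually_inf by auto
    then obtain R where R: "eventually R (nhds l)" "\<And>n. R (a n) \<Longrightarrow> Q n"
      unfolding eventually_filtercomap by auto
    have "\<forall>\<^sub>F n in G. \<not> R (a n)" using PQ(1) by eventually_elim (use PQ(3) R(2) in blast)
    then have "\<forall>\<^sub>F x in filtermap a G. \<not> R x" by (simp add: eventually_filtermap)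
    then have "\<forall>\<^sub>F x in inf (nhds l) (filtermap a G). False"
      using R(1) unfolding eventually_inf by (intro exI[of _ R] exI[of _ "\<lambda>x. \<not> R x"]) auto
    then show False using l by (simp add: eventually_False)
  qed
  moreover have "F \<le> filtercomap a (nhds l)" by (simp add: F_def)
  then have "(a \<longlongrightarrow> l) F" by (simp add: filterlim_iff_le_filtercomap)
  then have "((\<lambda>n. a n i) \<longlongrightarrow> l i) F" for i
    by (rule continuous_on_tendsto_compose[OF continuous_on_product_coordinates]) auto
  ultimately show ?thesis by (intro that[of F l]) (auto simp: F_def)
qed

context scheme
begin

lemma exists_limit_family:
  assumes "G \<noteq> bot" and "G \<le> sequentially"
  obtains F S where "F \<le> G" and "limit_family \<kappa> h I F S"
proof -
  define a where "a n i = (case i of (t, f, x) \<Rightarrow>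
      if 0 \<le> t \<and> f \<in> C then J n (num_steps (h n) t) f x else 0)" for n i
  define b where "b i = (case i of (t, f, x) \<Rightarrow> exp (growth * t) * \<bar>wnorm \<kappa> f\<bar> / \<kappa> x)" for i
  have "\<bar>a n i\<bar> \<le> b i" for n i
  proof (cases i)
    case (fields t f x)
    show ?thesis
    proof (cases "0 \<le> t \<and> f \<in> C")
      case True
      then have "f \<in> B \<bar>wnorm \<kappa> f\<bar>" by (simp add: ball_kappa_def)
      moreover have "real (num_steps (h n) t) * h n \<le> t" using True by (intro num_steps_props h_pos) simp
      ultimately have "\<bar>J n (num_steps (h n) t) f x\<bar> * \<kappa> x \<le> exp (growth * t) * \<bar>wnorm \<kappa> f\<bar>"
        by (intro ball_kappa_D J_ball)
      then show ?thesis using True kappa_pos[of x] by (simp add: fields a_def b_def le_divide_eq)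
    next
      case False
      then show ?thesis using kappa_pos[of x] by (auto simp: fields a_def b_def)
    qed
  qed
  then obtain F l where F: "F \<le> G" "F \<noteq> bot" "\<And>i. ((\<lambda>n. a n i) \<longlongrightarrow> l i) F"
    using bounded_family_converges_along_filter[OF assms(1), of a b] by blast
  have "limit_family \<kappa> h I F (\<lambda>t f x. l (t, f, x))"
  proof unfold_locales
    show "F \<le> sequentially" using F(1) assms(2) by (rule order_trans)
    show "((\<lambda>n. J n (num_steps (h n) t) f x) \<longlongrightarrow> l (t, f, x)) F" if "0 \<le> t" "f \<in> C_kappa \<kappa>" for t f x
      using F(3)[of "(t, f, x)"] that by (simp add: a_def)
  qed (rule F(2))
  then show ?thesis by (rule that[OF F(1)])
qed

text \<open>
  Let \<open>S\<close> be a limit family along some filter. If the iterates did not converge to \<open>S t f x\<close> along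
  the whole sequence, the indices at which they stay away from this value would form a filter that
  carries, after refinement, a limit family with a different value, against uniqueness.
\<close>

theorem exists_limit_family_sequentially: "\<exists>S. limit_family \<kappa> h I sequentially S"
proof -
  obtain F S where S: "limit_family \<kappa> h I F S"
    using exists_limit_family[OF sequentially_bot order_refl] by blast
  have "(\<lambda>n. J n (num_steps (h n) t) f x) \<longlonglongrightarrow> S t f x" if t: "0 \<le> t" and f: "f \<in> C" for t f x
  proof (rule ccontr)
    let ?a = "\<lambda>n. J n (num_steps (h n) t) f x"
    assume "\<not> ?a \<longlonglongrightarrow> S t f x"
    then obtain e where e: "0 < e" "\<not> (\<forall>\<^sub>F n in sequentially. dist (?a n) (S t f x) < e)"
      unfolding tendsto_iff by blast
    define G where "G = inf sequentially (principal {n. \<not> dist (?a n) (S t f x) < e})"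
    have "G \<noteq> bot" using e(2) by (simp add: G_def trivial_limit_def eventually_inf_principal)
    moreover have "G \<le> sequentially" by (simp add: G_def)
    ultimately obtain F' S' where F': "F' \<le> G" and S': "limit_family \<kappa> h I F' S'"
      by (rule exists_limit_family)
    interpret L: limit_family \<kappa> h I F' S' by (rule S')
    have "(?a \<longlongrightarrow> S t f x) F'"
      using L.S_lim[OF t f, of x] limit_family_unique[OF S' S f t] by simp
    then have "\<forall>\<^sub>F n in F'. dist (?a n) (S t f x) < e" using e(1) by (rule tendstoD)
    moreover have "\<forall>\<^sub>F n in F'. \<not> dist (?a n) (S t f x) < e"
      by (rule filter_leD[OF F']) (simp add: G_def eventually_inf_principal)
    ultimately have "\<forall>\<^sub>F n in F'. False" by eventually_elim simp
    then show False using L.F_nontrivial by (simp add: eventually_False)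
  qed
  then have "limit_family \<kappa> h I sequentially S"
    by unfold_locales auto
  then show ?thesis by (intro exI[of _ S])
qed

end

text \<open>
  On the dense set of times both sides are limits of the same subsequence. A general time \<open>t\<close> is
  approached from the right, where strong continuity at \<open>S' t f\<close> and the semigroup property of \<open>S'\<close>
  provide \<open>S' (s n) f = S' (s n - t) (S' t f)\<close>, which tends to \<open>S' t f\<close>.
\<close>

lemma limit_semigroup_eq:
  assumes T: "\<T> \<subseteq> {0..}" "{0..} \<subseteq> closure \<T>"
    and S: "limit_family \<kappa> h I sequentially S"
    and S': "limit_semigroup \<kappa> h \<T> I \<nu> S'"
    and t: "0 \<le> t" and f: "f \<in> C_kappa \<kappa>"
  shows "S' t f = S t f"
proof
  fix x
  interpret limit_family \<kappa> h I sequentially S by (rule S)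
  have semi: "convex_monotone_semigroup \<kappa> S'" and cont: "strongly_continuous \<kappa> S'" and "strict_mono \<nu>"
    and lim: "\<And>f t. f \<in> C \<Longrightarrow> t \<in> \<T> \<Longrightarrow> mixed_lim \<kappa> (\<lambda>l. iterate I h (\<nu> l) t f) (S' t f)"
    using S' by (auto simp: limit_semigroup_def)
  have on_T: "S' t f x = S t f x" if "t \<in> \<T>" for t
  proof -
    have "uniform_limit {x} (\<lambda>l. iterate I h (\<nu> l) t f) (S' t f) sequentially"
      using lim[OF f that] compact_sing[of x] unfolding mixed_lim_iff by blast
    then have "(\<lambda>l. J (\<nu> l) (num_steps (h (\<nu> l)) t) f x) \<longlonglongrightarrow> S' t f x"
      unfolding iterate_eq_J by (rule tendsto_uniform_limitI) simp
    moreover have "0 \<le> t" using that T(1) by auto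
    then have "(\<lambda>l. J (\<nu> l) (num_steps (h (\<nu> l)) t) f x) \<longlonglongrightarrow> S t f x"
      using LIMSEQ_subseq_LIMSEQ[OF S_lim[OF _ f, of t x] \<open>strict_mono \<nu>\<close>] by (simp add: o_def)
    ultimately show ?thesis by (rule LIMSEQ_unique)
  qed
  have "\<exists>s\<in>\<T>. t < s \<and> s < t + 1 / real (Suc n)" for n
  proof -
    have "t + 1 / real (2 * Suc n) \<in> closure \<T>" using T(2) t by auto
    moreover have "0 < 1 / real (2 * Suc n)" by simp
    ultimately obtain s where s: "s \<in> \<T>" "dist s (t + 1 / real (2 * Suc n)) < 1 / real (2 * Suc n)"
      unfolding closure_approachable by blast
    have "1 / real (Suc n) = 2 * (1 / real (2 * Suc n))" by (simp add: field_simps)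
    with s(2) have "t < s" "s < t + 1 / real (Suc n)" by (simp_all only: dist_real_def abs_less_iff) linarith+
    with s(1) show ?thesis by blast
  qed
  then obtain s where s: "\<And>n. s n \<in> \<T>" "\<And>n. t < s n" "\<And>n. s n < t + 1 / real (Suc n)" by metis
  have s_lim: "s \<longlonglongrightarrow> t"
  proof (rule tendsto_sandwich[where f = "\<lambda>_. t" and h = "\<lambda>n. t + 1 / real (Suc n)"])
    have "(\<lambda>n. t + 1 / real (Suc n)) \<longlonglongrightarrow> t + 0"
      by (intro tendsto_intros LIMSEQ_Suc[OF lim_1_over_n])
    then show "(\<lambda>n. t + 1 / real (Suc n)) \<longlonglongrightarrow> t" by simp
  qed (use s in \<open>auto intro!: always_eventually less_imp_le simp del: of_nat_Suc\<close>)
  have S't: "S' t f \<in> C" using semi f t by (auto simp: convex_monotone_semigroup_def)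
  have "(\<lambda>n. s n - t) \<longlonglongrightarrow> t - t" by (intro tendsto_intros s_lim)
  then have "mixed_lim \<kappa> (\<lambda>n. S' (s n - t) (S' t f)) (S' t f)"
    using cont S't s(2) by (simp add: strongly_continuous_def mixed_lim_at_right_0_def)
  then have "uniform_limit {x} (\<lambda>n. S' (s n - t) (S' t f)) (S' t f) sequentially"
    using compact_sing[of x] unfolding mixed_lim_iff by blast
  then have "(\<lambda>n. S' (s n - t) (S' t f) x) \<longlonglongrightarrow> S' t f x"
    by (rule tendsto_uniform_limitI) simp
  moreover have "S' (s n - t) (S' t f) x = S (s n) f x" for n
  proof -
    have "\<forall>s\<ge>0. \<forall>t\<ge>0. S' (s + t) f = S' s (S' t f)"
      using semi f by (simp add: convex_monotone_semigroup_def)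
    moreover have "0 \<le> s n - t" using s(2)[of n] by simp
    ultimately have "S' (s n - t + t) f = S' (s n - t) (S' t f)" using t by blast
    then have "S' (s n - t) (S' t f) = S' (s n) f" by simp
    then show ?thesis using on_T[OF s(1)] by simp
  qed
  ultimately have "(\<lambda>n. S (s n) f x) \<longlonglongrightarrow> S' t f x" by simp
  moreover have "uniform_limit {x} (\<lambda>n. S (s n) f) (S t f) sequentially"
    using s(2) t by (intro S_sequence_uniform[OF f _ s_lim]) (auto intro: less_imp_le order_trans)
  then have "(\<lambda>n. S (s n) f x) \<longlonglongrightarrow> S t f x"
    by (rule tendsto_uniform_limitI) simp
  ultimately show "S' t f x = S t f x" by (rule LIMSEQ_unique)
qed

lemma (in limit_family) S_mixed_lim:
  assumes "F = sequentially" and f: "f \<in> C" and t: "0 \<le> t"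
  shows "mixed_lim \<kappa> (\<lambda>n. iterate I h n t f) (S t f)"
  unfolding mixed_lim_iff iterate_eq_J
proof (intro conjI allI impI)
  obtain r where r: "f \<in> B r" using C_ball[OF f] by auto
  show "\<exists>M. \<forall>n. J n (steps t n) f \<in> B M" using J_ball[OF r steps_le[OF t]] by blast
  show "uniform_limit K (\<lambda>n. J n (steps t n) f) (S t f) sequentially" if "compact K" for K
    using S_uniform[OF f t that] assms(1) by simp
qed (rule S_C[OF f t])

theorem corollary5p11:
  fixes \<kappa> :: "real ^ 'd \<Rightarrow> real"
    and h :: "nat \<Rightarrow> real"
    and \<T> :: "real set"
    and I :: "real \<Rightarrow> (real ^ 'd \<Rightarrow> real) \<Rightarrow> (real ^ 'd \<Rightarrow> real)"
  assumes "\<forall>x. 0 < \<kappa> x" and "bounded (range \<kappa>)" and "continuous_on UNIV \<kappa>"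
    and "bdd_above {\<kappa> x / \<kappa> (x - y) | x y. norm y \<le> 1}"
    and "\<forall>n. 0 < h n" and "h \<longlonglongrightarrow> 0"
    and "countable \<T>" and "\<T> \<subseteq> {0..}" and "{0..} \<subseteq> closure \<T>" and "0 \<in> \<T>"
    and "\<forall>t\<ge>0. I t \<in> C_kappa \<kappa> \<rightarrow> C_kappa \<kappa>"
    and "assumption_A \<kappa> h I"
  shows "(\<exists>\<nu> S. limit_semigroup \<kappa> h \<T> I \<nu> S) \<and>
    (\<forall>\<nu>1 S1 \<nu>2 S2. limit_semigroup \<kappa> h \<T> I \<nu>1 S1 \<and> limit_semigroup \<kappa> h \<T> I \<nu>2 S2 \<longrightarrow>
       (\<forall>t\<ge>0. \<forall>f \<in> C_kappa \<kappa>. S1 t f = S2 t f)) \<and>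
    (\<forall>\<nu> S. limit_semigroup \<kappa> h \<T> I \<nu> S \<longrightarrow>
       (\<forall>f \<in> C_kappa \<kappa>. \<forall>t \<in> \<T>. mixed_lim \<kappa> (\<lambda>n. iterate I h n t f) (S t f)))"
proof -
  interpret scheme \<kappa> h I
    using assms by unfold_locales auto
  obtain S where S: "limit_family \<kappa> h I sequentially S"
    using exists_limit_family_sequentially by blast
  interpret L: limit_family \<kappa> h I sequentially S by (rule S)
  have T_nonneg: "0 \<le> t" if "t \<in> \<T>" for t using that assms(8) by auto
  have lim: "mixed_lim \<kappa> (\<lambda>n. iterate I h n t f) (S t f)" if "f \<in> C" "t \<in> \<T>" for f t
    by (rule L.S_mixed_lim[OF refl that(1) T_nonneg[OF that(2)]])
  have eq: "S' t f = S t f" if "limit_semigroup \<kappa> h \<T> I \<nu> S'" "0 \<le> t" "f \<in> C" for \<nu> S' t f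
    by (rule limit_semigroup_eq[OF assms(8,9) S that])
  have "limit_semigroup \<kappa> h \<T> I id S"
    unfolding limit_semigroup_def
    using L.S_convex_monotone_semigroup L.S_strongly_continuous lim by (simp add: strict_mono_def)
  moreover have "mixed_lim \<kappa> (\<lambda>n. iterate I h n t f) (S' t f)"
    if "limit_semigroup \<kappa> h \<T> I \<nu> S'" "f \<in> C" "t \<in> \<T>" for \<nu> S' f t
    using eq[OF that(1) T_nonneg[OF that(3)] that(2)] lim[OF that(2,3)] by simp
  moreover have "S1 t f = S2 t f"
    if "limit_semigroup \<kappa> h \<T> I \<nu>1 S1" "limit_semigroup \<kappa> h \<T> I \<nu>2 S2" "0 \<le> t" "f \<in> C" for \<nu>1 S1 \<nu>2 S2 t f
    using eq[OF that(1,3,4)] eq[OF that(2,3,4)] by simp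
  ultimately show ?thesis by blast
qed

end
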